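(* Fix integers $m\geq 1$ and $d\geq 2$. Let $X$ be a real random variable such that $\mathbb{E}[X]=0$, $\mathbb{E}[X^2]=1$, $\mathbb{E}[X^3]=0$, $\mathbb{E}[|X|^{4+\epsilon}]<\infty$ for some $\epsilon>0$, and $\mathbb{E}[X^4]\geq 3$. Let $\mathbf{X}=\{X_i\}_{i\geq 1}$ be a sequence of independent copies of $X$. For every $j=1,\dots,m$ and every $n\geq 1$, let $f_n^{(j)}:[n]^d\to\mathbb{R}$ be an admissible kernel, and let $Q_{\mathbf{X}}(f_n^{(j)})$ be the associated homogeneous sum of degree $d$. Assume that $$\lim_{n\to\infty}\mathbb{E}\big[Q_{\mathbf{X}}(f_n^{(j)})\,Q_{\mathbf{X}}(f_n^{(i)})\big]=C_{i,j}\qquad\text{for all } i,j=1,\dots,m,$$ where $C=(C_{i,j})_{i,j=1,\dots,m}$ is a real-valued, positive definite, symmetric matrix. Then the following statements are equivalent as $n\to\infty$: (i) $Q_{\mathbf{X}}(f_n^{(j)})$ converges in law to $\mathcal{N}(0,C_{j,j})$ for every $j=1,\dots,m$; (ii) $(Q_{\mathbf{X}}(f_n^{(1)}),\dots,Q_{\mathbf{X}}(f_n^{(m)}))$ converges in law to $\mathcal{N}(0,C)$, the $m$-dimensional centered Gaussian distribution with covariance matrix $C$.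
   Context: Write $[n]=\{1,\dots,n\}$. For $f:[n]^d\to\mathbb{R}$ and a sequence $\mathbf{X}=\{X_i\}_{i\geq1}$ of random variables, the homogeneous sum is $$Q_{\mathbf{X}}(f)=\sum_{i_1,\dots,i_d=1}^n f(i_1,\dots,i_d)\,X_{i_1}\cdots X_{i_d}.$$ A function $f:[n]^d\to\mathbb{R}$ is an admissible kernel if: (a) it vanishes on diagonals, i.e. $f(i_1,\dots,i_d)=0$ whenever $i_j=i_k$ for some $j\neq k$; (b) it is symmetric, i.e. $f(i_1,\dots,i_d)=f(i_{\sigma(1)},\dots,i_{\sigma(d)})$ for every permutation $\sigma$ of $\{1,\dots,d\}$ and every $(i_1,\dots,i_d)\in[n]^d$; (c) it is normalized: $d!\sum_{i_1,\dots,i_d=1}^n f(i_1,\dots,i_d)^2=1$. *)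

theory Defs
  imports "HOL-Probability.Probability"
begin

text \<open>
  A kernel \<open>[n]\<^sup>d \<rightarrow> \<real>\<close> is a function on multi-indices \<open>i :: nat \<Rightarrow> nat\<close>; only its values on
  the extensional function space \<open>{1..d} \<rightarrow>\<^sub>E {1..n}\<close>, which represents \<open>[n]\<^sup>d\<close>, matter.
\<close>

definition hom_sum ::
    "nat \<Rightarrow> nat \<Rightarrow> (nat \<Rightarrow> 'a \<Rightarrow> real) \<Rightarrow> ((nat \<Rightarrow> nat) \<Rightarrow> real) \<Rightarrow> 'a \<Rightarrow> real" where
  "hom_sum d n X f \<omega> = (\<Sum>i \<in> {1..d} \<rightarrow>\<^sub>E {1..n}. f i * (\<Prod>k=1..d. X (i k) \<omega>))"

text \<open>
  A permutation of \<open>{1..d}\<close> in the sense of \<open>permutes\<close> is the identity outside \<open>{1..d}\<close>, so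
  \<open>i \<circ> \<sigma>\<close> is again in \<open>{1..d} \<rightarrow>\<^sub>E {1..n}\<close>. For \<open>n < d\<close> every multi-index has a repeated
  entry, so the first and third conditions are contradictory: admissible kernels
  exist only for \<open>n \<ge> d\<close>.
\<close>

definition admissible_kernel :: "nat \<Rightarrow> nat \<Rightarrow> ((nat \<Rightarrow> nat) \<Rightarrow> real) \<Rightarrow> bool" where
  "admissible_kernel d n f \<longleftrightarrow>
     (\<forall>i \<in> {1..d} \<rightarrow>\<^sub>E {1..n}. (\<exists>j\<in>{1..d}. \<exists>k\<in>{1..d}. j \<noteq> k \<and> i j = i k) \<longrightarrow> f i = 0) \<and>
     (\<forall>\<sigma>. \<sigma> permutes {1..d} \<longrightarrow> (\<forall>i \<in> {1..d} \<rightarrow>\<^sub>E {1..n}. f i = f (i \<circ> \<sigma>))) \<and>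
     fact d * (\<Sum>i \<in> {1..d} \<rightarrow>\<^sub>E {1..n}. (f i)\<^sup>2) = 1"

definition sym_pos_def :: "real^'m^'m \<Rightarrow> bool" where
  "sym_pos_def C \<longleftrightarrow> transpose C = C \<and> (\<forall>x. x \<noteq> 0 \<longrightarrow> 0 < x \<bullet> (C *v x))"

text \<open>
  The Gaussian law \<open>N(0, C)\<close>, given by its Lebesgue density; this is meaningful only for
  symmetric positive definite \<open>C\<close>.
\<close>

definition centered_gaussian :: "real^'m^'m \<Rightarrow> (real^'m) measure" where
  "centered_gaussian C = density lborel
     (\<lambda>x. ennreal (exp (- (x \<bullet> (matrix_inv C *v x)) / 2) / sqrt ((2 * pi) ^ CARD('m) * det C)))"

text \<open>
  Weak convergence of laws on a general space, tested on bounded continuous functions; the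
  library's \<open>weak_conv_m\<close> is restricted to measures on the real line.
\<close>

definition weak_conv_bc :: "(nat \<Rightarrow> 'b::topological_space measure) \<Rightarrow> 'b measure \<Rightarrow> bool" where
  "weak_conv_bc \<mu> \<nu> \<longleftrightarrow>
     (\<forall>g :: 'b \<Rightarrow> real. continuous_on UNIV g \<and> bounded (range g) \<longrightarrow>
        (\<lambda>n. integral\<^sup>L (\<mu> n) g) \<longlonglongrightarrow> integral\<^sup>L \<nu> g)"

end

theory Submission
  imports Defs
begin

text \<open>
  A homogeneous sum of degree \<open>d\<close> is a multilinear polynomial \<open>W = \<Sum>\<^sub>S c\<^sub>S X\<^sub>S\<close> over \<open>d\<close>-element sets \<open>S\<close>.
  With \<open>G(A,B) = \<Sum>\<^sub>Y c\<^sub>A\<^sub>\<union>\<^sub>Y c\<^sub>B\<^sub>\<union>\<^sub>Y\<close>, expanding \<open>X\<^sub>k\<^sup>2 = 1 + (X\<^sub>k\<^sup>2 - 1)\<close> gives \<open>W\<^sup>2 = \<Sum>\<^sub>A\<^sub>,\<^sub>B G(A,B) \<Phi>(A,B)\<close>, where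
  \<open>\<Phi>(A,B)\<close> is the product of \<open>X\<^sub>k\<close> over the symmetric difference and of \<open>X\<^sub>k\<^sup>2 - 1\<close> over the intersection.
  Since \<open>E X\<^sub>k\<^sup>3 = 0\<close>, two \<open>\<Phi>\<close>'s are equal or orthogonal, so \<open>E W\<^sup>4\<close> is a sum of weighted squares; as
  \<open>E X\<^sub>k\<^sup>4 - 1 \<ge> 2\<close>, it is at least \<open>3 (E W\<^sup>2)\<^sup>2 + K\<close> with \<open>K = \<Sum> G(A,B)\<^sup>2\<close> over sets of size \<open>1, \<dots>, d - 1\<close>.
  Hypercontractivity makes \<open>W\<^sup>4\<close> uniformly integrable, so marginal convergence forces \<open>K \<rightarrow> 0\<close>.
  A linear combination of the sums is again a homogeneous sum, and its \<open>K\<close> is controlled by those of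
  the summands. Moreover \<open>K\<close> bounds all influences and the variance of \<open>(1/d) \<Sum>\<^sub>k (\<partial>\<^sub>k W)\<^sup>2\<close>,
  which has the same expansion as \<open>W\<^sup>2\<close> with \<open>G(A,B)\<close> multiplied by \<open>(d - |A|)/d\<close>. Stein's method then
  yields the Gaussian limit of the characteristic function of every linear combination.
\<close>

subsection \<open>Multilinear polynomials and contractions of their coefficients\<close>

text \<open>Gaussian marginals alone do not force a jointly Gaussian limit, and the fourth moments
  of the components say nothing direct about that of a linear combination. K bridges the gap: it is
  built from the coefficients alone as squared norms of Gram-type matrices, so mixed terms of two
  kernels are dominated by the two pure ones. The constant 3 arises as 1 + 2. The constant term of
  \<open>W^2\<close> gives \<open>(E W^2)^2\<close>. The part of full degree 2d carries weights
  \<open>(\<kappa> - 1)^|A \<inter> B|\<close>; with 2 in place of \<open>\<kappa> - 1\<close> it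
  equals the sum of all squared contractions, in which the empty pair and the pairs of d-sets give
  \<open>(E W^2)^2\<close> each and the rest is K. The power of 2 counts the ways to split
  \<open>A \<inter> B\<close> in two, while 2 is also the variance of \<open>X^2 - 1\<close> for
  Gaussian X; this is where a fourth moment of at least 3 enters. The full-degree part has second
  moment at least \<open>2 (E W^2)^2\<close>, so \<open>W^2\<close> itself does not concentrate. The
  factor \<open>(d - |A|)/d\<close> removes exactly this part, which is why Stein's method is run
  with squared derivatives.\<close>

definition multilinear :: "'i set \<Rightarrow> ('i set \<Rightarrow> real) \<Rightarrow> ('i \<Rightarrow> real) \<Rightarrow> real" where
  "multilinear V c x = (\<Sum>S\<in>Pow V. c S * (\<Prod>k\<in>S. x k))"

text \<open>Up to factorials these are the contractions of a symmetric kernel with itself, all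
  orders in one function: for homogeneous coefficients a term survives only if \<open>Y\<close> has
  \<open>d - card A\<close> elements, and this number is the order. \<open>A\<close> and
  \<open>B\<close> may overlap, so diagonal values are kept.\<close>

definition contraction :: "'i set \<Rightarrow> ('i set \<Rightarrow> real) \<Rightarrow> 'i set \<Rightarrow> 'i set \<Rightarrow> real" where
  "contraction V c A B = (\<Sum>Y\<in>Pow (V - A - B). c (A \<union> Y) * c (B \<union> Y))"

definition chaos :: "('i \<Rightarrow> real) \<Rightarrow> 'i set \<times> 'i set \<Rightarrow> real" where
  "chaos x = (\<lambda>(A, B). (\<Prod>k\<in>(A - B) \<union> (B - A). x k) * (\<Prod>k\<in>A \<inter> B. (x k)\<^sup>2 - 1))"

definition homogeneous :: "nat \<Rightarrow> ('i set \<Rightarrow> real) \<Rightarrow> bool" where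
  "homogeneous d c \<longleftrightarrow> (\<forall>S. c S \<noteq> 0 \<longrightarrow> card S = d)"

definition mid :: "'i set \<Rightarrow> nat \<Rightarrow> 'i set set" where
  "mid V d = {A \<in> Pow V. 1 \<le> card A \<and> card A < d}"

text \<open>Up to constants, the squared norms of the contractions of orders 1 to d - 1 of a
  homogeneous kernel, whose vanishing is the classical criterion for normal approximation in a fixed
  chaos. Pairs of unequal cardinality contribute 0 there.\<close>

definition mid_norm :: "'i set \<Rightarrow> nat \<Rightarrow> ('i set \<Rightarrow> real) \<Rightarrow> real" where
  "mid_norm V d c = (\<Sum>A\<in>mid V d. \<Sum>B\<in>mid V d. (contraction V c A B)\<^sup>2)"

text \<open>All that \<open>chaos\<close> sees of a pair. Moving indices between
  \<open>A - B\<close> and \<open>B - A\<close> keeps it, so many pairs share one chaos element and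
  their coefficients have to be added before squaring.\<close>

definition pattern :: "'i set \<times> 'i set \<Rightarrow> 'i set \<times> 'i set" where
  "pattern = (\<lambda>(A, B). ((A - B) \<union> (B - A), A \<inter> B))"

lemma sum_pair_Sigma:
  assumes "finite P" "\<And>A B. (A, B) \<in> P \<Longrightarrow> finite (F A B)"
  shows "(\<Sum>(A, B)\<in>P. \<Sum>Y\<in>F A B. g A B Y) = (\<Sum>((A, B), Y)\<in>(SIGMA (A, B):P. F A B). g A B Y)"
proof -
  have "(\<Sum>p\<in>P. \<Sum>Y\<in>F (fst p) (snd p). g (fst p) (snd p) Y) =
      (\<Sum>(p, Y)\<in>(SIGMA p:P. F (fst p) (snd p)). g (fst p) (snd p) Y)"
    by (rule sum.Sigma) (use assms in auto)
  then show ?thesis by (simp add: split_def)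
qed

lemma prod_mult_prod_eq_sum_chaos:
  assumes "finite S" "finite T"
  shows "(\<Prod>k\<in>S. x k) * (\<Prod>k\<in>T. x k) =
    (\<Sum>P\<in>Pow (S \<inter> T). (\<Prod>k\<in>(S - T) \<union> (T - S). x k) * (\<Prod>k\<in>P. (x k)\<^sup>2 - (1::real)))"
proof -
  have S: "(\<Prod>k\<in>S. x k) = (\<Prod>k\<in>S - T. x k) * (\<Prod>k\<in>S \<inter> T. x k)"
    using assms by (subst prod.union_disjoint[symmetric]) (auto intro!: prod.cong)
  have T: "(\<Prod>k\<in>T. x k) = (\<Prod>k\<in>T - S. x k) * (\<Prod>k\<in>S \<inter> T. x k)"
    using assms by (subst prod.union_disjoint[symmetric]) (auto intro!: prod.cong)
  have "(\<Prod>k\<in>S. x k) * (\<Prod>k\<in>T. x k) =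
      ((\<Prod>k\<in>S - T. x k) * (\<Prod>k\<in>T - S. x k)) * ((\<Prod>k\<in>S \<inter> T. x k) * (\<Prod>k\<in>S \<inter> T. x k))"
    unfolding S T by simp
  also have "(\<Prod>k\<in>S - T. x k) * (\<Prod>k\<in>T - S. x k) = (\<Prod>k\<in>(S - T) \<union> (T - S). x k)"
    using assms by (intro prod.union_disjoint[symmetric]) auto
  also have "(\<Prod>k\<in>S \<inter> T. x k) * (\<Prod>k\<in>S \<inter> T. x k) = (\<Prod>k\<in>S \<inter> T. ((x k)\<^sup>2 - 1) + 1)"
    by (simp add: prod.distrib[symmetric] power2_eq_square)
  also have "\<dots> = (\<Sum>P\<in>Pow (S \<inter> T). \<Prod>k\<in>P. (x k)\<^sup>2 - 1)"
    using assms by (subst prod_add) auto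
  finally show ?thesis by (simp add: sum_distrib_left)
qed

lemma multilinear_square:
  assumes "finite V"
  shows "(multilinear V c x)\<^sup>2 = (\<Sum>(A, B)\<in>Pow V \<times> Pow V. contraction V c A B * chaos x (A, B))"
proof -
  let ?L = "SIGMA (S, T) : Pow V \<times> Pow V. Pow (S \<inter> T)"
  let ?R = "SIGMA (A, B) : Pow V \<times> Pow V. Pow (V - A - B)"
  have fin: "finite S" if "S \<subseteq> V" for S using that assms finite_subset by auto
  have "(multilinear V c x)\<^sup>2 = (\<Sum>(S, T)\<in>Pow V \<times> Pow V. c S * c T * ((\<Prod>k\<in>S. x k) * (\<Prod>k\<in>T. x k)))"
    unfolding multilinear_def power2_eq_square sum_product sum.cartesian_product
    by (intro sum.cong) (auto simp: ac_simps)
  also have "\<dots> = (\<Sum>(S, T)\<in>Pow V \<times> Pow V. \<Sum>P\<in>Pow (S \<inter> T). c S * c T *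
      ((\<Prod>k\<in>(S - T) \<union> (T - S). x k) * (\<Prod>k\<in>P. (x k)\<^sup>2 - 1)))"
    by (intro sum.cong refl) (auto simp: prod_mult_prod_eq_sum_chaos fin sum_distrib_left)
  also have "\<dots> = (\<Sum>((S, T), P)\<in>?L. c S * c T *
      ((\<Prod>k\<in>(S - T) \<union> (T - S). x k) * (\<Prod>k\<in>P. (x k)\<^sup>2 - 1)))"
    by (rule sum_pair_Sigma) (use assms fin in auto)
  \<comment> \<open>\<open>Y\<close> collects the common indices at which the summand 1 of
    \<open>1 + (x k^2 - 1)\<close> was chosen. Taking \<open>Y\<close> out of both \<open>S\<close>
    and \<open>T\<close> leaves \<open>A\<close> and \<open>B\<close> with
    \<open>A \<inter> B = P\<close>.\<close>
  also have "\<dots> = (\<Sum>((A, B), Y)\<in>?R. c (A \<union> Y) * c (B \<union> Y) * chaos x (A, B))"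
  proof (rule sum.reindex_bij_witness[where
        j = "\<lambda>((S, T), P). ((S - (S \<inter> T - P), T - (S \<inter> T - P)), S \<inter> T - P)" and
        i = "\<lambda>((A, B), Y). ((A \<union> Y, B \<union> Y), A \<inter> B)"], goal_cases)
    case (5 a)
    obtain S T P where a: "a = ((S, T), P)" by (metis prod.exhaust)
    with 5 have P: "P \<subseteq> S \<inter> T" by auto
    have "S - (S \<inter> T - P) \<union> (S \<inter> T - P) = S" "T - (S \<inter> T - P) \<union> (S \<inter> T - P) = T"
      "(S - (S \<inter> T - P)) - (T - (S \<inter> T - P)) = S - T"
      "(T - (S \<inter> T - P)) - (S - (S \<inter> T - P)) = T - S"
      "(S - (S \<inter> T - P)) \<inter> (T - (S \<inter> T - P)) = P"
      using P by auto
    then show ?case by (simp add: a chaos_def)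
  qed auto
  also have "\<dots> = (\<Sum>(A, B)\<in>Pow V \<times> Pow V. \<Sum>Y\<in>Pow (V - A - B). c (A \<union> Y) * c (B \<union> Y) * chaos x (A, B))"
    by (rule sum_pair_Sigma[symmetric]) (use assms fin in auto)
  also have "\<dots> = (\<Sum>(A, B)\<in>Pow V \<times> Pow V. contraction V c A B * chaos x (A, B))"
    by (simp add: contraction_def sum_distrib_right)
  finally show ?thesis .
qed

text \<open>The coefficients \<open>c (insert k S)\<close> are those of the partial derivative in
  \<open>x k\<close>. A set \<open>Y\<close> in its square stands for \<open>insert k Y\<close> in a
  contraction of \<open>c\<close>, and each set is reached once for every one of its elements; hence
  the weight \<open>card Y\<close>.\<close>

lemma sum_partial_derivative_square:
  assumes "finite V"
  shows "(\<Sum>k\<in>V. (multilinear (V - {k}) (\<lambda>S. c (insert k S)) x)\<^sup>2) =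
    (\<Sum>(A, B)\<in>Pow V \<times> Pow V.
       (\<Sum>Y\<in>Pow (V - A - B). real (card Y) * (c (A \<union> Y) * c (B \<union> Y))) * chaos x (A, B))"
proof -
  have fin: "finite S" if "S \<subseteq> V" for S using that assms finite_subset by auto
  let ?L = "SIGMA k : V. SIGMA (A, B) : Pow (V - {k}) \<times> Pow (V - {k}). Pow (V - {k} - A - B)"
  let ?R = "SIGMA (A, B) : Pow V \<times> Pow V. SIGMA Y : Pow (V - A - B). Y"
  let ?f = "\<lambda>A B Y. c (A \<union> Y) * c (B \<union> Y) * chaos x (A, B)"
  let ?h = "\<lambda>k A B Y. c (insert k (A \<union> Y)) * c (insert k (B \<union> Y)) * chaos x (A, B)"
  have "(\<Sum>k\<in>V. (multilinear (V - {k}) (\<lambda>S. c (insert k S)) x)\<^sup>2) =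
    (\<Sum>k\<in>V. \<Sum>(A, B)\<in>Pow (V - {k}) \<times> Pow (V - {k}). \<Sum>Y\<in>Pow (V - {k} - A - B). ?h k A B Y)"
    using assms
    by (subst multilinear_square) (simp_all add: contraction_def sum_distrib_right)
  also have "\<dots> = (\<Sum>k\<in>V. \<Sum>((A, B), Y)\<in>(SIGMA (A, B) : Pow (V - {k}) \<times> Pow (V - {k}). Pow (V - {k} - A - B)). ?h k A B Y)"
    by (intro sum.cong refl sum_pair_Sigma) (use assms fin in auto)
  also have "\<dots> = (\<Sum>(k, (A, B), Y)\<in>?L. ?h k A B Y)"
    by (rule sum.Sigma) (use assms fin in \<open>auto intro!: finite_SigmaI\<close>)
  also have "\<dots> = (\<Sum>((A, B), Y, k)\<in>?R. ?f A B Y)"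
    by (rule sum.reindex_bij_witness[where
        j = "\<lambda>(k, (A, B), Y). ((A, B), insert k Y, k)" and
        i = "\<lambda>((A, B), Y, k). (k, (A, B), Y - {k})"]) auto
  also have "\<dots> = (\<Sum>(A, B)\<in>Pow V \<times> Pow V. \<Sum>(Y, k)\<in>(SIGMA Y : Pow (V - A - B). Y). ?f A B Y)"
    by (rule sum_pair_Sigma[symmetric]) (use assms in \<open>auto intro!: finite_SigmaI intro: fin\<close>)
  also have "\<dots> = (\<Sum>(A, B)\<in>Pow V \<times> Pow V. \<Sum>Y\<in>Pow (V - A - B). \<Sum>k\<in>Y. ?f A B Y)"
  proof (intro sum.cong refl, clarify)
    fix A B assume "A \<subseteq> V" "B \<subseteq> V"
    show "(\<Sum>(Y, k)\<in>(SIGMA Y : Pow (V - A - B). Y). ?f A B Y) = (\<Sum>Y\<in>Pow (V - A - B). \<Sum>k\<in>Y. ?f A B Y)"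
      by (rule sum.Sigma[symmetric]) (use assms in \<open>auto intro: fin\<close>)
  qed
  also have "\<dots> = (\<Sum>(A, B)\<in>Pow V \<times> Pow V.
       (\<Sum>Y\<in>Pow (V - A - B). real (card Y) * (c (A \<union> Y) * c (B \<union> Y))) * chaos x (A, B))"
    by (simp add: sum_distrib_right mult.assoc)
  finally show ?thesis .
qed

lemma homogeneous_contraction_card:
  assumes "homogeneous d c" "finite V" "A \<subseteq> V" "B \<subseteq> V" "contraction V c A B \<noteq> 0"
  shows "card A = card B" "card A \<le> d"
proof -
  have fin: "finite S" if "S \<subseteq> V" for S using that assms(2) finite_subset by auto
  obtain Y where Y: "Y \<subseteq> V - A - B" "c (A \<union> Y) * c (B \<union> Y) \<noteq> 0"
    using assms(5) unfolding contraction_def by (meson PowD sum.not_neutral_contains_not_neutral)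
  have c: "card (A \<union> Y) = d" "card (B \<union> Y) = d"
    using Y assms(1) by (auto simp: homogeneous_def)
  have d: "card (A \<union> Y) = card A + card Y" "card (B \<union> Y) = card B + card Y"
    using Y assms(3,4) by (auto intro!: card_Un_disjoint fin)
  show "card A = card B" "card A \<le> d"
    using c d by auto
qed

lemma sum_partial_derivative_square_homogeneous:
  assumes "finite V" "homogeneous d c"
  shows "(\<Sum>k\<in>V. (multilinear (V - {k}) (\<lambda>S. c (insert k S)) x)\<^sup>2) =
    (\<Sum>(A, B)\<in>Pow V \<times> Pow V. real (d - card A) * contraction V c A B * chaos x (A, B))"
proof -
  have fin: "finite S" if "S \<subseteq> V" for S using that assms(1) finite_subset by auto
  have *: "real (card Y) * (c (A \<union> Y) * c (B \<union> Y)) = real (d - card A) * (c (A \<union> Y) * c (B \<union> Y))"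
    if "A \<subseteq> V" "Y \<subseteq> V - A - B" for A B Y
  proof (cases "c (A \<union> Y) = 0")
    case False
    then have "card (A \<union> Y) = d" using assms(2) by (auto simp: homogeneous_def)
    moreover have "card (A \<union> Y) = card A + card Y"
      using that by (auto intro!: card_Un_disjoint fin)
    ultimately show ?thesis by auto
  qed auto
  show ?thesis
    unfolding sum_partial_derivative_square[OF assms(1)] contraction_def
    by (intro sum.cong refl) (auto simp: sum_distrib_left * intro!: sum.cong)
qed

text \<open>Expanding the squares gives products of \<open>c\<close> at \<open>A \<union> Y\<close>,
  \<open>B \<union> Y\<close>, \<open>A \<union> Z\<close>, \<open>B \<union> Z\<close>. Paired
  crosswise as \<open>(A \<union> Y, B \<union> Z)\<close> and
  \<open>(A \<union> Z, B \<union> Y)\<close> they have equal patterns. Conversely, for pairs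
  \<open>(S1, S2)\<close> and \<open>(T1, T2)\<close> of equal pattern, an index outside
  \<open>S1 \<inter> S2\<close> lies in exactly one of \<open>S1, S2\<close> and one of
  \<open>T1, T2\<close>, which tells whether it belongs to \<open>A\<close>, \<open>B\<close>,
  \<open>Y\<close> or \<open>Z\<close>. An index of \<open>S1 \<inter> S2\<close> lies either in
  both \<open>A\<close> and \<open>B\<close> or in both \<open>Y\<close> and \<open>Z\<close>; this
  free choice \<open>Q\<close> produces the power of 2.\<close>

lemma sum_pattern_eq_sum_contraction_square:
  assumes "finite V"
  shows "(\<Sum>p\<in>Pow V \<times> Pow V. \<Sum>q\<in>{q\<in>Pow V \<times> Pow V. pattern q = pattern p}.
      2 ^ card (fst p \<inter> snd p) * (c (fst p) * c (snd p)) * (c (fst q) * c (snd q))) =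
    (\<Sum>A\<in>Pow V. \<Sum>B\<in>Pow V. (contraction V c A B)\<^sup>2)"
proof -
  have fin: "finite S" if "S \<subseteq> V" for S using that assms finite_subset by auto
  let ?D = "SIGMA p:Pow V \<times> Pow V. {q\<in>Pow V \<times> Pow V. pattern q = pattern p}"
  let ?g = "\<lambda>A B Y Z. (c (A \<union> Y) * c (B \<union> Z)) * (c (A \<union> Z) * c (B \<union> Y))"
  let ?h = "\<lambda>p q. (c (fst p) * c (snd p)) * (c (fst q) * c (snd q))"
  have "(\<Sum>A\<in>Pow V. \<Sum>B\<in>Pow V. (contraction V c A B)\<^sup>2) =
    (\<Sum>(A, B)\<in>Pow V \<times> Pow V. \<Sum>(Y, Z)\<in>Pow (V - A - B) \<times> Pow (V - A - B). ?g A B Y Z)"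
    unfolding contraction_def power2_eq_square sum_product sum.cartesian_product
    by (simp add: ac_simps)
  also have "\<dots> = (\<Sum>((A, B), Y, Z)\<in>(SIGMA (A,B):Pow V \<times> Pow V. Pow (V - A - B) \<times> Pow (V - A - B)). ?g A B Y Z)"
    by (subst sum_pair_Sigma) (use assms fin in auto)
  also have "\<dots> = (\<Sum>((p, q), Q)\<in>(SIGMA (p, q):?D. Pow (fst p \<inter> snd p)). ?h p q)"
  proof (rule sum.reindex_bij_witness[where
        j = "\<lambda>((A, B), Y, Z). (((A \<union> Y, B \<union> Z), (A \<union> Z, B \<union> Y)), A \<inter> B)" and
        i = "\<lambda>(((S1, S2), (T1, T2)), Q). ((S1 \<inter> T1 - (S1 \<inter> S2) \<union> Q, S2 \<inter> T2 - (S1 \<inter> S2) \<union> Q),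
               S1 \<inter> T2 - (S1 \<inter> S2) \<union> (S1 \<inter> S2 - Q), S2 \<inter> T1 - (S1 \<inter> S2) \<union> (S1 \<inter> S2 - Q))"],
        goal_cases)
    case (1 a)
    obtain A B Y Z where a: "a = ((A, B), Y, Z)" by (metis prod.exhaust)
    with 1 have "Y \<inter> A = {}" "Y \<inter> B = {}" "Z \<inter> A = {}" "Z \<inter> B = {}" by auto
    then show ?case unfolding a by (simp, intro conjI; blast)
  next
    case (2 a)
    obtain A B Y Z where a: "a = ((A, B), Y, Z)" by (metis prod.exhaust)
    with 2 have "A \<subseteq> V" "B \<subseteq> V" "Y \<subseteq> V" "Z \<subseteq> V" "Y \<inter> A = {}" "Y \<inter> B = {}" "Z \<inter> A = {}" "Z \<inter> B = {}" by auto
    then show ?case unfolding a by (simp add: pattern_def, intro conjI; blast)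
  next
    case (3 b)
    obtain S1 S2 T1 T2 Q where b: "b = (((S1, S2), (T1, T2)), Q)" by (metis prod.exhaust)
    from 3 have sub: "S1 \<subseteq> V" "S2 \<subseteq> V" "T1 \<subseteq> V" "T2 \<subseteq> V" "Q \<subseteq> S1 \<inter> S2"
      and i: "T1 \<inter> T2 = S1 \<inter> S2"
      and d: "T1 - T2 \<union> (T2 - T1) = S1 - S2 \<union> (S2 - S1)"
      by (auto simp: b pattern_def)
    have "T1 \<union> T2 = S1 \<union> S2" using i d by blast
    then show ?case unfolding b using sub i by (simp, intro conjI; blast)
  next
    case (4 b)
    obtain S1 S2 T1 T2 Q where b: "b = (((S1, S2), (T1, T2)), Q)" by (metis prod.exhaust)
    from 4 have sub: "S1 \<subseteq> V" "S2 \<subseteq> V" "T1 \<subseteq> V" "T2 \<subseteq> V" "Q \<subseteq> S1 \<inter> S2"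
      and i: "T1 \<inter> T2 = S1 \<inter> S2"
      and d: "T1 - T2 \<union> (T2 - T1) = S1 - S2 \<union> (S2 - S1)"
      by (auto simp: b pattern_def)
    then show ?case unfolding b by (simp, intro conjI; blast)
  next
    case (5 a)
    then show ?case by auto
  qed
  also have "\<dots> = (\<Sum>(p, q)\<in>?D. \<Sum>Q\<in>Pow (fst p \<inter> snd p). ?h p q)"
    by (rule sum_pair_Sigma[symmetric]) (use assms fin in \<open>auto intro!: finite_SigmaI\<close>)
  also have "\<dots> = (\<Sum>(p, q)\<in>?D. 2 ^ card (fst p \<inter> snd p) * (c (fst p) * c (snd p)) * (c (fst q) * c (snd q)))"
  proof (intro sum.cong refl, clarify)
    fix A B A' B' assume "A \<subseteq> V"
    then show "(\<Sum>Q\<in>Pow (fst (A, B) \<inter> snd (A, B)). ?h (A, B) (A', B')) =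
        2 ^ card (fst (A, B) \<inter> snd (A, B)) * (c (fst (A, B)) * c (snd (A, B))) * (c (fst (A', B')) * c (snd (A', B')))"
      by (simp add: card_Pow fin finite_Int del: Pow_Int_eq)
  qed
  also have "\<dots> = (\<Sum>p\<in>Pow V \<times> Pow V. \<Sum>q\<in>{q\<in>Pow V \<times> Pow V. pattern q = pattern p}.
      2 ^ card (fst p \<inter> snd p) * (c (fst p) * c (snd p)) * (c (fst q) * c (snd q)))"
    using assms by (subst sum.Sigma) auto
  finally show ?thesis by simp
qed

lemma contraction_empty: "contraction V c {} {} = (\<Sum>S\<in>Pow V. (c S)\<^sup>2)"
  by (simp add: contraction_def power2_eq_square)

lemma contraction_top:
  assumes "homogeneous d c" "finite V" "A \<subseteq> V" "B \<subseteq> V" "card A = d"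
  shows "contraction V c A B = c A * c B"
proof -
  have fin: "finite S" if "S \<subseteq> V" for S using that assms(2) finite_subset by auto
  have "c (A \<union> Y) * c (B \<union> Y) = 0" if "Y \<in> Pow (V - A - B) - {{}}" for Y
  proof -
    have "finite Y" "Y \<noteq> {}" using that fin by auto
    moreover have "card (A \<union> Y) = card A + card Y"
      using that assms by (intro card_Un_disjoint fin) auto
    ultimately have "card (A \<union> Y) \<noteq> d"
      using assms(5) by (simp add: card_gt_0_iff)
    then show ?thesis using assms(1) by (auto simp: homogeneous_def)
  qed
  then have "contraction V c A B = (\<Sum>Y\<in>{{}}. c (A \<union> Y) * c (B \<union> Y))"
    unfolding contraction_def using assms(2) by (intro sum.mono_neutral_right) auto
  then show ?thesis by simp
qed

text \<open>The empty pair contributes \<open>(\<Sum> c^2)^2\<close>. Pairs of d-sets contribute the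
  same amount, because no room is left for \<open>Y\<close> and the contraction is a plain product.
  The middle sets give \<open>mid_norm\<close>; \<open>1 \<le> d\<close> keeps the three groups
  disjoint.\<close>

lemma sum_contraction_square_ge:
  assumes "homogeneous d c" "finite V" "d \<ge> 1"
  shows "2 * (\<Sum>S\<in>Pow V. (c S)\<^sup>2)\<^sup>2 + mid_norm V d c \<le> (\<Sum>A\<in>Pow V. \<Sum>B\<in>Pow V. (contraction V c A B)\<^sup>2)"
proof -
  define top where "top = {A\<in>Pow V. card A = d}"
  have fin: "finite S" if "S \<subseteq> V" for S using that assms finite_subset by auto
  have [simp]: "finite top" "finite (mid V d)" using assms(2) by (auto simp: top_def mid_def)
  have disj: "({{}} \<times> {{}}) \<inter> (top \<times> top) = {}" "(({{}} \<times> {{}}) \<union> (top \<times> top)) \<inter> (mid V d \<times> mid V d) = {}"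
    using assms(3) by (auto simp: top_def mid_def)
  have "(\<Sum>S\<in>Pow V. (c S)\<^sup>2) = (\<Sum>S\<in>top. (c S)\<^sup>2)"
    using assms(1,2) by (intro sum.mono_neutral_right) (auto simp: top_def homogeneous_def)
  then have "(\<Sum>S\<in>Pow V. (c S)\<^sup>2)\<^sup>2 = (\<Sum>(A, B)\<in>top \<times> top. (c A)\<^sup>2 * (c B)\<^sup>2)"
    by (simp add: power2_eq_square[of "sum _ _"] sum_product sum.cartesian_product)
  also have "\<dots> = (\<Sum>(A, B)\<in>top \<times> top. (contraction V c A B)\<^sup>2)"
    using assms by (intro sum.cong) (auto simp: contraction_top top_def power_mult_distrib)
  finally have top: "(\<Sum>(A, B)\<in>top \<times> top. (contraction V c A B)\<^sup>2) = (\<Sum>S\<in>Pow V. (c S)\<^sup>2)\<^sup>2" by simp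
  have "2 * (\<Sum>S\<in>Pow V. (c S)\<^sup>2)\<^sup>2 + mid_norm V d c =
     (\<Sum>(A, B)\<in>{{}} \<times> {{}}. (contraction V c A B)\<^sup>2) + (\<Sum>(A, B)\<in>top \<times> top. (contraction V c A B)\<^sup>2)
     + (\<Sum>(A, B)\<in>mid V d \<times> mid V d. (contraction V c A B)\<^sup>2)"
    unfolding top by (simp add: contraction_empty mid_norm_def sum.cartesian_product)
  also have "\<dots> = (\<Sum>(A, B)\<in>({{}} \<times> {{}}) \<union> (top \<times> top) \<union> (mid V d \<times> mid V d). (contraction V c A B)\<^sup>2)"
    using disj by (simp add: sum.union_disjoint)
  also have "\<dots> \<le> (\<Sum>(A, B)\<in>Pow V \<times> Pow V. (contraction V c A B)\<^sup>2)"
    using assms(2) by (intro sum_mono2) (auto simp: top_def mid_def)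
  finally show ?thesis by (simp add: sum.cartesian_product)
qed

section \<open>Influences of single variables\<close>

definition influence :: "'i set \<Rightarrow> ('i set \<Rightarrow> real) \<Rightarrow> 'i \<Rightarrow> real" where
  "influence V c k = (\<Sum>S\<in>Pow (V - {k}). (c (insert k S))\<^sup>2)"

lemma influence_nonneg: "influence V c k \<ge> 0"
  unfolding influence_def by (simp add: sum_nonneg)

lemma mid_norm_nonneg: "mid_norm V d c \<ge> 0"
  unfolding mid_norm_def by (simp add: sum_nonneg)

text \<open>The influence of \<open>k\<close>, the second moment of the derivative in
  \<open>x k\<close> for normalized variables, is the contraction at \<open>({k}, {k})\<close>.
  Degree at least 2 makes \<open>{k}\<close> a middle set, so a small \<open>mid_norm\<close>
  excludes dominant variables.\<close>

lemma influence_square_le: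
  assumes "finite V" "d \<ge> 2" "k \<in> V"
  shows "(influence V c k)\<^sup>2 \<le> mid_norm V d c"
proof -
  have k: "{k} \<in> mid V d" using assms by (auto simp: mid_def)
  have fin: "finite (mid V d)" using assms by (auto simp: mid_def)
  have "influence V c k = contraction V c {k} {k}"
    by (simp add: influence_def contraction_def power2_eq_square)
  then have "(influence V c k)\<^sup>2 \<le> (\<Sum>B\<in>mid V d. (contraction V c {k} B)\<^sup>2)"
    using k fin by (auto intro: member_le_sum[of "{k}" _ "\<lambda>B. (contraction V c {k} B)\<^sup>2"])
  also have "\<dots> \<le> mid_norm V d c"
    unfolding mid_norm_def using k fin by (intro member_le_sum) (auto intro: sum_nonneg)
  finally show ?thesis .
qed

lemma sum_influence:
  assumes "finite V" "homogeneous d c"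
  shows "(\<Sum>k\<in>V. influence V c k) = real d * (\<Sum>S\<in>Pow V. (c S)\<^sup>2)"
proof -
  have fin: "finite S" if "S \<subseteq> V" for S using that assms(1) finite_subset by auto
  have "(\<Sum>k\<in>V. influence V c k) = (\<Sum>(k, S)\<in>(SIGMA k:V. Pow (V - {k})). (c (insert k S))\<^sup>2)"
    unfolding influence_def using assms by (intro sum.Sigma) auto
  also have "\<dots> = (\<Sum>(S, k)\<in>(SIGMA S:Pow V. S). (c S)\<^sup>2)"
    by (rule sum.reindex_bij_witness[where
        j = "\<lambda>(k, S). (insert k S, k)" and i = "\<lambda>(S, k). (k, S - {k})"]) auto
  also have "\<dots> = (\<Sum>S\<in>Pow V. \<Sum>k\<in>S. (c S)\<^sup>2)"
    using assms fin by (intro sum.Sigma[symmetric]) auto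
  also have "\<dots> = (\<Sum>S\<in>Pow V. real d * (c S)\<^sup>2)"
    using assms(2) by (intro sum.cong) (auto simp: homogeneous_def)
  finally show ?thesis by (simp add: sum_distrib_left)
qed

section \<open>Mixed contractions and linear combinations\<close>

lemma sum_inner_square_swap:
  fixes M N :: "'a \<Rightarrow> 'b \<Rightarrow> real"
  shows "(\<Sum>a\<in>I. \<Sum>b\<in>I. (\<Sum>y\<in>J. M a y * N b y)\<^sup>2) =
    (\<Sum>y\<in>J. \<Sum>z\<in>J. (\<Sum>a\<in>I. M a y * M a z) * (\<Sum>b\<in>I. N b y * N b z))"
proof -
  have "(\<Sum>a\<in>I. \<Sum>b\<in>I. (\<Sum>y\<in>J. M a y * N b y)\<^sup>2) =
     (\<Sum>a\<in>I. \<Sum>b\<in>I. \<Sum>y\<in>J. \<Sum>z\<in>J. (M a y * M a z) * (N b y * N b z))"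
    unfolding power2_eq_square sum_product by (simp add: ac_simps)
  also have "\<dots> = (\<Sum>a\<in>I. \<Sum>y\<in>J. \<Sum>z\<in>J. \<Sum>b\<in>I. (M a y * M a z) * (N b y * N b z))"
    by (intro sum.cong refl) (subst sum.swap, intro sum.cong refl, subst sum.swap, simp)
  also have "\<dots> = (\<Sum>y\<in>J. \<Sum>z\<in>J. \<Sum>a\<in>I. \<Sum>b\<in>I. (M a y * M a z) * (N b y * N b z))"
    by (subst sum.swap, intro sum.cong refl, subst sum.swap, simp)
  finally show ?thesis by (simp add: sum_product)
qed

text \<open>In matrix terms, the squared Hilbert-Schmidt norm of \<open>M N^T\<close> is the inner
  product of \<open>M^T M\<close> and \<open>N^T N\<close>. Bounding \<open>u v\<close> by
  \<open>(u^2 + v^2)/2\<close> entrywise leaves the norms of \<open>M^T M\<close> and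
  \<open>N^T N\<close>, which the swap turns back into those of \<open>M M^T\<close> and
  \<open>N N^T\<close>.\<close>

lemma sum_inner_square_mixed_le:
  fixes M N :: "'a \<Rightarrow> 'b \<Rightarrow> real"
  shows "(\<Sum>a\<in>I. \<Sum>b\<in>I. (\<Sum>y\<in>J. M a y * N b y)\<^sup>2) \<le>
    ((\<Sum>a\<in>I. \<Sum>b\<in>I. (\<Sum>y\<in>J. M a y * M b y)\<^sup>2) + (\<Sum>a\<in>I. \<Sum>b\<in>I. (\<Sum>y\<in>J. N a y * N b y)\<^sup>2)) / 2"
proof -
  have "u * v \<le> (u * u + v * v) / 2" for u v :: real
    using sum_squares_bound[of u v] by (simp add: power2_eq_square)
  then have "(\<Sum>y\<in>J. \<Sum>z\<in>J. (\<Sum>a\<in>I. M a y * M a z) * (\<Sum>b\<in>I. N b y * N b z)) \<le>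
    (\<Sum>y\<in>J. \<Sum>z\<in>J. ((\<Sum>a\<in>I. M a y * M a z) * (\<Sum>a\<in>I. M a y * M a z) + (\<Sum>b\<in>I. N b y * N b z) * (\<Sum>b\<in>I. N b y * N b z)) / 2)"
    by (intro sum_mono) blast
  then show ?thesis
    unfolding sum_inner_square_swap by (simp add: sum.distrib sum_divide_distrib add_divide_distrib)
qed

lemma sum_rotate:
  "(\<Sum>a\<in>A. \<Sum>b\<in>B. \<Sum>p\<in>P. f a b p) = (\<Sum>p\<in>P. \<Sum>a\<in>A. \<Sum>b\<in>B. f a b p)"
  by (subst sum.swap[of _ P], intro sum.cong refl sum.swap)

text \<open>The contraction matrix of the combination is the sum of \<open>t j * t i\<close> times
  \<open>M j (M i)^T\<close>. Cauchy-Schwarz over the pairs of indices costs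
  \<open>card (J \<times> J)\<close>, and each mixed term is dominated by the two pure ones.\<close>

lemma mid_norm_linear_combination_le:
  fixes t :: "'j \<Rightarrow> real" and cf :: "'j \<Rightarrow> 'i set \<Rightarrow> real"
  assumes "finite V"
  shows "mid_norm V d (\<lambda>S. \<Sum>j\<in>J. t j * cf j S) \<le>
    real (card (J \<times> J)) * (\<Sum>j\<in>J. \<Sum>i\<in>J. (t j * t i)\<^sup>2 * ((mid_norm V d (cf j) + mid_norm V d (cf i)) / 2))"
proof -
  \<comment> \<open>The value 0 for \<open>Y\<close> meeting \<open>A\<close> lets the sum run over
    all of \<open>Pow V\<close>, whatever \<open>A\<close> and \<open>B\<close> are; contractions
    thereby become entries of a Gram matrix.\<close>
  define M where "M j A Y = (if Y \<subseteq> V - A then cf j (A \<union> Y) else 0)" for j A Y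
  have restrict: "(\<Sum>Y\<in>Pow (V - A - B). f Y) = (\<Sum>Y\<in>Pow V. if Y \<subseteq> V - A \<and> Y \<subseteq> V - B then f Y else 0)"
    for A B and f :: "'i set \<Rightarrow> real"
  proof -
    have "{Y\<in>Pow V. Y \<subseteq> V - A \<and> Y \<subseteq> V - B} = Pow (V - A - B)" by auto
    then show ?thesis using assms by (subst sum.inter_filter[symmetric]) auto
  qed
  have c1: "contraction V (cf j) A B = (\<Sum>Y\<in>Pow V. M j A Y * M j B Y)" for j A B
    unfolding contraction_def restrict by (auto simp: M_def intro!: sum.cong)
  have "contraction V (\<lambda>S. \<Sum>j\<in>J. t j * cf j S) A B =
      (\<Sum>Y\<in>Pow V. (\<Sum>j\<in>J. t j * M j A Y) * (\<Sum>i\<in>J. t i * M i B Y))" for A B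
  proof -
    have M: "(\<Sum>j\<in>J. t j * M j A Y) = (if Y \<subseteq> V - A then \<Sum>j\<in>J. t j * cf j (A \<union> Y) else 0)" for A Y
      by (simp add: M_def)
    show ?thesis
      unfolding contraction_def restrict M by (intro sum.cong refl) simp
  qed
  also have "(\<Sum>Y\<in>Pow V. (\<Sum>j\<in>J. t j * M j A Y) * (\<Sum>i\<in>J. t i * M i B Y)) =
      (\<Sum>j\<in>J. \<Sum>i\<in>J. t j * t i * (\<Sum>Y\<in>Pow V. M j A Y * M i B Y))" for A B
  proof -
    have "(\<Sum>Y\<in>Pow V. (\<Sum>j\<in>J. t j * M j A Y) * (\<Sum>i\<in>J. t i * M i B Y)) =
        (\<Sum>Y\<in>Pow V. \<Sum>j\<in>J. \<Sum>i\<in>J. (t j * M j A Y) * (t i * M i B Y))"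
      by (simp only: sum_product)
    also have "\<dots> = (\<Sum>j\<in>J. \<Sum>Y\<in>Pow V. \<Sum>i\<in>J. (t j * M j A Y) * (t i * M i B Y))"
      by (rule sum.swap)
    also have "\<dots> = (\<Sum>j\<in>J. \<Sum>i\<in>J. \<Sum>Y\<in>Pow V. (t j * M j A Y) * (t i * M i B Y))"
      by (intro sum.cong refl sum.swap)
    finally show ?thesis by (simp add: sum_distrib_left ac_simps)
  qed
  also have "\<dots> A B = (\<Sum>(j, i)\<in>J \<times> J. t j * t i * (\<Sum>Y\<in>Pow V. M j A Y * M i B Y))" for A B
    by (simp add: sum.cartesian_product)
  finally have c2: "contraction V (\<lambda>S. \<Sum>j\<in>J. t j * cf j S) A B =
      (\<Sum>(j, i)\<in>J \<times> J. t j * t i * (\<Sum>Y\<in>Pow V. M j A Y * M i B Y))" for A B .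
  have "mid_norm V d (\<lambda>S. \<Sum>j\<in>J. t j * cf j S) \<le>
    (\<Sum>A\<in>mid V d. \<Sum>B\<in>mid V d. (\<Sum>(j, i)\<in>J \<times> J. (t j * t i * (\<Sum>Y\<in>Pow V. M j A Y * M i B Y))\<^sup>2) * card (J \<times> J))"
    unfolding mid_norm_def c2
    by (intro sum_mono order_trans[OF sum_squared_le_sum_of_squares]) (simp add: split_def)
  also have "\<dots> = real (card (J \<times> J)) * (\<Sum>j\<in>J. \<Sum>i\<in>J. (t j * t i)\<^sup>2 *
      (\<Sum>A\<in>mid V d. \<Sum>B\<in>mid V d. (\<Sum>Y\<in>Pow V. M j A Y * M i B Y)\<^sup>2))"
  proof -
    let ?F = "\<lambda>p A B. (t (fst p) * t (snd p) * (\<Sum>Y\<in>Pow V. M (fst p) A Y * M (snd p) B Y))\<^sup>2"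
    have "(\<Sum>A\<in>mid V d. \<Sum>B\<in>mid V d. (\<Sum>(j, i)\<in>J \<times> J. (t j * t i * (\<Sum>Y\<in>Pow V. M j A Y * M i B Y))\<^sup>2) * real (card (J \<times> J)))
      = real (card (J \<times> J)) * (\<Sum>A\<in>mid V d. \<Sum>B\<in>mid V d. \<Sum>p\<in>J \<times> J. ?F p A B)"
      by (simp only: split_def sum_distrib_left sum_distrib_right mult.commute)
    also have "\<dots> = real (card (J \<times> J)) * (\<Sum>p\<in>J \<times> J. \<Sum>A\<in>mid V d. \<Sum>B\<in>mid V d. ?F p A B)"
      by (intro arg_cong2[where f="(*)"] refl sum_rotate)
    also have "(\<Sum>p\<in>J \<times> J. \<Sum>A\<in>mid V d. \<Sum>B\<in>mid V d. ?F p A B) =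
        (\<Sum>p\<in>J \<times> J. (t (fst p) * t (snd p))\<^sup>2 * (\<Sum>A\<in>mid V d. \<Sum>B\<in>mid V d. (\<Sum>Y\<in>Pow V. M (fst p) A Y * M (snd p) B Y)\<^sup>2))"
      by (simp add: power_mult_distrib flip: sum_distrib_left)
    finally show ?thesis
      by (simp only: sum.cartesian_product split_def)
  qed
  also have "\<dots> \<le> real (card (J \<times> J)) * (\<Sum>j\<in>J. \<Sum>i\<in>J. (t j * t i)\<^sup>2 * ((mid_norm V d (cf j) + mid_norm V d (cf i)) / 2))"
    unfolding mid_norm_def c1
    by (intro mult_left_mono sum_mono sum_inner_square_mixed_le) auto
  finally show ?thesis .
qed

subsection \<open>Moments of multilinear polynomials in independent variables\<close>

text \<open>Brings a second moment into the form of a weighted sum of squares, one per class, so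
  that weights can be compared and whole classes dropped in a lower bound.\<close>

lemma sum_same_class_eq_sum_squares:
  fixes \<alpha> :: "'p \<Rightarrow> real"
  assumes "finite P"
  shows "(\<Sum>p\<in>P. \<Sum>q\<in>{q\<in>P. \<pi> q = \<pi> p}. v (\<pi> p) * \<alpha> p * \<alpha> q) =
    (\<Sum>r\<in>\<pi> ` P. v r * (\<Sum>p\<in>{p\<in>P. \<pi> p = r}. \<alpha> p)\<^sup>2)"
proof -
  have "(\<Sum>p\<in>P. \<Sum>q\<in>{q\<in>P. \<pi> q = \<pi> p}. v (\<pi> p) * \<alpha> p * \<alpha> q) =
    (\<Sum>r\<in>\<pi> ` P. \<Sum>p\<in>{p\<in>P. \<pi> p = r}. \<Sum>q\<in>{q\<in>P. \<pi> q = \<pi> p}. v (\<pi> p) * \<alpha> p * \<alpha> q)"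
    using assms by (rule sum.image_gen)
  also have "\<dots> = (\<Sum>r\<in>\<pi> ` P. v r * (\<Sum>p\<in>{p\<in>P. \<pi> p = r}. \<alpha> p)\<^sup>2)"
  proof (intro sum.cong refl)
    fix r
    have "v r * (\<Sum>p\<in>{p\<in>P. \<pi> p = r}. \<alpha> p)\<^sup>2 = (\<Sum>p\<in>{p\<in>P. \<pi> p = r}. \<Sum>q\<in>{q\<in>P. \<pi> q = r}. v r * (\<alpha> p * \<alpha> q))"
      by (simp only: power2_eq_square sum_product) (simp only: sum_distrib_left)
    then show "(\<Sum>p\<in>{p\<in>P. \<pi> p = r}. \<Sum>q\<in>{q\<in>P. \<pi> q = \<pi> p}. v (\<pi> p) * \<alpha> p * \<alpha> q) =
        v r * (\<Sum>p\<in>{p\<in>P. \<pi> p = r}. \<alpha> p)\<^sup>2"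
      by (simp add: mult.assoc)
  qed
  finally show ?thesis .
qed

locale indep_family = prob_space M for M :: "'a measure" +
  fixes X :: "'i \<Rightarrow> 'a \<Rightarrow> real" and I :: "'i set"
  assumes indep: "indep_vars (\<lambda>_. borel) X I"
begin

lemma X_measurable [measurable]: "k \<in> I \<Longrightarrow> X k \<in> borel_measurable M"
  using indep by (auto simp: indep_vars_def)

lemma indep_var_split:
  assumes "k \<in> I" "J \<subseteq> I" "k \<notin> J" "u \<in> borel_measurable borel" "g \<in> borel_measurable (PiM J (\<lambda>_. borel))"
  shows "indep_var borel (\<lambda>\<omega>. u (X k \<omega>)) borel (\<lambda>\<omega>. g (\<lambda>i\<in>J. X i \<omega>))"
proof -
  have "indep_var borel ((\<lambda>f. u (f k)) \<circ> (\<lambda>\<omega>. restrict (\<lambda>i. X i \<omega>) {k})) borel (g \<circ> (\<lambda>\<omega>. restrict (\<lambda>i. X i \<omega>) J))"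
    using assms by (intro indep_var_compose[OF indep_var_restrict[OF indep]]) auto
  then show ?thesis by (simp add: comp_def)
qed

end

lemma multilinear_restrict: "multilinear J c (restrict x J) = multilinear J c x"
  unfolding multilinear_def by (intro sum.cong refl arg_cong2[where f="(*)"] prod.cong) auto

lemma multilinear_measurable_PiM:
  "finite J \<Longrightarrow> multilinear J c \<in> borel_measurable (PiM J (\<lambda>_. borel))"
  unfolding multilinear_def
  by (intro borel_measurable_sum borel_measurable_times borel_measurable_prod) auto

lemma multilinear_insert:
  assumes "finite V" "k \<notin> V"
  shows "multilinear (insert k V) c x = multilinear V c x + x k * multilinear V (\<lambda>S. c (insert k S)) x"
proof -
  have disj: "Pow V \<inter> insert k ` Pow V = {}" using assms by auto
  have inj: "inj_on (insert k) (Pow V)" using assms by (auto simp: inj_on_def)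
  have "multilinear (insert k V) c x = multilinear V c x + (\<Sum>S\<in>Pow V. c (insert k S) * (\<Prod>i\<in>insert k S. x i))"
    using assms disj inj unfolding multilinear_def Pow_insert
    by (simp add: sum.union_disjoint sum.reindex)
  also have "(\<Sum>S\<in>Pow V. c (insert k S) * (\<Prod>i\<in>insert k S. x i)) = (\<Sum>S\<in>Pow V. x k * (c (insert k S) * (\<Prod>i\<in>S. x i)))"
  proof (intro sum.cong refl)
    fix S assume "S \<in> Pow V"
    then have "finite S" "k \<notin> S" using assms finite_subset by auto
    then show "c (insert k S) * (\<Prod>i\<in>insert k S. x i) = x k * (c (insert k S) * (\<Prod>i\<in>S. x i))"
      by simp
  qed
  finally show ?thesis by (simp add: multilinear_def sum_distrib_left)
qed

context indep_family
begin

lemma multilinear_measurable: "J \<subseteq> I \<Longrightarrow> (\<lambda>\<omega>. multilinear J c (\<lambda>i. X i \<omega>)) \<in> borel_measurable M"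
  unfolding multilinear_def
  by (intro borel_measurable_sum borel_measurable_times borel_measurable_prod X_measurable borel_measurable_const) auto

text \<open>The condition on \<open>restrict\<close> says that \<open>g\<close> looks only at
  coordinates in \<open>J\<close>. It allows \<open>g\<close> to be evaluated on the whole family
  while its measurability is stated on the product over \<open>J\<close>.\<close>

lemma
  fixes u :: "real \<Rightarrow> 'z::{real_normed_field,banach,second_countable_topology}" and g :: "('i \<Rightarrow> real) \<Rightarrow> 'z"
  assumes "k \<in> I" "J \<subseteq> I" "k \<notin> J"
    and "u \<in> borel_measurable borel" "g \<in> borel_measurable (PiM J (\<lambda>_. borel))" "\<And>x. g (restrict x J) = g x"
    and "integrable M (\<lambda>\<omega>. u (X k \<omega>))" "integrable M (\<lambda>\<omega>. g (\<lambda>i. X i \<omega>))"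
  shows integrable_mult_split: "integrable M (\<lambda>\<omega>. u (X k \<omega>) * g (\<lambda>i. X i \<omega>))"
    and integral_mult_split:
      "(\<integral>\<omega>. u (X k \<omega>) * g (\<lambda>i. X i \<omega>) \<partial>M) = (\<integral>\<omega>. u (X k \<omega>) \<partial>M) * (\<integral>\<omega>. g (\<lambda>i. X i \<omega>) \<partial>M)"
proof -
  have "indep_var borel (\<lambda>\<omega>. u (X k \<omega>)) borel (\<lambda>\<omega>. g (\<lambda>i\<in>J. X i \<omega>))"
    using assms by (intro indep_var_split) auto
  then have iv: "indep_var borel (\<lambda>\<omega>. u (X k \<omega>)) borel (\<lambda>\<omega>. g (\<lambda>i. X i \<omega>))"
    by (simp add: assms(6))
  show "integrable M (\<lambda>\<omega>. u (X k \<omega>) * g (\<lambda>i. X i \<omega>))"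
    by (rule indep_var_integrable[OF iv assms(7,8)])
  show "(\<integral>\<omega>. u (X k \<omega>) * g (\<lambda>i. X i \<omega>) \<partial>M) = (\<integral>\<omega>. u (X k \<omega>) \<partial>M) * (\<integral>\<omega>. g (\<lambda>i. X i \<omega>) \<partial>M)"
    by (rule indep_var_lebesgue_integral[OF iv assms(7,8)])
qed

end

locale indep_family4 = indep_family M X I for M :: "'a measure" and X :: "'i \<Rightarrow> 'a \<Rightarrow> real" and I +
  fixes \<kappa> :: real
  assumes int4: "\<And>k. k \<in> I \<Longrightarrow> integrable M (\<lambda>\<omega>. X k \<omega> ^ 4)"
    and mean: "\<And>k. k \<in> I \<Longrightarrow> expectation (X k) = 0"
    and var: "\<And>k. k \<in> I \<Longrightarrow> expectation (\<lambda>\<omega>. (X k \<omega>)\<^sup>2) = 1"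
    and third: "\<And>k. k \<in> I \<Longrightarrow> expectation (\<lambda>\<omega>. X k \<omega> ^ 3) = 0"
    and fourth: "\<And>k. k \<in> I \<Longrightarrow> expectation (\<lambda>\<omega>. X k \<omega> ^ 4) = \<kappa>"
begin

lemma abs_power_le: "\<bar>x ^ j\<bar> \<le> 1 + x ^ 4" if "j \<le> 4" for x :: real
proof (cases "\<bar>x\<bar> \<le> 1")
  case True
  then have "\<bar>x\<bar> ^ j \<le> 1" by (simp add: power_le_one)
  moreover have "0 \<le> x ^ 4" by simp
  ultimately show ?thesis unfolding power_abs by linarith
next
  case False
  then have "\<bar>x\<bar> ^ j \<le> \<bar>x\<bar> ^ 4" using that by (intro power_increasing) auto
  then show ?thesis by (simp add: power_abs)
qed

lemma int_power: "k \<in> I \<Longrightarrow> j \<le> 4 \<Longrightarrow> integrable M (\<lambda>\<omega>. X k \<omega> ^ j)"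
  by (rule Bochner_Integration.integrable_bound[where f="\<lambda>\<omega>. 1 + X k \<omega> ^ 4"])
     (auto intro: int4 intro!: AE_I2 order_trans[OF abs_power_le])

lemma int_simps [simp]:
  assumes "k \<in> I"
  shows "integrable M (X k)" "integrable M (\<lambda>\<omega>. (X k \<omega>)\<^sup>2)" "integrable M (\<lambda>\<omega>. X k \<omega> ^ 3)" "integrable M (\<lambda>\<omega>. X k \<omega> ^ 4)"
  using int_power[OF assms, of 1] int_power[OF assms, of 2] int_power[OF assms, of 3] int_power[OF assms, of 4] by auto

definition factor :: "'i set \<times> 'i set \<Rightarrow> 'i \<Rightarrow> real \<Rightarrow> real" where
  "factor r k z = (if k \<in> fst r then z else if k \<in> snd r then z\<^sup>2 - 1 else 1)"

text \<open>Spreading the product over all of \<open>V\<close>, with factor 1 off the two sets,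
  gives any two chaos elements a common index set on which independence can be applied coordinate by
  coordinate.\<close>

lemma chaos_eq_prod_factor:
  assumes "finite V" "A \<subseteq> V" "B \<subseteq> V"
  shows "chaos x (A, B) = (\<Prod>k\<in>V. factor (pattern (A, B)) k (x k))"
proof -
  let ?D = "(A - B) \<union> (B - A)"
  have "(\<Prod>k\<in>V. factor (pattern (A, B)) k (x k)) = (\<Prod>k\<in>?D \<union> A \<inter> B. factor (pattern (A, B)) k (x k))"
  proof (rule prod.mono_neutral_right)
    show "?D \<union> A \<inter> B \<subseteq> V" using assms(2,3) by blast
    show "\<forall>k\<in>V - (?D \<union> A \<inter> B). factor (pattern (A, B)) k (x k) = 1"
    proof
      fix k assume "k \<in> V - (?D \<union> A \<inter> B)"
      then have "k \<notin> fst (pattern (A, B))" "k \<notin> snd (pattern (A, B))"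
        unfolding pattern_def prod.case fst_conv snd_conv by blast+
      then show "factor (pattern (A, B)) k (x k) = 1" by (simp add: factor_def)
    qed
  qed (use assms(1) in simp)
  also have "\<dots> = (\<Prod>k\<in>?D. factor (pattern (A, B)) k (x k)) * (\<Prod>k\<in>A \<inter> B. factor (pattern (A, B)) k (x k))"
    using assms by (intro prod.union_disjoint) (auto intro: finite_subset)
  also have "\<dots> = chaos x (A, B)"
    unfolding chaos_def prod.case
    by (intro arg_cong2[where f="(*)"] prod.cong) (auto simp: factor_def pattern_def)
  finally show ?thesis ..
qed

text \<open>The functions 1, X and \<open>X^2 - 1\<close> are orthogonal because the first and third
  moments vanish and the second is 1. Their squared norms are 1, 1 and
  \<open>\<kappa> - 1\<close>.\<close>

lemma factor_moment:
  assumes "k \<in> I" "fst r \<inter> snd r = {}" "fst r' \<inter> snd r' = {}"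
  shows "integrable M (\<lambda>\<omega>. factor r k (X k \<omega>) * factor r' k (X k \<omega>))"
    and "expectation (\<lambda>\<omega>. factor r k (X k \<omega>) * factor r' k (X k \<omega>)) =
      (if (k \<in> fst r \<longleftrightarrow> k \<in> fst r') \<and> (k \<in> snd r \<longleftrightarrow> k \<in> snd r') then (if k \<in> snd r then \<kappa> - 1 else 1) else 0)"
proof -
  have e: "z * (z\<^sup>2 - 1) = z ^ 3 - z" "(z\<^sup>2 - 1) * z = z ^ 3 - z" "(z\<^sup>2 - 1)\<^sup>2 = z ^ 4 - 2 * z\<^sup>2 + 1" "(z\<^sup>2 - 1) * (z\<^sup>2 - 1) = z ^ 4 - 2 * z\<^sup>2 + 1" "z * z = z\<^sup>2" for z :: real
    by (simp_all add: algebra_simps power2_eq_square power3_eq_cube power4_eq_xxxx)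
  note s = mean[OF assms(1)] var[OF assms(1)] third[OF assms(1)] fourth[OF assms(1)] prob_space
  show "integrable M (\<lambda>\<omega>. factor r k (X k \<omega>) * factor r' k (X k \<omega>))"
    using assms by (cases "k \<in> fst r"; cases "k \<in> snd r"; cases "k \<in> fst r'"; cases "k \<in> snd r'")
      (auto simp: factor_def e)
  show "expectation (\<lambda>\<omega>. factor r k (X k \<omega>) * factor r' k (X k \<omega>)) =
      (if (k \<in> fst r \<longleftrightarrow> k \<in> fst r') \<and> (k \<in> snd r \<longleftrightarrow> k \<in> snd r') then (if k \<in> snd r then \<kappa> - 1 else 1) else 0)"
    using assms by (cases "k \<in> fst r"; cases "k \<in> snd r"; cases "k \<in> fst r'"; cases "k \<in> snd r'")
      (auto simp: factor_def e s)
qed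

text \<open>By independence the expectation factorizes over \<open>V\<close>. Different patterns
  select different factors at some index, where the expectation is 0; equal patterns collect
  \<open>\<kappa> - 1\<close> at each index of the intersection.\<close>

lemma chaos_orthogonal:
  assumes "finite V" "V \<subseteq> I" "p \<in> Pow V \<times> Pow V" "q \<in> Pow V \<times> Pow V"
  shows "integrable M (\<lambda>\<omega>. chaos (\<lambda>i. X i \<omega>) p * chaos (\<lambda>i. X i \<omega>) q)"
    and "expectation (\<lambda>\<omega>. chaos (\<lambda>i. X i \<omega>) p * chaos (\<lambda>i. X i \<omega>) q) =
      (if pattern q = pattern p then (\<kappa> - 1) ^ card (snd (pattern p)) else 0)"
proof -
  let ?f = "\<lambda>k \<omega>. factor (pattern p) k (X k \<omega>) * factor (pattern q) k (X k \<omega>)"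
  have prod: "(\<lambda>\<omega>. chaos (\<lambda>i. X i \<omega>) p * chaos (\<lambda>i. X i \<omega>) q) = (\<lambda>\<omega>. \<Prod>k\<in>V. ?f k \<omega>)"
    using assms by (cases p; cases q) (auto simp: chaos_eq_prod_factor[OF assms(1)] prod.distrib)
  have disj: "fst (pattern p) \<inter> snd (pattern p) = {}" "fst (pattern q) \<inter> snd (pattern q) = {}"
    by (auto simp: pattern_def split: prod.split)
  have sub: "fst (pattern p) \<subseteq> V" "snd (pattern p) \<subseteq> V" "fst (pattern q) \<subseteq> V" "snd (pattern q) \<subseteq> V"
    using assms by (auto simp: pattern_def)
  have meas: "(\<lambda>x. factor (pattern p) k x * factor (pattern q) k x) \<in> borel_measurable borel" for k
    by (auto simp: factor_def)
  have ind: "indep_vars (\<lambda>_. borel) ?f V"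
    by (rule indep_vars_compose2[OF indep_vars_subset[OF indep assms(2)] meas])
  have mom: "integrable M (?f k)" if "k \<in> V" for k
    using that assms(2) disj by (intro factor_moment) auto
  show "integrable M (\<lambda>\<omega>. chaos (\<lambda>i. X i \<omega>) p * chaos (\<lambda>i. X i \<omega>) q)"
    unfolding prod by (rule indep_vars_integrable[OF assms(1) ind mom])
  have "expectation (\<lambda>\<omega>. chaos (\<lambda>i. X i \<omega>) p * chaos (\<lambda>i. X i \<omega>) q) = (\<Prod>k\<in>V. expectation (?f k))"
    unfolding prod by (rule indep_vars_lebesgue_integral[OF assms(1) ind mom])
  also have "\<dots> = (\<Prod>k\<in>V. if (k \<in> fst (pattern p) \<longleftrightarrow> k \<in> fst (pattern q)) \<and> (k \<in> snd (pattern p) \<longleftrightarrow> k \<in> snd (pattern q))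
       then (if k \<in> snd (pattern p) then \<kappa> - 1 else 1) else 0)"
    using assms(2) disj by (intro prod.cong refl factor_moment) auto
  also have "\<dots> = (if pattern q = pattern p then (\<kappa> - 1) ^ card (snd (pattern p)) else 0)"
  proof (cases "pattern q = pattern p")
    case True
    have "(\<Prod>k\<in>V. if k \<in> snd (pattern p) then \<kappa> - 1 else 1) = (\<Prod>k\<in>snd (pattern p). \<kappa> - 1)"
      using assms(1) sub(2) by (intro prod.mono_neutral_cong_right) auto
    then show ?thesis using True by simp
  next
    case False
    obtain k where "k \<in> V" "\<not> ((k \<in> fst (pattern p) \<longleftrightarrow> k \<in> fst (pattern q)) \<and> (k \<in> snd (pattern p) \<longleftrightarrow> k \<in> snd (pattern q)))"
    proof (rule ccontr)
      assume "\<not> thesis"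
      with that have *: "(k \<in> fst (pattern p) \<longleftrightarrow> k \<in> fst (pattern q)) \<and> (k \<in> snd (pattern p) \<longleftrightarrow> k \<in> snd (pattern q))"
        if "k \<in> V" for k using that by blast
      then have "fst (pattern q) = fst (pattern p)" "snd (pattern q) = snd (pattern p)"
        using sub by blast+
      then show False using False by (simp add: prod_eq_iff)
    qed
    then have "(\<Prod>k\<in>V. if (k \<in> fst (pattern p) \<longleftrightarrow> k \<in> fst (pattern q)) \<and> (k \<in> snd (pattern p) \<longleftrightarrow> k \<in> snd (pattern q))
       then (if k \<in> snd (pattern p) then \<kappa> - 1 else 1) else 0) = 0"
      using assms(1) by (intro prod_zero bexI[of _ k]) auto
    then show ?thesis using False by simp
  qed
  finally show "expectation (\<lambda>\<omega>. chaos (\<lambda>i. X i \<omega>) p * chaos (\<lambda>i. X i \<omega>) q) =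
      (if pattern q = pattern p then (\<kappa> - 1) ^ card (snd (pattern p)) else 0)" .
qed

lemma chaos_sum_square:
  assumes "finite V" "V \<subseteq> I"
  shows "integrable M (\<lambda>\<omega>. (\<Sum>p\<in>Pow V \<times> Pow V. \<alpha> p * chaos (\<lambda>i. X i \<omega>) p)\<^sup>2)"
    and "expectation (\<lambda>\<omega>. (\<Sum>p\<in>Pow V \<times> Pow V. \<alpha> p * chaos (\<lambda>i. X i \<omega>) p)\<^sup>2) =
      (\<Sum>p\<in>Pow V \<times> Pow V. \<Sum>q\<in>{q\<in>Pow V \<times> Pow V. pattern q = pattern p}.
         (\<kappa> - 1) ^ card (snd (pattern p)) * \<alpha> p * \<alpha> q)"
proof -
  let ?P = "Pow V \<times> Pow V"
  have eq: "(\<lambda>\<omega>. (\<Sum>p\<in>?P. \<alpha> p * chaos (\<lambda>i. X i \<omega>) p)\<^sup>2) =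
    (\<lambda>\<omega>. \<Sum>p\<in>?P. \<Sum>q\<in>?P. (\<alpha> p * \<alpha> q) * (chaos (\<lambda>i. X i \<omega>) p * chaos (\<lambda>i. X i \<omega>) q))"
    unfolding power2_eq_square sum_product by (simp add: ac_simps)
  note orth = chaos_orthogonal[OF assms]
  show "integrable M (\<lambda>\<omega>. (\<Sum>p\<in>?P. \<alpha> p * chaos (\<lambda>i. X i \<omega>) p)\<^sup>2)"
    unfolding eq by (intro Bochner_Integration.integrable_sum integrable_mult_right orth)
  have "expectation (\<lambda>\<omega>. (\<Sum>p\<in>?P. \<alpha> p * chaos (\<lambda>i. X i \<omega>) p)\<^sup>2) =
    (\<Sum>p\<in>?P. \<Sum>q\<in>?P. (\<alpha> p * \<alpha> q) * expectation (\<lambda>\<omega>. chaos (\<lambda>i. X i \<omega>) p * chaos (\<lambda>i. X i \<omega>) q))"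
    unfolding eq
    by (subst Bochner_Integration.integral_sum, intro Bochner_Integration.integrable_sum integrable_mult_right orth,
        assumption, assumption, intro sum.cong refl, subst Bochner_Integration.integral_sum,
        intro integrable_mult_right orth, assumption, assumption, simp)
  also have "\<dots> = (\<Sum>p\<in>?P. \<Sum>q\<in>?P. if pattern q = pattern p then (\<kappa> - 1) ^ card (snd (pattern p)) * \<alpha> p * \<alpha> q else 0)"
    by (intro sum.cong refl) (simp add: orth(2))
  also have "\<dots> = (\<Sum>p\<in>?P. \<Sum>q\<in>{q\<in>?P. pattern q = pattern p}. (\<kappa> - 1) ^ card (snd (pattern p)) * \<alpha> p * \<alpha> q)"
    using assms(1) by (intro sum.cong refl sum.inter_filter[symmetric]) auto
  finally show "expectation (\<lambda>\<omega>. (\<Sum>p\<in>?P. \<alpha> p * chaos (\<lambda>i. X i \<omega>) p)\<^sup>2) = \<dots>" .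
qed

abbreviation W :: "'i set \<Rightarrow> ('i set \<Rightarrow> real) \<Rightarrow> 'a \<Rightarrow> real" where
  "W V c \<omega> \<equiv> multilinear V c (\<lambda>i. X i \<omega>)"

lemma multilinear_second_moment:
  assumes "finite V" "V \<subseteq> I"
  shows "integrable M (\<lambda>\<omega>. (W V c \<omega>)\<^sup>2)"
    and "expectation (\<lambda>\<omega>. (W V c \<omega>)\<^sup>2) = (\<Sum>S\<in>Pow V. (c S)\<^sup>2)"
proof -
  let ?P = "Pow V \<times> Pow V"
  have empty: "chaos x ({}, {}) = 1" for x :: "'i \<Rightarrow> real" by (simp add: chaos_def)
  have pat_empty: "pattern ({}, {}) = ({}, {} :: 'i set)" by (simp add: pattern_def)
  have pat: "pattern p = ({}, {}) \<longleftrightarrow> p = ({}, {})" for p :: "'i set \<times> 'i set"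
    by (cases p) (auto simp: pattern_def)
  have orth: "integrable M (\<lambda>\<omega>. chaos (\<lambda>i. X i \<omega>) p)"
    "expectation (\<lambda>\<omega>. chaos (\<lambda>i. X i \<omega>) p) = (if p = ({}, {}) then 1 else 0)" if "p \<in> ?P" for p
    using chaos_orthogonal[OF assms, of "({}, {})" p] that by (auto simp: empty pat pat_empty cong: if_cong)
  have eq: "(\<lambda>\<omega>. (W V c \<omega>)\<^sup>2) = (\<lambda>\<omega>. \<Sum>p\<in>?P. contraction V c (fst p) (snd p) * chaos (\<lambda>i. X i \<omega>) p)"
    by (simp add: multilinear_square[OF assms(1)] split_def)
  show "integrable M (\<lambda>\<omega>. (W V c \<omega>)\<^sup>2)"
    unfolding eq by (intro Bochner_Integration.integrable_sum integrable_mult_right orth)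
  have "expectation (\<lambda>\<omega>. (W V c \<omega>)\<^sup>2) = (\<Sum>p\<in>?P. contraction V c (fst p) (snd p) * (if p = ({}, {}) then 1 else 0))"
    unfolding eq by (subst Bochner_Integration.integral_sum) (auto simp: orth)
  also have "\<dots> = (\<Sum>p\<in>?P. if p = ({}, {}) then contraction V c {} {} else 0)"
    by (intro sum.cong) auto
  also have "\<dots> = (\<Sum>S\<in>Pow V. (c S)\<^sup>2)"
    using assms(1) by (simp add: contraction_empty)
  finally show "expectation (\<lambda>\<omega>. (W V c \<omega>)\<^sup>2) = (\<Sum>S\<in>Pow V. (c S)\<^sup>2)" .
qed

text \<open>After grouping by pattern the fourth moment is a sum of nonnegative terms. Only the
  empty pattern and those of full degree 2d are kept; the latter, with weights lowered to powers of
  2, add up to all squared contractions.\<close>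

lemma multilinear_fourth_moment:
  assumes "finite V" "V \<subseteq> I" "homogeneous d c" "d \<ge> 1" "\<kappa> \<ge> 3"
  shows "integrable M (\<lambda>\<omega>. W V c \<omega> ^ 4)"
    and "3 * (\<Sum>S\<in>Pow V. (c S)\<^sup>2)\<^sup>2 + mid_norm V d c \<le> expectation (\<lambda>\<omega>. W V c \<omega> ^ 4)"
proof -
  let ?P = "Pow V \<times> Pow V" and ?G = "\<lambda>p. contraction V c (fst p) (snd p)"
  let ?c = "\<lambda>p. c (fst p) * c (snd p)"
  have fin: "finite S" if "S \<subseteq> V" for S using that assms(1) finite_subset by auto
  have eq: "(\<lambda>\<omega>. W V c \<omega> ^ 4) = (\<lambda>\<omega>. (\<Sum>p\<in>?P. ?G p * chaos (\<lambda>i. X i \<omega>) p)\<^sup>2)"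
  proof
    fix \<omega>
    have "W V c \<omega> ^ 4 = ((W V c \<omega>)\<^sup>2)\<^sup>2" by (simp flip: power_mult)
    also have "\<dots> = (\<Sum>p\<in>?P. ?G p * chaos (\<lambda>i. X i \<omega>) p)\<^sup>2"
      by (simp add: multilinear_square[OF assms(1)] split_def)
    finally show "W V c \<omega> ^ 4 = (\<Sum>p\<in>?P. ?G p * chaos (\<lambda>i. X i \<omega>) p)\<^sup>2" .
  qed
  show "integrable M (\<lambda>\<omega>. W V c \<omega> ^ 4)"
    unfolding eq by (rule chaos_sum_square[OF assms(1,2)])
  define g where "g r = (\<Sum>p\<in>{p\<in>?P. pattern p = r}. ?G p)" for r
  define gc where "gc r = (\<Sum>p\<in>{p\<in>?P. pattern p = r}. ?c p)" for r
  have fourth_eq: "expectation (\<lambda>\<omega>. W V c \<omega> ^ 4) = (\<Sum>r\<in>pattern ` ?P. (\<kappa> - 1) ^ card (snd r) * (g r)\<^sup>2)"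
    unfolding eq chaos_sum_square(2)[OF assms(1,2)] g_def
    using assms(1) by (intro sum_same_class_eq_sum_squares) auto
  \<comment> \<open>Since \<open>card A + card B\<close> can be read off the pattern, full degree is
    a property of whole classes.\<close>
  define top where "top = {r \<in> pattern ` ?P. card (fst r) + 2 * card (snd r) = 2 * d}"
  have card_pat: "card (fst (pattern p)) + 2 * card (snd (pattern p)) = card (fst p) + card (snd p)"
    if "p \<in> ?P" for p
  proof -
    obtain A B where p: "p = (A, B)" by force
    have AB: "finite A" "finite B" using that p fin by auto
    have "card A = card (A - B) + card (A \<inter> B)" "card B = card (B - A) + card (A \<inter> B)"
      using AB card_Diff_subset_Int[of A B] card_Diff_subset_Int[of B A] card_mono[of A "A \<inter> B"] card_mono[of B "A \<inter> B"]
      by (auto simp: Int_commute)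
    moreover have "card (A - B \<union> (B - A)) = card (A - B) + card (B - A)"
      using AB by (intro card_Un_disjoint) auto
    ultimately show ?thesis by (simp add: p pattern_def)
  qed
  \<comment> \<open>At full degree either both sets have d elements, so that only
    \<open>Y = {}\<close> fits, or both sides vanish.\<close>
  have Gc: "?G p = ?c p" if "p \<in> ?P" "pattern p \<in> top" for p
  proof (cases "?G p = 0")
    case True
    show ?thesis
    proof (rule ccontr)
      assume n: "?G p \<noteq> ?c p"
      then have "c (fst p) \<noteq> 0" using True by auto
      then have "card (fst p) = d" using assms(3) by (auto simp: homogeneous_def)
      then show False
        using n contraction_top[OF assms(3,1), of "fst p" "snd p"] that by auto
    qed
  next
    case False
    then have "card (fst p) = card (snd p)"
      using that homogeneous_contraction_card[OF assms(3,1)] by auto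
    moreover have "card (fst p) + card (snd p) = 2 * d"
      using card_pat[OF that(1)] that(2) by (simp add: top_def)
    ultimately show ?thesis
      using contraction_top[OF assms(3,1), of "fst p" "snd p"] that by auto
  qed
  have r0: "({}, {}) \<in> pattern ` ?P" "({}, {}) \<notin> top"
    using assms(4) by (auto simp: top_def pattern_def image_iff intro!: bexI[of _ "({}, {})"])
  have fin_top: "finite top" using assms(1) by (auto simp: top_def)
  have g0: "g ({}, {}) = (\<Sum>S\<in>Pow V. (c S)\<^sup>2)"
  proof -
    have "{p\<in>?P. pattern p = ({}, {})} = {({}, {})}" by (auto simp: pattern_def)
    then show ?thesis by (simp add: contraction_empty g_def)
  qed
  have "(\<Sum>S\<in>Pow V. (c S)\<^sup>2)\<^sup>2 + (\<Sum>r\<in>top. 2 ^ card (snd r) * (gc r)\<^sup>2) =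
      (g ({}, {}))\<^sup>2 + (\<Sum>r\<in>top. 2 ^ card (snd r) * (g r)\<^sup>2)"
  proof -
    have "gc r = g r" if "r \<in> top" for r
      unfolding g_def gc_def using that by (intro sum.cong refl) (auto simp: Gc)
    then show ?thesis by (simp add: g0)
  qed
  \<comment> \<open>The hypothesis on the fourth moment enters here, as
    \<open>2 \<le> \<kappa> - 1\<close>.\<close>
  also have "\<dots> \<le> (g ({}, {}))\<^sup>2 + (\<Sum>r\<in>top. (\<kappa> - 1) ^ card (snd r) * (g r)\<^sup>2)"
    using assms(5) by (intro add_left_mono sum_mono mult_right_mono power_mono) simp_all
  also have "\<dots> = (\<Sum>r\<in>insert ({}, {}) top. (\<kappa> - 1) ^ card (snd r) * (g r)\<^sup>2)"
    by (subst sum.insert[OF fin_top r0(2)]) simp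
  also have "\<dots> \<le> (\<Sum>r\<in>pattern ` ?P. (\<kappa> - 1) ^ card (snd r) * (g r)\<^sup>2)"
  proof (rule sum_mono2)
    show "insert ({}, {}) top \<subseteq> pattern ` ?P" using r0 by (auto simp: top_def)
  qed (use assms(1,5) in simp_all)
  \<comment> \<open>Products \<open>c A * c B\<close> vanish unless both sets have d elements. The
    sum may therefore run over all patterns, as the identity for squared contractions
    demands.\<close>
  also have "(\<Sum>r\<in>top. 2 ^ card (snd r) * (gc r)\<^sup>2) = (\<Sum>r\<in>pattern ` ?P. 2 ^ card (snd r) * (gc r)\<^sup>2)"
  proof (intro sum.mono_neutral_left ballI)
    fix r assume r: "r \<in> pattern ` ?P - top"
    have "?c p = 0" if "p \<in> ?P" "pattern p = r" for p
    proof (rule ccontr)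
      assume "?c p \<noteq> 0"
      then have "card (fst p) = d" "card (snd p) = d" using assms(3) by (auto simp: homogeneous_def)
      then show False using card_pat[OF that(1)] that r by (auto simp: top_def)
    qed
    then have "gc r = 0" unfolding gc_def by (intro sum.neutral) auto
    then show "2 ^ card (snd r) * (gc r)\<^sup>2 = 0" by simp
  qed (use assms(1) in \<open>auto simp: top_def\<close>)
  also have "\<dots> = (\<Sum>p\<in>?P. \<Sum>q\<in>{q\<in>?P. pattern q = pattern p}. 2 ^ card (snd (pattern p)) * ?c p * ?c q)"
    unfolding gc_def using assms(1) by (intro sum_same_class_eq_sum_squares[symmetric]) auto
  also have "\<dots> = (\<Sum>A\<in>Pow V. \<Sum>B\<in>Pow V. (contraction V c A B)\<^sup>2)"
    unfolding sum_pattern_eq_sum_contraction_square[OF assms(1), symmetric]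
    by (intro sum.cong refl) (auto simp: pattern_def)
  finally have "(\<Sum>S\<in>Pow V. (c S)\<^sup>2)\<^sup>2 + (\<Sum>A\<in>Pow V. \<Sum>B\<in>Pow V. (contraction V c A B)\<^sup>2) \<le>
    (\<Sum>r\<in>pattern ` ?P. (\<kappa> - 1) ^ card (snd r) * (g r)\<^sup>2)" .
  with fourth_eq show "3 * (\<Sum>S\<in>Pow V. (c S)\<^sup>2)\<^sup>2 + mid_norm V d c \<le> expectation (\<lambda>\<omega>. W V c \<omega> ^ 4)"
    using sum_contraction_square_ge[OF assms(3,1,4)] by linarith
qed

text \<open>The factor \<open>d - card A\<close> removes the pairs of d-sets, and centring removes
  the empty pair, so only middle sets remain. The constant has two sources:
  \<open>(\<kappa> - 1) ^ d\<close> bounds the second moment of the chaos elements that occur, and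
  \<open>16 ^ d = 4 ^ (2 * d)\<close> bounds the number of pairs sharing a pattern, since a pattern
  fixes the union \<open>A \<union> B\<close>, of at most 2d elements here.\<close>

lemma sum_partial_derivative_square_variance:
  assumes "finite V" "V \<subseteq> I" "homogeneous d c" "d \<ge> 1" "\<kappa> \<ge> 2"
  defines "T \<equiv> \<lambda>\<omega>. (\<Sum>k\<in>V. (W (V - {k}) (\<lambda>S. c (insert k S)) \<omega>)\<^sup>2) / real d"
  shows "integrable M (\<lambda>\<omega>. (T \<omega> - (\<Sum>S\<in>Pow V. (c S)\<^sup>2))\<^sup>2)"
    and "expectation (\<lambda>\<omega>. (T \<omega> - (\<Sum>S\<in>Pow V. (c S)\<^sup>2))\<^sup>2) \<le> (16 * (\<kappa> - 1)) ^ d * mid_norm V d c"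
proof -
  let ?P = "Pow V \<times> Pow V" and ?G = "\<lambda>p. contraction V c (fst p) (snd p)"
  have fin: "finite S" if "S \<subseteq> V" for S using that assms(1) finite_subset by auto
  define \<alpha> where "\<alpha> p = (if p = ({}, {}) then 0 else real (d - card (fst p)) / real d * ?G p)" for p
  have eq: "T \<omega> - (\<Sum>S\<in>Pow V. (c S)\<^sup>2) = (\<Sum>p\<in>?P. \<alpha> p * chaos (\<lambda>i. X i \<omega>) p)" for \<omega>
  proof -
    have "T \<omega> = (\<Sum>p\<in>?P. real (d - card (fst p)) / real d * ?G p * chaos (\<lambda>i. X i \<omega>) p)"
      unfolding T_def sum_partial_derivative_square_homogeneous[OF assms(1,3)]
      by (simp add: sum_divide_distrib split_def)
    also have "\<dots> = (\<Sum>p\<in>?P. \<alpha> p * chaos (\<lambda>i. X i \<omega>) p) + (\<Sum>p\<in>?P. if p = ({}, {}) then (\<Sum>S\<in>Pow V. (c S)\<^sup>2) else 0)"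
      using assms(4) by (subst sum.distrib[symmetric], intro sum.cong refl) (auto simp: \<alpha>_def contraction_empty chaos_def)
    finally show ?thesis
      using assms(1) by simp
  qed
  show "integrable M (\<lambda>\<omega>. (T \<omega> - (\<Sum>S\<in>Pow V. (c S)\<^sup>2))\<^sup>2)"
    unfolding eq by (rule chaos_sum_square[OF assms(1,2)])
  define u where "u = (\<kappa> - 1) ^ d"
  have u: "u \<ge> 0" using assms(5) by (simp add: u_def)
  have nz: "card (fst p) = card (snd p)" "fst p \<in> mid V d" "snd p \<in> mid V d" if "\<alpha> p \<noteq> 0" "p \<in> ?P" for p
  proof -
    have n: "p \<noteq> ({}, {})" "card (fst p) < d" "?G p \<noteq> 0" using that by (auto simp: \<alpha>_def split: if_splits)
    show c: "card (fst p) = card (snd p)"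
      using n that homogeneous_contraction_card[OF assms(3,1)] by auto
    have "card (fst p) \<noteq> 0"
    proof
      assume "card (fst p) = 0"
      then have "fst p = {}" "snd p = {}" using c fin[of "fst p"] fin[of "snd p"] that by auto
      then show False using n by (cases p) auto
    qed
    then show "fst p \<in> mid V d" "snd p \<in> mid V d" using c n that by (auto simp: mid_def)
  qed
  let ?N = "\<lambda>p. {q\<in>?P. pattern q = pattern p}"
  have bound: "(\<kappa> - 1) ^ card (snd (pattern p)) * \<alpha> p * \<alpha> q \<le> u * ((\<alpha> p)\<^sup>2 + (\<alpha> q)\<^sup>2) / 2"
    if "p \<in> ?P" "q \<in> ?P" for p q
  proof (cases "\<alpha> p = 0")
    case False
    have "card (snd (pattern p)) \<le> card (fst p)"
      using that fin[of "fst p"] by (auto simp: pattern_def split: prod.split intro!: card_mono)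
    also have "\<dots> \<le> d" using nz[OF False that(1)] by (auto simp: mid_def)
    finally have le: "(\<kappa> - 1) ^ card (snd (pattern p)) \<le> u" "0 \<le> (\<kappa> - 1) ^ card (snd (pattern p))"
      using assms(5) by (auto simp: u_def intro!: power_increasing)
    have "\<alpha> p * \<alpha> q \<le> ((\<alpha> p)\<^sup>2 + (\<alpha> q)\<^sup>2) / 2"
      using sum_squares_bound[of "\<alpha> p" "\<alpha> q"] by (simp add: power2_eq_square)
    then have "(\<kappa> - 1) ^ card (snd (pattern p)) * (\<alpha> p * \<alpha> q) \<le> (\<kappa> - 1) ^ card (snd (pattern p)) * (((\<alpha> p)\<^sup>2 + (\<alpha> q)\<^sup>2) / 2)"
      using le(2) by (rule mult_left_mono)
    also have "\<dots> \<le> u * (((\<alpha> p)\<^sup>2 + (\<alpha> q)\<^sup>2) / 2)"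
      using le(1) by (rule mult_right_mono) simp
    finally have "(\<kappa> - 1) ^ card (snd (pattern p)) * (\<alpha> p * \<alpha> q) \<le> u * (((\<alpha> p)\<^sup>2 + (\<alpha> q)\<^sup>2) / 2)" .
    then show ?thesis by simp
  qed (use u in simp)
  have swap: "(\<Sum>p\<in>?P. \<Sum>q\<in>?N p. u * (\<alpha> q)\<^sup>2) = (\<Sum>p\<in>?P. \<Sum>q\<in>?N p. u * (\<alpha> p)\<^sup>2)"
  proof -
    have "(\<Sum>p\<in>?P. \<Sum>q\<in>?N p. u * (\<alpha> q)\<^sup>2) = (\<Sum>p\<in>?P. \<Sum>q\<in>?P. if pattern q = pattern p then u * (\<alpha> q)\<^sup>2 else 0)"
      using assms(1) by (intro sum.cong refl sum.inter_filter) auto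
    also have "\<dots> = (\<Sum>q\<in>?P. \<Sum>p\<in>?P. if pattern q = pattern p then u * (\<alpha> q)\<^sup>2 else 0)"
      by (rule sum.swap)
    also have "\<dots> = (\<Sum>q\<in>?P. \<Sum>p\<in>?P. if pattern p = pattern q then u * (\<alpha> q)\<^sup>2 else 0)"
      by (intro sum.cong refl if_cong) auto
    also have "\<dots> = (\<Sum>p\<in>?P. \<Sum>q\<in>?N p. u * (\<alpha> p)\<^sup>2)"
      using assms(1) by (intro sum.cong refl sum.inter_filter[symmetric]) auto
    finally show ?thesis .
  qed
  have "expectation (\<lambda>\<omega>. (T \<omega> - (\<Sum>S\<in>Pow V. (c S)\<^sup>2))\<^sup>2) \<le> (\<Sum>p\<in>?P. \<Sum>q\<in>?N p. u * ((\<alpha> p)\<^sup>2 + (\<alpha> q)\<^sup>2) / 2)"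
    unfolding eq chaos_sum_square(2)[OF assms(1,2)] by (intro sum_mono bound) auto
  also have "\<dots> = ((\<Sum>p\<in>?P. \<Sum>q\<in>?N p. u * (\<alpha> p)\<^sup>2) + (\<Sum>p\<in>?P. \<Sum>q\<in>?N p. u * (\<alpha> q)\<^sup>2)) / 2"
    by (simp only: sum.distrib[symmetric] sum_divide_distrib distrib_left)
  also have "\<dots> = (\<Sum>p\<in>?P. real (card (?N p)) * (u * (\<alpha> p)\<^sup>2))"
    unfolding swap by simp
  also have "\<dots> \<le> (\<Sum>p\<in>?P. 16 ^ d * (u * (\<alpha> p)\<^sup>2))"
  proof (intro sum_mono)
    fix p assume p: "p \<in> ?P"
    show "real (card (?N p)) * (u * (\<alpha> p)\<^sup>2) \<le> 16 ^ d * (u * (\<alpha> p)\<^sup>2)"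
    proof (cases "\<alpha> p = 0")
      case False
      let ?U = "fst p \<union> snd p"
      have U: "finite ?U" using p fin by auto
      have un: "fst q \<union> snd q = fst (pattern q) \<union> snd (pattern q)" for q :: "'i set \<times> 'i set"
        by (cases q) (auto simp: pattern_def)
      have "?N p \<subseteq> Pow ?U \<times> Pow ?U"
      proof
        fix q assume "q \<in> ?N p"
        then have "fst q \<union> snd q = ?U" using un[of p] un[of q] by simp
        then show "q \<in> Pow ?U \<times> Pow ?U" by (simp add: mem_Times_iff) blast
      qed
      then have "card (?N p) \<le> card (Pow ?U \<times> Pow ?U)"
        using U by (intro card_mono) auto
      also have "\<dots> = 4 ^ card ?U"
        using U by (simp add: card_cartesian_product card_Pow flip: power_mult_distrib)
      also have "\<dots> \<le> 4 ^ (2 * d)"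
        using nz[OF False p] by (intro power_increasing order_trans[OF card_Un_le]) (auto simp: mid_def)
      finally have "real (card (?N p)) \<le> real (16 ^ d)"
        by (intro of_nat_mono) (simp add: power_mult)
      then have "real (card (?N p)) \<le> 16 ^ d" by simp
      then show ?thesis using u by (intro mult_right_mono) auto
    qed simp
  qed
  also have "\<dots> = (16 * (\<kappa> - 1)) ^ d * (\<Sum>p\<in>?P. (\<alpha> p)\<^sup>2)"
    by (simp only: u_def power_mult_distrib sum_distrib_left mult.assoc)
  also have "(\<Sum>p\<in>?P. (\<alpha> p)\<^sup>2) = (\<Sum>p\<in>mid V d \<times> mid V d. (\<alpha> p)\<^sup>2)"
  proof (rule sum.mono_neutral_right)
    show "\<forall>i\<in>?P - mid V d \<times> mid V d. (\<alpha> i)\<^sup>2 = 0"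
      using nz by (auto simp: mem_Times_iff)
  qed (use assms(1) in \<open>auto simp: mid_def\<close>)
  also have "\<dots> \<le> (\<Sum>p\<in>mid V d \<times> mid V d. (?G p)\<^sup>2)"
  proof (intro sum_mono)
    fix p :: "'i set \<times> 'i set"
    have "(real (d - card (fst p)) / real d)\<^sup>2 \<le> 1"
      using assms(4) by (intro power_le_one) auto
    then have "(real (d - card (fst p)) / real d)\<^sup>2 * (?G p)\<^sup>2 \<le> 1 * (?G p)\<^sup>2"
      by (intro mult_right_mono) auto
    then show "(\<alpha> p)\<^sup>2 \<le> (?G p)\<^sup>2" by (simp add: \<alpha>_def power_mult_distrib power_divide)
  qed
  also have "\<dots> = mid_norm V d c"
    by (simp add: mid_norm_def sum.cartesian_product split_def)
  finally show "expectation (\<lambda>\<omega>. (T \<omega> - (\<Sum>S\<in>Pow V. (c S)\<^sup>2))\<^sup>2) \<le> (16 * (\<kappa> - 1)) ^ d * mid_norm V d c"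
    using assms(5) by (simp add: mult_left_mono)
qed

end

subsection \<open>Hypercontractivity\<close>

lemma exp_le_quadratic: "exp w \<le> 1 + w + w\<^sup>2 * exp \<bar>w\<bar>" for w :: real
proof -
  obtain t where t: "\<bar>t\<bar> \<le> \<bar>w\<bar>" "exp w = (\<Sum>m<2. w ^ m / fact m) + exp t / fact 2 * w ^ 2"
    using Maclaurin_exp_le[of w 2] by blast
  have "exp t / fact 2 * w ^ 2 \<le> exp \<bar>w\<bar> * w ^ 2"
  proof (rule mult_right_mono)
    have "exp t \<le> exp \<bar>w\<bar>" using t(1) by simp
    moreover have "exp t / fact 2 \<le> exp t" by simp
    ultimately show "exp t / fact 2 \<le> exp \<bar>w\<bar>" by linarith
  qed simp
  then show ?thesis using t(2) by (simp add: numeral_2_eq_2 mult.commute)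
qed

lemma one_plus_powr_le:
  fixes z q :: real
  assumes "q \<ge> 0" "\<bar>z\<bar> \<le> 1 / 2"
  shows "(1 + z) powr q \<le> 1 + q * z + q\<^sup>2 * exp q * z\<^sup>2"
proof -
  have z: "1 + z > 0" using assms(2) by (simp add: abs_le_iff)
  have "(1 + z) powr q = exp (q * ln (1 + z))" using z by (simp add: powr_def)
  also have "\<dots> \<le> exp (q * z)"
    using assms(1) z ln_add_one_self_le_self2[of z] by (simp add: mult_left_mono)
  also have "\<dots> \<le> 1 + q * z + (q * z)\<^sup>2 * exp \<bar>q * z\<bar>" by (rule exp_le_quadratic)
  also have "\<dots> \<le> 1 + q * z + (q * z)\<^sup>2 * exp q"
  proof -
    have "\<bar>q * z\<bar> \<le> q * 1" unfolding abs_mult using assms by (intro mult_mono) auto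
    then show ?thesis by (intro add_left_mono mult_left_mono) auto
  qed
  finally show ?thesis by (simp add: power_mult_distrib ac_simps)
qed

text \<open>If \<open>\<bar>a\<bar> \<le> 2 * \<bar>y\<bar>\<close>, the left side and the linear
  term are of order \<open>\<bar>y\<bar> powr q\<close>, with constants \<open>3 powr q\<close> and
  \<open>q * 2 powr (q - 1)\<close>. Otherwise \<open>z = y / a\<close> is at most 1/2 in absolute
  value, and the second-order expansion of \<open>(1 + z) powr q\<close> gives the summand
  \<open>q^2 * exp q\<close>. The linear term is kept exactly so that a centred \<open>y\<close>
  independent of \<open>a\<close> cancels it.\<close>

lemma abs_add_powr_le:
  fixes q :: real
  assumes "q \<ge> 2"
  obtains C where "C \<ge> 0" and "\<And>a y. \<bar>a + y\<bar> powr q \<le>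
    \<bar>a\<bar> powr q + q * (sgn a * \<bar>a\<bar> powr (q - 1)) * y + C * (\<bar>a\<bar> powr (q - 2) * y\<^sup>2 + \<bar>y\<bar> powr q)"
proof
  let ?C = "3 powr q + q * 2 powr (q - 1) + q\<^sup>2 * exp q"
  show "?C \<ge> 0" using assms by simp
  fix a y :: real
  show "\<bar>a + y\<bar> powr q \<le>
    \<bar>a\<bar> powr q + q * (sgn a * \<bar>a\<bar> powr (q - 1)) * y + ?C * (\<bar>a\<bar> powr (q - 2) * y\<^sup>2 + \<bar>y\<bar> powr q)"
  proof (cases "\<bar>a\<bar> \<le> 2 * \<bar>y\<bar>")
    case True
    have "\<bar>a + y\<bar> powr q \<le> (3 * \<bar>y\<bar>) powr q"
      using True assms by (intro powr_mono2) auto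
    also have "\<dots> = 3 powr q * \<bar>y\<bar> powr q" by (simp add: powr_mult)
    finally have 1: "\<bar>a + y\<bar> powr q \<le> 3 powr q * \<bar>y\<bar> powr q" .
    have "\<bar>q * (sgn a * \<bar>a\<bar> powr (q - 1)) * y\<bar> = q * (\<bar>sgn a\<bar> * \<bar>a\<bar> powr (q - 1) * \<bar>y\<bar>)"
      using assms by (simp add: abs_mult)
    also have "\<dots> \<le> q * (1 * (2 * \<bar>y\<bar>) powr (q - 1) * \<bar>y\<bar>)"
      using True assms by (intro mult_left_mono mult_right_mono mult_mono powr_mono2) (auto simp: abs_sgn_eq)
    also have "\<dots> = q * 2 powr (q - 1) * (\<bar>y\<bar> powr (q - 1) * \<bar>y\<bar>)"
      by (simp add: powr_mult)
    also have "\<bar>y\<bar> powr (q - 1) * \<bar>y\<bar> = \<bar>y\<bar> powr q"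
      by (cases "y = 0") (simp_all add: powr_diff)
    finally have 2: "\<bar>q * (sgn a * \<bar>a\<bar> powr (q - 1)) * y\<bar> \<le> q * 2 powr (q - 1) * \<bar>y\<bar> powr q" .
    have 3: "?C * (\<bar>a\<bar> powr (q - 2) * y\<^sup>2 + \<bar>y\<bar> powr q) =
      3 powr q * \<bar>y\<bar> powr q + q * 2 powr (q - 1) * \<bar>y\<bar> powr q + (q\<^sup>2 * exp q * \<bar>y\<bar> powr q + ?C * (\<bar>a\<bar> powr (q - 2) * y\<^sup>2))"
      by (simp add: algebra_simps)
    have 4: "0 \<le> q\<^sup>2 * exp q * \<bar>y\<bar> powr q" "0 \<le> ?C * (\<bar>a\<bar> powr (q - 2) * y\<^sup>2)" "0 \<le> \<bar>a\<bar> powr q"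
      using assms by simp_all
    show ?thesis using 1 2 4 unfolding 3 by linarith
  next
    case False
    then have a: "a \<noteq> 0" by auto
    define z where "z = y / a"
    have z: "\<bar>z\<bar> \<le> 1 / 2" using False a by (simp add: z_def abs_divide divide_le_eq)
    have "a + y = a * (1 + z)" using a by (simp add: z_def distrib_left)
    moreover have z0: "1 + z \<ge> 0" using z by (simp add: abs_le_iff)
    ultimately have "\<bar>a + y\<bar> powr q = \<bar>a\<bar> powr q * (1 + z) powr q"
      by (simp add: abs_mult powr_mult)
    also have "\<dots> \<le> \<bar>a\<bar> powr q * (1 + q * z + q\<^sup>2 * exp q * z\<^sup>2)"
      using one_plus_powr_le[OF _ z, of q] assms by (intro mult_left_mono) auto
    also have "\<dots> = \<bar>a\<bar> powr q + q * (\<bar>a\<bar> powr q * z) + q\<^sup>2 * exp q * (\<bar>a\<bar> powr q * z\<^sup>2)"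
      by (simp add: algebra_simps)
    also have "\<bar>a\<bar> powr q * z = sgn a * \<bar>a\<bar> powr (q - 1) * y"
      using a by (simp add: z_def powr_diff sgn_if divide_simps)
    also have "\<bar>a\<bar> powr q * z\<^sup>2 = \<bar>a\<bar> powr (q - 2) * y\<^sup>2"
      using a by (simp add: z_def powr_diff power_divide divide_simps)
    finally have 1: "\<bar>a + y\<bar> powr q \<le> \<bar>a\<bar> powr q + q * (sgn a * \<bar>a\<bar> powr (q - 1)) * y + q\<^sup>2 * exp q * (\<bar>a\<bar> powr (q - 2) * y\<^sup>2)"
      by (simp add: mult.assoc)
    have 3: "?C * (\<bar>a\<bar> powr (q - 2) * y\<^sup>2 + \<bar>y\<bar> powr q) =
      q\<^sup>2 * exp q * (\<bar>a\<bar> powr (q - 2) * y\<^sup>2) + ((3 powr q + q * 2 powr (q - 1)) * (\<bar>a\<bar> powr (q - 2) * y\<^sup>2) + ?C * \<bar>y\<bar> powr q)"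
      by (simp add: algebra_simps)
    have 4: "0 \<le> (3 powr q + q * 2 powr (q - 1)) * (\<bar>a\<bar> powr (q - 2) * y\<^sup>2)" "0 \<le> ?C * \<bar>y\<bar> powr q"
      using assms by simp_all
    show ?thesis using 1 4 unfolding 3 by linarith
  qed
qed

lemma powr_mult_square_le:
  fixes y z q :: real
  assumes "q \<ge> 2" "y \<ge> 0" "z \<ge> 0"
  shows "y powr (q - 2) * z\<^sup>2 \<le> y powr q + z powr q"
proof -
  have e: "w powr (q - 2) * w\<^sup>2 = w powr q" if "w \<ge> 0" for w :: real
    using that by (cases "w = 0") (simp_all add: powr_diff)
  show ?thesis
  proof (cases "z \<le> y")
    case True
    then have "y powr (q - 2) * z\<^sup>2 \<le> y powr (q - 2) * y\<^sup>2"
      using assms by (intro mult_left_mono power_mono) auto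
    then show ?thesis using e[of y] assms by (simp add: add_increasing2)
  next
    case False
    then have "y powr (q - 2) * z\<^sup>2 \<le> z powr (q - 2) * z\<^sup>2"
      using assms by (intro mult_right_mono powr_mono2) auto
    then show ?thesis using e[of z] assms by (simp add: add_increasing)
  qed
qed

text \<open>The preceding bound at \<open>\<bar>a\<bar> / sqrt s\<close> and
  \<open>\<bar>b\<bar> / sqrt u\<close>. It takes the place of Hoelder's inequality: if the q-th
  moments of a and b are at most \<open>s powr (q / 2)\<close> and \<open>u powr (q / 2)\<close>,
  the expectation of the left side is at most \<open>2 * s powr (q / 2 - 1) * u\<close>.\<close>

lemma powr_mult_square_scaled_le:
  fixes a b q s u :: real
  assumes "q \<ge> 2" "s > 0" "u > 0"
  shows "\<bar>a\<bar> powr (q - 2) * b\<^sup>2 \<le> s powr (q / 2 - 1) * u * (\<bar>a\<bar> powr q / s powr (q / 2) + \<bar>b\<bar> powr q / u powr (q / 2))"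
proof -
  have r: "(\<bar>w\<bar> / sqrt v) powr e = \<bar>w\<bar> powr e / v powr (e / 2)" if "v > 0" for w v e :: real
    using that by (simp add: powr_divide powr_half_sqrt[symmetric] powr_powr)
  have "(\<bar>a\<bar> / sqrt s) powr (q - 2) * (\<bar>b\<bar> / sqrt u)\<^sup>2 \<le> (\<bar>a\<bar> / sqrt s) powr q + (\<bar>b\<bar> / sqrt u) powr q"
    using assms by (intro powr_mult_square_le) auto
  then have "\<bar>a\<bar> powr (q - 2) / s powr (q / 2 - 1) * (b\<^sup>2 / u) \<le> \<bar>a\<bar> powr q / s powr (q / 2) + \<bar>b\<bar> powr q / u powr (q / 2)"
    using assms by (simp add: r power_divide diff_divide_distrib)
  then have "(s powr (q / 2 - 1) * u) * (\<bar>a\<bar> powr (q - 2) / s powr (q / 2 - 1) * (b\<^sup>2 / u)) \<le>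
     (s powr (q / 2 - 1) * u) * (\<bar>a\<bar> powr q / s powr (q / 2) + \<bar>b\<bar> powr q / u powr (q / 2))"
    using assms by (intro mult_left_mono) auto
  then show ?thesis using assms by simp
qed

text \<open>Split \<open>(s + t) powr p\<close> as \<open>(s + t) powr (p - 1)\<close> times
  \<open>s\<close>, \<open>t / 2\<close> and \<open>t / 2\<close>, and bound the power from below by
  that of \<open>s\<close> or of \<open>t\<close>. The last two terms are shaped to absorb the two
  errors of the hypercontractive induction step.\<close>

lemma add_powr_ge:
  fixes s t p :: real
  assumes "p \<ge> 1" "s > 0" "t > 0"
  shows "s powr p + s powr (p - 1) * t / 2 + t powr p / 2 \<le> (s + t) powr p"
proof -
  have e: "w powr p = w powr (p - 1) * w" if "w > 0" for w :: real
    using that by (simp add: powr_diff)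
  have 1: "s powr (p - 1) \<le> (s + t) powr (p - 1)" "t powr (p - 1) \<le> (s + t) powr (p - 1)"
    using assms by (auto intro: powr_mono2)
  have "s powr (p - 1) * s \<le> (s + t) powr (p - 1) * s" "s powr (p - 1) * t \<le> (s + t) powr (p - 1) * t"
    "t powr (p - 1) * t \<le> (s + t) powr (p - 1) * t"
    using 1 assms by (auto intro: mult_right_mono)
  moreover have "(s + t) powr p = (s + t) powr (p - 1) * s + (s + t) powr (p - 1) * t"
    using e[of "s + t"] assms by (simp add: distrib_left)
  ultimately show ?thesis using e[OF assms(2)] e[OF assms(3)] by linarith
qed

context indep_family
begin

text \<open>
  Expanding to second order around \<open>a\<close> gives
  \<open>E|a + X\<^sub>k b|\<^sup>q \<le> E|a|\<^sup>q + C (E|a|\<^sup>q\<^sup>-\<^sup>2b\<^sup>2 + E|X\<^sub>k|\<^sup>q E|b|\<^sup>q)\<close>, and the right-hand side is at most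
  \<open>(s + \<Lambda> u)\<^sup>q\<^sup>/\<^sup>2\<close> whenever \<open>E|a|\<^sup>q \<le> s\<^sup>q\<^sup>/\<^sup>2\<close> and \<open>E|b|\<^sup>q \<le> u\<^sup>q\<^sup>/\<^sup>2\<close>; the bound thus tensorizes.
\<close>

lemma hypercontractivity:
  fixes q K :: real
  assumes q: "q \<ge> 2"
    and intq: "\<And>k. k \<in> I \<Longrightarrow> integrable M (\<lambda>\<omega>. \<bar>X k \<omega>\<bar> powr q)"
    and K: "\<And>k. k \<in> I \<Longrightarrow> expectation (\<lambda>\<omega>. \<bar>X k \<omega>\<bar> powr q) \<le> K"
    and int1: "\<And>k. k \<in> I \<Longrightarrow> integrable M (X k)" and mean: "\<And>k. k \<in> I \<Longrightarrow> expectation (X k) = 0"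
    and int2: "\<And>k. k \<in> I \<Longrightarrow> integrable M (\<lambda>\<omega>. (X k \<omega>)\<^sup>2)" and var: "\<And>k. k \<in> I \<Longrightarrow> expectation (\<lambda>\<omega>. (X k \<omega>)\<^sup>2) = 1"
  obtains \<Lambda> where "\<Lambda> \<ge> 1"
    and "\<And>V c. finite V \<Longrightarrow> V \<subseteq> I \<Longrightarrow> integrable M (\<lambda>\<omega>. \<bar>multilinear V c (\<lambda>i. X i \<omega>)\<bar> powr q)"
    and "\<And>V c. finite V \<Longrightarrow> V \<subseteq> I \<Longrightarrow> expectation (\<lambda>\<omega>. \<bar>multilinear V c (\<lambda>i. X i \<omega>)\<bar> powr q) \<le>
      (\<Sum>S\<in>Pow V. \<Lambda> ^ card S * (c S)\<^sup>2) powr (q / 2)"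
proof -
  obtain C where C: "C \<ge> 0" and exp_le: "\<And>a y. \<bar>a + y\<bar> powr q \<le>
    \<bar>a\<bar> powr q + q * (sgn a * \<bar>a\<bar> powr (q - 1)) * y + C * (\<bar>a\<bar> powr (q - 2) * y\<^sup>2 + \<bar>y\<bar> powr q)"
    using abs_add_powr_le[OF q] by blast
  \<comment> \<open>In the induction step \<open>4 * C\<close> absorbs the quadratic term and
    \<open>2 * C * K\<close> the term of order q; \<open>\<Lambda> \<ge> 1\<close> ensures
    \<open>\<Lambda> \<le> \<Lambda> powr (q / 2)\<close>.\<close>
  define \<Lambda> where "\<Lambda> = max 1 (max (4 * C) (2 * C * K))"
  have \<Lambda>: "\<Lambda> \<ge> 1" "4 * C \<le> \<Lambda>" "2 * C * K \<le> \<Lambda>" by (auto simp: \<Lambda>_def)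
  define L where "L V c = (\<Sum>S\<in>Pow V. \<Lambda> ^ card S * (c S)\<^sup>2)" for V :: "'i set" and c
  have L0: "L V c \<ge> 0" for V c using \<Lambda> by (auto simp: L_def intro!: sum_nonneg)
  let ?W = "\<lambda>V c \<omega>. multilinear V c (\<lambda>i. X i \<omega>)"
  \<comment> \<open>The bound is claimed for every \<open>s\<close> strictly above
    \<open>L V c\<close>, because the scaled inequality divides by powers of such numbers and
    \<open>L V c\<close> may be 0.\<close>
  have main: "integrable M (\<lambda>\<omega>. \<bar>?W V c \<omega>\<bar> powr q) \<and>
      (\<forall>s>L V c. expectation (\<lambda>\<omega>. \<bar>?W V c \<omega>\<bar> powr q) \<le> s powr (q / 2))"
    if "finite V" "V \<subseteq> I" for V c
    using that
  proof (induction V arbitrary: c rule: finite_induct)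
    case empty
    have "\<bar>c {}\<bar> powr q \<le> s powr (q / 2)" if "L {} c < s" for s
    proof -
      have sq: "\<bar>c {}\<bar> powr 2 = (c {})\<^sup>2" by simp
      have "\<bar>c {}\<bar> powr q = ((c {})\<^sup>2) powr (q / 2)"
        unfolding sq[symmetric] by (subst powr_powr) simp
      also have "\<dots> \<le> s powr (q / 2)"
        using that q by (intro powr_mono2) (auto simp: L_def)
      finally show ?thesis .
    qed
    then show ?case by (simp add: multilinear_def prob_space)
  next
    case (insert k V)
    have k: "k \<in> I" and V: "V \<subseteq> I" using insert.prems by auto
    define c' where "c' S = c (insert k S)" for S
    let ?a = "?W V c" and ?b = "?W V c'"
    note [measurable] = X_measurable[OF k]
    have meas: "?W V c'' \<in> borel_measurable M" for c''
      by (rule multilinear_measurable) (use V in auto)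
    note [measurable] = meas[of c] meas[of c']
    have ia: "integrable M (\<lambda>\<omega>. \<bar>?a \<omega>\<bar> powr q)" and ib: "integrable M (\<lambda>\<omega>. \<bar>?b \<omega>\<bar> powr q)"
      using insert.IH[OF V] by auto
    have W: "?W (insert k V) c \<omega> = ?a \<omega> + X k \<omega> * ?b \<omega>" for \<omega>
      using insert.hyps by (simp add: multilinear_insert c'_def[abs_def])
    note mPiM [measurable] = multilinear_measurable_PiM[OF insert.hyps(1), of c] multilinear_measurable_PiM[OF insert.hyps(1), of c']
    note split = integrable_mult_split[OF k V insert.hyps(2)] integral_mult_split[OF k V insert.hyps(2)]
    define h where "h x = sgn (multilinear V c x) * \<bar>multilinear V c x\<bar> powr (q - 1) * multilinear V c' x" for x
    define r where "r x = \<bar>multilinear V c x\<bar> powr (q - 2) * (multilinear V c' x)\<^sup>2" for x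
    define l where "l x = \<bar>multilinear V c' x\<bar> powr q" for x
    have rs: "h (restrict x V) = h x" "r (restrict x V) = r x" "l (restrict x V) = l x" for x
      by (simp_all add: h_def r_def l_def multilinear_restrict)
    have hm: "h \<in> borel_measurable (PiM V (\<lambda>_. borel))" "r \<in> borel_measurable (PiM V (\<lambda>_. borel))" "l \<in> borel_measurable (PiM V (\<lambda>_. borel))"
      unfolding h_def r_def l_def by measurable
    have il: "integrable M (\<lambda>\<omega>. l (\<lambda>i. X i \<omega>))" using ib by (simp add: l_def)
    have ir: "integrable M (\<lambda>\<omega>. r (\<lambda>i. X i \<omega>))"
    proof (rule Bochner_Integration.integrable_bound)
      show "integrable M (\<lambda>\<omega>. \<bar>?a \<omega>\<bar> powr q + \<bar>?b \<omega>\<bar> powr q)" using ia ib by simp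
      have "norm (r (\<lambda>i. X i \<omega>)) \<le> norm (\<bar>?a \<omega>\<bar> powr q + \<bar>?b \<omega>\<bar> powr q)" for \<omega>
        using powr_mult_square_le[OF q, of "\<bar>?a \<omega>\<bar>" "\<bar>?b \<omega>\<bar>"] by (simp add: r_def)
      then show "AE \<omega> in M. norm (r (\<lambda>i. X i \<omega>)) \<le> norm (\<bar>?a \<omega>\<bar> powr q + \<bar>?b \<omega>\<bar> powr q)" by simp
    qed (simp add: r_def)
    have ih: "integrable M (\<lambda>\<omega>. h (\<lambda>i. X i \<omega>))"
    proof (rule Bochner_Integration.integrable_bound)
      show "integrable M (\<lambda>\<omega>. \<bar>?a \<omega>\<bar> powr q + \<bar>?b \<omega>\<bar> powr q)" using ia ib by simp
      have "norm (h (\<lambda>i. X i \<omega>)) \<le> norm (\<bar>?a \<omega>\<bar> powr q + \<bar>?b \<omega>\<bar> powr q)" for \<omega>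
      proof -
        have "\<bar>?a \<omega>\<bar> powr (q - 1) * \<bar>?b \<omega>\<bar> \<le> \<bar>?a \<omega>\<bar> powr q + \<bar>?b \<omega>\<bar> powr q"
        proof (cases "\<bar>?b \<omega>\<bar> \<le> \<bar>?a \<omega>\<bar>")
          case True
          then have "\<bar>?a \<omega>\<bar> powr (q - 1) * \<bar>?b \<omega>\<bar> \<le> \<bar>?a \<omega>\<bar> powr (q - 1) * \<bar>?a \<omega>\<bar>"
            by (intro mult_left_mono) auto
          also have "\<dots> = \<bar>?a \<omega>\<bar> powr q" by (cases "?a \<omega> = 0") (simp_all add: powr_diff)
          finally show ?thesis by (simp add: add_increasing2)
        next
          case False
          then have "\<bar>?a \<omega>\<bar> powr (q - 1) * \<bar>?b \<omega>\<bar> \<le> \<bar>?b \<omega>\<bar> powr (q - 1) * \<bar>?b \<omega>\<bar>"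
            using q by (intro mult_right_mono powr_mono2) auto
          also have "\<dots> = \<bar>?b \<omega>\<bar> powr q" by (cases "?b \<omega> = 0") (simp_all add: powr_diff)
          finally show ?thesis by (simp add: add_increasing)
        qed
        then show ?thesis by (cases "?a \<omega> = 0") (auto simp: h_def abs_mult abs_sgn_eq)
      qed
      then show "AE \<omega> in M. norm (h (\<lambda>i. X i \<omega>)) \<le> norm (\<bar>?a \<omega>\<bar> powr q + \<bar>?b \<omega>\<bar> powr q)" by simp
    qed (simp add: h_def)
    note s1 = split[OF _ hm(1) rs(1) _ ih, of "\<lambda>x. x", simplified, OF int1[OF k]]
    note s2 = split[OF _ hm(2) rs(2) _ ir, of "\<lambda>x. x\<^sup>2", simplified, OF int2[OF k]]
    note s3 = split[OF _ hm(3) rs(3) _ il, of "\<lambda>x. \<bar>x\<bar> powr q", simplified, OF intq[OF k]]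
    \<comment> \<open>The pointwise bound of the second-order expansion, with each term written as a
      function of \<open>X k\<close> times a function of the variables in \<open>V\<close>. The term
      with \<open>h\<close> has expectation 0.\<close>
    define R where "R \<omega> = \<bar>?a \<omega>\<bar> powr q + q * (X k \<omega> * h (\<lambda>i. X i \<omega>)) +
      C * ((X k \<omega>)\<^sup>2 * r (\<lambda>i. X i \<omega>) + \<bar>X k \<omega>\<bar> powr q * l (\<lambda>i. X i \<omega>))" for \<omega>
    have W_le: "\<bar>?W (insert k V) c \<omega>\<bar> powr q \<le> R \<omega>" for \<omega>
      using exp_le[of "?a \<omega>" "X k \<omega> * ?b \<omega>"]
      by (simp add: W R_def h_def r_def l_def abs_mult powr_mult power_mult_distrib ac_simps)
    have iR: "integrable M R"
      unfolding R_def using ia s1(1) s2(1) s3(1) by simp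
    have iW: "integrable M (\<lambda>\<omega>. \<bar>?W (insert k V) c \<omega>\<bar> powr q)"
    proof (rule Bochner_Integration.integrable_bound[OF iR])
      show "AE \<omega> in M. norm (\<bar>?W (insert k V) c \<omega>\<bar> powr q) \<le> norm (R \<omega>)"
        by (simp, intro AE_I2 order_trans[OF W_le abs_ge_self])
    qed (simp add: W)
    have "expectation (\<lambda>\<omega>. \<bar>?W (insert k V) c \<omega>\<bar> powr q) \<le> s powr (q / 2)" if s: "L (insert k V) c < s" for s
    proof -
      have L: "L (insert k V) c = L V c + \<Lambda> * L V c'"
      proof -
        have disj: "Pow V \<inter> insert k ` Pow V = {}" using insert.hyps by auto
        have inj: "inj_on (insert k) (Pow V)" using insert.hyps by (auto simp: inj_on_def)
        have "(\<Sum>S\<in>Pow V. \<Lambda> ^ card (insert k S) * (c (insert k S))\<^sup>2) = (\<Sum>S\<in>Pow V. \<Lambda> * (\<Lambda> ^ card S * (c' S)\<^sup>2))"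
        proof (intro sum.cong refl)
          fix S assume "S \<in> Pow V"
          then have "finite S" "k \<notin> S" using insert.hyps finite_subset by auto
          then show "\<Lambda> ^ card (insert k S) * (c (insert k S))\<^sup>2 = \<Lambda> * (\<Lambda> ^ card S * (c' S)\<^sup>2)"
            by (simp add: c'_def)
        qed
        then show ?thesis
          using insert.hyps disj inj unfolding L_def Pow_insert
          by (simp add: sum.union_disjoint sum.reindex sum_distrib_left)
      qed
      \<comment> \<open>The slack between \<open>s\<close> and \<open>L (insert k V) c\<close> is
        shared out so that \<open>sa\<close> and \<open>sb\<close> are strictly admissible for the
        induction hypothesis and \<open>s = sa + \<Lambda> * sb\<close> exactly.\<close>
      define \<delta> where "\<delta> = s - L V c - \<Lambda> * L V c'"
      have \<delta>: "\<delta> > 0" using s L by (simp add: \<delta>_def)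
      define sa where "sa = L V c + \<delta> / 2"
      define sb where "sb = L V c' + \<delta> / (2 * \<Lambda>)"
      have pos: "sa > L V c" "sb > L V c'" "sa > 0" "sb > 0"
        using \<delta> \<Lambda> L0[of V c] L0[of V c'] by (auto simp: sa_def sb_def intro: add_nonneg_pos)
      have s_eq: "s = sa + \<Lambda> * sb" using \<Lambda> by (simp add: sa_def sb_def \<delta>_def field_simps)
      have ea: "expectation (\<lambda>\<omega>. \<bar>?a \<omega>\<bar> powr q) \<le> sa powr (q / 2)" and eb: "expectation (\<lambda>\<omega>. \<bar>?b \<omega>\<bar> powr q) \<le> sb powr (q / 2)"
        using insert.IH[OF V] pos by auto
      have er: "expectation (\<lambda>\<omega>. r (\<lambda>i. X i \<omega>)) \<le> 2 * (sa powr (q / 2 - 1) * sb)"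
      proof -
        have "expectation (\<lambda>\<omega>. r (\<lambda>i. X i \<omega>)) \<le> expectation (\<lambda>\<omega>. sa powr (q / 2 - 1) * sb *
            (\<bar>?a \<omega>\<bar> powr q / sa powr (q / 2) + \<bar>?b \<omega>\<bar> powr q / sb powr (q / 2)))"
          using ir ia ib powr_mult_square_scaled_le[OF q pos(3,4)] by (intro integral_mono) (auto simp: r_def)
        also have "\<dots> = sa powr (q / 2 - 1) * sb * (expectation (\<lambda>\<omega>. \<bar>?a \<omega>\<bar> powr q) / sa powr (q / 2)
            + expectation (\<lambda>\<omega>. \<bar>?b \<omega>\<bar> powr q) / sb powr (q / 2))"
          using ia ib by simp
        also have "\<dots> \<le> sa powr (q / 2 - 1) * sb * (1 + 1)"
          using ea eb pos by (intro mult_left_mono add_mono) (auto simp: divide_le_eq)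
        finally show ?thesis by simp
      qed
      have "expectation (\<lambda>\<omega>. \<bar>?W (insert k V) c \<omega>\<bar> powr q) \<le> expectation R"
        using iW iR W_le by (rule integral_mono)
      also have "\<dots> = expectation (\<lambda>\<omega>. \<bar>?a \<omega>\<bar> powr q) + C * (expectation (\<lambda>\<omega>. r (\<lambda>i. X i \<omega>)) +
          expectation (\<lambda>\<omega>. \<bar>X k \<omega>\<bar> powr q) * expectation (\<lambda>\<omega>. l (\<lambda>i. X i \<omega>)))"
        unfolding R_def using ia s1 s2 s3 mean[OF k] var[OF k] by simp
      also have "\<dots> \<le> sa powr (q / 2) + C * (2 * (sa powr (q / 2 - 1) * sb) + K * sb powr (q / 2))"
      proof -
        have "expectation (\<lambda>\<omega>. \<bar>X k \<omega>\<bar> powr q) * expectation (\<lambda>\<omega>. l (\<lambda>i. X i \<omega>)) \<le> K * sb powr (q / 2)"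
          using K[OF k] eb by (intro mult_mono) (auto simp: l_def intro!: order_trans[OF integral_nonneg_AE K[OF k]])
        then show ?thesis using ea er C by (intro add_mono mult_left_mono) auto
      qed
      also have "\<dots> = sa powr (q / 2) + sa powr (q / 2 - 1) * (4 * C * sb) / 2 + (2 * C * K) * sb powr (q / 2) / 2"
        by (simp add: algebra_simps)
      also have "\<dots> \<le> sa powr (q / 2) + sa powr (q / 2 - 1) * (\<Lambda> * sb) / 2 + (\<Lambda> * sb) powr (q / 2) / 2"
      proof -
        have "2 * C * K \<le> \<Lambda> powr 1" using \<Lambda> by simp
        also have "\<dots> \<le> \<Lambda> powr (q / 2)" using \<Lambda> q by (intro powr_mono) auto
        finally have "2 * C * K * sb powr (q / 2) \<le> (\<Lambda> * sb) powr (q / 2)"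
          using \<Lambda> pos by (simp add: powr_mult mult_right_mono)
        moreover have "sa powr (q / 2 - 1) * (4 * C * sb) \<le> sa powr (q / 2 - 1) * (\<Lambda> * sb)"
          using \<Lambda> pos by (intro mult_left_mono mult_right_mono) auto
        ultimately show ?thesis by (intro add_mono divide_right_mono) auto
      qed
      also have "\<dots> \<le> (sa + \<Lambda> * sb) powr (q / 2)"
        using q \<Lambda> pos by (intro add_powr_ge) auto
      finally show ?thesis by (simp add: s_eq)
    qed
    then show ?case using iW by blast
  qed
  show thesis
  proof (rule that[OF \<Lambda>(1)])
    fix V c assume V: "finite V" "V \<subseteq> I"
    show "integrable M (\<lambda>\<omega>. \<bar>multilinear V c (\<lambda>i. X i \<omega>)\<bar> powr q)" using main[OF V] by blast
    \<comment> \<open>Letting \<open>s\<close> decrease to \<open>L V c\<close> removes the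
      slack.\<close>
    have "((\<lambda>s. s powr (q / 2)) \<longlongrightarrow> L V c powr (q / 2)) (at_right (L V c))"
      using q L0[of V c] by (intro tendsto_powr') (auto simp: eventually_at_right_less intro!: eventually_at_rightI[of _ "L V c + 1"])
    moreover have "eventually (\<lambda>s. expectation (\<lambda>\<omega>. \<bar>?W V c \<omega>\<bar> powr q) \<le> s powr (q / 2)) (at_right (L V c))"
      using main[OF V] by (intro eventually_at_rightI[of _ "L V c + 1"]) auto
    ultimately show "expectation (\<lambda>\<omega>. \<bar>?W V c \<omega>\<bar> powr q) \<le> (\<Sum>S\<in>Pow V. \<Lambda> ^ card S * (c S)\<^sup>2) powr (q / 2)"
      by (intro tendsto_lowerbound[of _ _ "at_right (L V c)", folded L_def]) (auto simp: L_def[symmetric])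
  qed
qed

end

subsection \<open>Stein bounds for the characteristic function\<close>

lemma sum_mult_partial_derivative:
  assumes "finite V" "homogeneous d c"
  shows "(\<Sum>k\<in>V. x k * multilinear (V - {k}) (\<lambda>S. c (insert k S)) x) = real d * multilinear V c x"
proof -
  have fin: "finite S" if "S \<subseteq> V" for S using that assms(1) finite_subset by auto
  have "(\<Sum>k\<in>V. x k * multilinear (V - {k}) (\<lambda>S. c (insert k S)) x) =
      (\<Sum>k\<in>V. \<Sum>S\<in>Pow (V - {k}). c (insert k S) * (\<Prod>i\<in>insert k S. x i))"
    unfolding multilinear_def sum_distrib_left
  proof (intro sum.cong refl)
    fix k S assume "S \<in> Pow (V - {k})"
    then have "finite S" "k \<notin> S" using fin by auto
    then show "x k * (c (insert k S) * (\<Prod>i\<in>S. x i)) = c (insert k S) * (\<Prod>i\<in>insert k S. x i)"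
      by simp
  qed
  also have "\<dots> = (\<Sum>(k, S)\<in>(SIGMA k:V. Pow (V - {k})). c (insert k S) * (\<Prod>i\<in>insert k S. x i))"
    using assms by (intro sum.Sigma) auto
  also have "\<dots> = (\<Sum>(S, k)\<in>(SIGMA S:Pow V. S). c S * (\<Prod>i\<in>S. x i))"
    by (rule sum.reindex_bij_witness[where
        j = "\<lambda>(k, S). (insert k S, k)" and i = "\<lambda>(S, k). (k, S - {k})"]) (auto simp: insert_absorb)
  also have "\<dots> = (\<Sum>S\<in>Pow V. \<Sum>k\<in>S. c S * (\<Prod>i\<in>S. x i))"
    using assms fin by (intro sum.Sigma[symmetric]) auto
  also have "\<dots> = (\<Sum>S\<in>Pow V. real d * (c S * (\<Prod>i\<in>S. x i)))"
    using assms(2) by (intro sum.cong) (auto simp: homogeneous_def)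
  finally show ?thesis by (simp add: multilinear_def sum_distrib_left)
qed

lemma norm_iexp_diff_le: "cmod (iexp x - iexp y) \<le> \<bar>x - y\<bar>"
proof -
  have "iexp x - iexp y = iexp y * (iexp (x - y) - 1)"
    by (simp add: exp_diff algebra_simps)
  then have "cmod (iexp x - iexp y) = cmod (iexp (x - y) - 1)" by (simp add: norm_mult)
  also have "\<dots> \<le> \<bar>x - y\<bar>" using iexp_approx1[of "x - y" 0] by simp
  finally show ?thesis .
qed

lemma norm_iexp_minus_linear_le: "cmod (iexp x - 1 - \<i> * x) \<le> x\<^sup>2 / 2"
  using iexp_approx1[of x 1] by (simp add: algebra_simps power2_eq_square)

lemma iexp_add: "iexp (x + y) = iexp x * iexp y"
  by (simp add: distrib_left exp_add)

lemma iexp_diff_factor: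
  "iexp (v * y) - iexp (u * y) - (of_real (v - u) * \<i>) * (of_real y * iexp (u * y)) =
    iexp (u * y) * (iexp ((v - u) * y) - 1 - \<i> * of_real ((v - u) * y))"
proof -
  have "v * y = u * y + (v - u) * y" by (simp add: algebra_simps)
  then have e: "iexp (v * y) = iexp (u * y) * iexp ((v - u) * y)" by (metis iexp_add)
  have r: "a * b - a - (d * \<i>) * (w * a) = a * (b - 1 - \<i> * (d * w))" for a b d w :: complex
    by (simp add: algebra_simps)
  show ?thesis unfolding e of_real_mult[of "v - u" y] by (rule r)
qed

text \<open>The Taylor remainder of the exponential is pointwise at most
  \<open>(v - u)^2 * Y^2 / 2\<close>, so a finite second moment makes the difference quotient
  converge with error linear in \<open>v - u\<close>.\<close>

lemma (in prob_space) char_fun_has_vector_derivative: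
  fixes Y :: "'a \<Rightarrow> real"
  assumes [measurable]: "Y \<in> borel_measurable M" and Y2: "integrable M (\<lambda>\<omega>. (Y \<omega>)\<^sup>2)"
  shows "((\<lambda>u. \<integral>\<omega>. iexp (u * Y \<omega>) \<partial>M) has_vector_derivative (\<i> * (\<integral>\<omega>. Y \<omega> * iexp (u * Y \<omega>) \<partial>M))) (at u)"
proof -
  let ?\<phi> = "\<lambda>u. \<integral>\<omega>. iexp (u * Y \<omega>) \<partial>M"
  define E2 where "E2 = expectation (\<lambda>\<omega>. (Y \<omega>)\<^sup>2)"
  have Y1: "integrable M Y"
  proof (rule Bochner_Integration.integrable_bound)
    show "integrable M (\<lambda>\<omega>. 1 + (Y \<omega>)\<^sup>2)" using Y2 by simp
    have "\<bar>y\<bar> \<le> 1 + y\<^sup>2" for y :: real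
      using zero_le_power2[of "\<bar>y\<bar> - 1"] abs_ge_zero[of y] unfolding power2_diff power2_abs power_one mult_1_right by linarith
    then show "AE \<omega> in M. norm (Y \<omega>) \<le> norm (1 + (Y \<omega>)\<^sup>2)" by auto
  qed simp
  have ie: "integrable M (\<lambda>\<omega>. iexp (u * Y \<omega>))" for u
    by (rule integrable_const_bound[of _ 1]) auto
  have iy: "integrable M (\<lambda>\<omega>. of_real (Y \<omega>) * iexp (u * Y \<omega>))" for u
    by (rule Bochner_Integration.integrable_bound[OF Y1]) (auto simp: norm_mult)
  have bound: "cmod (?\<phi> v - ?\<phi> u - (v - u) *\<^sub>R (\<i> * (\<integral>\<omega>. Y \<omega> * iexp (u * Y \<omega>) \<partial>M))) \<le> (v - u)\<^sup>2 * (E2 / 2)" for v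
  proof -
    have eq: "?\<phi> v - ?\<phi> u - (v - u) *\<^sub>R (\<i> * (\<integral>\<omega>. Y \<omega> * iexp (u * Y \<omega>) \<partial>M)) =
      (\<integral>\<omega>. iexp (v * Y \<omega>) - iexp (u * Y \<omega>) - (of_real (v - u) * \<i>) * (of_real (Y \<omega>) * iexp (u * Y \<omega>)) \<partial>M)"
      by (subst Bochner_Integration.integral_diff[OF Bochner_Integration.integrable_diff[OF ie ie] integrable_mult_right[OF iy]],
          subst Bochner_Integration.integral_diff[OF ie ie]) (simp add: scaleR_conv_of_real)
    have "cmod (?\<phi> v - ?\<phi> u - (v - u) *\<^sub>R (\<i> * (\<integral>\<omega>. Y \<omega> * iexp (u * Y \<omega>) \<partial>M))) \<le> (\<integral>\<omega>. cmod (iexp (v * Y \<omega>) - iexp (u * Y \<omega>) - (of_real (v - u) * \<i>) * (of_real (Y \<omega>) * iexp (u * Y \<omega>))) \<partial>M)"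
      unfolding eq by (rule integral_norm_bound)
    also have "\<dots> \<le> (\<integral>\<omega>. (v - u)\<^sup>2 * ((Y \<omega>)\<^sup>2 / 2) \<partial>M)"
    proof (rule integral_mono)
      fix \<omega>
      have "cmod (iexp (v * Y \<omega>) - iexp (u * Y \<omega>) - (of_real (v - u) * \<i>) * (of_real (Y \<omega>) * iexp (u * Y \<omega>))) =
        cmod (iexp ((v - u) * Y \<omega>) - 1 - \<i> * of_real ((v - u) * Y \<omega>))"
        unfolding iexp_diff_factor norm_mult norm_exp_i_times mult_1_left ..
      also have "\<dots> \<le> (v - u)\<^sup>2 * ((Y \<omega>)\<^sup>2 / 2)"
        using norm_iexp_minus_linear_le[of "(v - u) * Y \<omega>"] by (simp add: power_mult_distrib)
      finally show "cmod (iexp (v * Y \<omega>) - iexp (u * Y \<omega>) - (of_real (v - u) * \<i>) * (of_real (Y \<omega>) * iexp (u * Y \<omega>))) \<le> (v - u)\<^sup>2 * ((Y \<omega>)\<^sup>2 / 2)" .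
    next
      show "integrable M (\<lambda>\<omega>. cmod (iexp (v * Y \<omega>) - iexp (u * Y \<omega>) - (of_real (v - u) * \<i>) * (of_real (Y \<omega>) * iexp (u * Y \<omega>))))"
        by (intro integrable_norm Bochner_Integration.integrable_diff integrable_mult_right ie iy)
    qed (use Y2 in simp)
    also have "\<dots> = (v - u)\<^sup>2 * (E2 / 2)" by (simp add: E2_def)
    finally show ?thesis .
  qed
  show ?thesis
    unfolding has_vector_derivative_def has_derivative_iff_norm
  proof (intro conjI)
    show "((\<lambda>v. norm (?\<phi> v - ?\<phi> u - (v - u) *\<^sub>R (\<i> * (\<integral>\<omega>. Y \<omega> * iexp (u * Y \<omega>) \<partial>M))) / norm (v - u)) \<longlongrightarrow> 0) (at u)"
    proof (rule Lim_null_comparison)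
      show "eventually (\<lambda>v. norm (norm (?\<phi> v - ?\<phi> u - (v - u) *\<^sub>R (\<i> * (\<integral>\<omega>. Y \<omega> * iexp (u * Y \<omega>) \<partial>M))) / norm (v - u)) \<le> \<bar>v - u\<bar> * (E2 / 2)) (at u)"
        unfolding eventually_at_filter
      proof (intro always_eventually allI impI)
        fix v assume "v \<noteq> u"
        then show "norm (norm (?\<phi> v - ?\<phi> u - (v - u) *\<^sub>R (\<i> * (\<integral>\<omega>. Y \<omega> * iexp (u * Y \<omega>) \<partial>M))) / norm (v - u)) \<le> \<bar>v - u\<bar> * (E2 / 2)"
          using bound[of v] by (simp add: divide_le_eq power2_eq_square ac_simps flip: abs_mult)
      qed
      have "((\<lambda>v. \<bar>v - u\<bar> * (E2 / 2)) \<longlongrightarrow> \<bar>u - u\<bar> * (E2 / 2)) (at u)"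
        by (intro tendsto_intros)
      then show "((\<lambda>v. \<bar>v - u\<bar> * (E2 / 2)) \<longlongrightarrow> 0) (at u)" by simp
    qed
  qed (rule bounded_linear_scaleR_left)
qed

lemma cubic_remainder_eq:
  "\<bar>x * b\<bar> * ((t * (x * b))\<^sup>2 / 2) + \<bar>t\<bar> * b\<^sup>2 * \<bar>t * x * b\<bar> =
    t\<^sup>2 * ((\<bar>x\<bar> ^ 3 / 2 + \<bar>x\<bar>) * \<bar>b\<bar> ^ 3)" for x b t :: real
proof -
  have c: "\<bar>y\<bar> ^ 3 = \<bar>y\<bar> * y\<^sup>2" for y :: real
    by (simp add: power3_eq_cube power2_eq_square)
  have t: "\<bar>t\<bar> * \<bar>t\<bar> = t\<^sup>2" by (simp add: power2_eq_square)
  have "\<bar>x * b\<bar> * ((t * (x * b))\<^sup>2 / 2) + \<bar>t\<bar> * b\<^sup>2 * \<bar>t * x * b\<bar> =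
    \<bar>x\<bar> * \<bar>b\<bar> * (t\<^sup>2 * (x\<^sup>2 * b\<^sup>2) / 2) + (\<bar>t\<bar> * \<bar>t\<bar>) * (b\<^sup>2 * (\<bar>x\<bar> * \<bar>b\<bar>))"
    unfolding abs_mult power_mult_distrib by (simp only: ac_simps)
  also have "\<dots> = t\<^sup>2 * ((\<bar>x\<bar> ^ 3 / 2 + \<bar>x\<bar>) * \<bar>b\<bar> ^ 3)"
    unfolding t c by (simp add: distrib_left distrib_right)
  finally show ?thesis .
qed

context indep_family4
begin

text \<open>This is approximate integration by parts in the single variable \<open>X k\<close>,
  which is independent of \<open>A\<close> and \<open>B\<close>. Subtracting \<open>X k * B\<close>
  and \<open>\<i> * t * ((X k)^2 - 1) * B^2\<close>, each times the exponential of \<open>A\<close>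
  alone, changes no expectation because both have mean 0. What remains is pointwise of order
  \<open>t^2 * \<bar>B\<bar>^3\<close>.\<close>

lemma stein_term_bound:
  fixes t :: real and a b :: "'i set \<Rightarrow> real"
  assumes V: "finite V" "V \<subseteq> I" "k \<in> I" "k \<notin> V"
  defines "A \<equiv> W V a" and "B \<equiv> W V b"
  assumes B3: "integrable M (\<lambda>\<omega>. \<bar>B \<omega>\<bar> ^ 3)"
  shows "integrable M (\<lambda>\<omega>. of_real (X k \<omega> * B \<omega>) * iexp (t * (A \<omega> + X k \<omega> * B \<omega>)))"
    and "integrable M (\<lambda>\<omega>. of_real ((B \<omega>)\<^sup>2) * iexp (t * (A \<omega> + X k \<omega> * B \<omega>)))"
    and "cmod ((\<integral>\<omega>. of_real (X k \<omega> * B \<omega>) * iexp (t * (A \<omega> + X k \<omega> * B \<omega>)) \<partial>M)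
        - \<i> * t * (\<integral>\<omega>. of_real ((B \<omega>)\<^sup>2) * iexp (t * (A \<omega> + X k \<omega> * B \<omega>)) \<partial>M))
      \<le> t\<^sup>2 * (2 * (1 + \<kappa>)) * expectation (\<lambda>\<omega>. \<bar>B \<omega>\<bar> ^ 3)"
proof -
  note [measurable] = X_measurable[OF V(3)]
  have meas: "W V c \<in> borel_measurable M" for c
    by (rule multilinear_measurable) (use V in auto)
  have [measurable]: "A \<in> borel_measurable M" "B \<in> borel_measurable M"
    unfolding A_def B_def by (rule meas)+
  note [measurable] = multilinear_measurable_PiM[OF V(1), of a] multilinear_measurable_PiM[OF V(1), of b]
  have pw: "\<bar>y\<bar> \<le> 1 + \<bar>y\<bar> ^ 3" "y\<^sup>2 \<le> 1 + \<bar>y\<bar> ^ 3" for y :: real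
  proof -
    have "\<bar>y\<bar> ^ j \<le> 1 + \<bar>y\<bar> ^ 3" if "j \<le> 3" for j
    proof (cases "\<bar>y\<bar> \<le> 1")
      case True
      then show ?thesis using power_le_one[of "\<bar>y\<bar>" j] by (simp add: add_increasing2)
    next
      case False
      then have "\<bar>y\<bar> ^ j \<le> \<bar>y\<bar> ^ 3" using that by (intro power_increasing) auto
      then show ?thesis by simp
    qed
    from this[of 1] this[of 2] show "\<bar>y\<bar> \<le> 1 + \<bar>y\<bar> ^ 3" "y\<^sup>2 \<le> 1 + \<bar>y\<bar> ^ 3" by simp_all
  qed
  have i3: "integrable M (\<lambda>\<omega>. 1 + \<bar>B \<omega>\<bar> ^ 3)" using B3 by simp
  have B1: "integrable M B" by (rule Bochner_Integration.integrable_bound[OF i3]) (auto intro!: AE_I2 order_trans[OF pw(1)])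
  have B2: "integrable M (\<lambda>\<omega>. (B \<omega>)\<^sup>2)" by (rule Bochner_Integration.integrable_bound[OF i3]) (auto intro!: AE_I2 order_trans[OF pw(2)])
  note split = integrable_mult_split[OF V(3,2,4)] integral_mult_split[OF V(3,2,4)]
  define g1 where "g1 x = of_real (multilinear V b x) * iexp (t * multilinear V a x)" for x
  define g2 where "g2 x = of_real ((multilinear V b x)\<^sup>2) * iexp (t * multilinear V a x)" for x
  define g3 where "g3 x = \<bar>multilinear V b x\<bar> ^ 3" for x
  have gr: "g1 (restrict x V) = g1 x" "g2 (restrict x V) = g2 x" "g3 (restrict x V) = g3 x" for x
    by (simp_all add: g1_def g2_def g3_def multilinear_restrict)
  have gm: "g1 \<in> borel_measurable (PiM V (\<lambda>_. borel))" "g2 \<in> borel_measurable (PiM V (\<lambda>_. borel))" "g3 \<in> borel_measurable (PiM V (\<lambda>_. borel))"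
    unfolding g1_def g2_def g3_def by measurable
  have gB: "g1 (\<lambda>i. X i \<omega>) = of_real (B \<omega>) * iexp (t * A \<omega>)" "g2 (\<lambda>i. X i \<omega>) = of_real ((B \<omega>)\<^sup>2) * iexp (t * A \<omega>)"
    "g3 (\<lambda>i. X i \<omega>) = \<bar>B \<omega>\<bar> ^ 3" for \<omega>
    by (simp_all add: g1_def g2_def g3_def A_def B_def)
  have gi: "integrable M (\<lambda>\<omega>. g1 (\<lambda>i. X i \<omega>))" "integrable M (\<lambda>\<omega>. g2 (\<lambda>i. X i \<omega>))" "integrable M (\<lambda>\<omega>. g3 (\<lambda>i. X i \<omega>))"
  proof -
    show "integrable M (\<lambda>\<omega>. g1 (\<lambda>i. X i \<omega>))"
      unfolding gB by (rule Bochner_Integration.integrable_bound[OF B1]) (auto simp: norm_mult)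
    show "integrable M (\<lambda>\<omega>. g2 (\<lambda>i. X i \<omega>))"
      unfolding gB by (rule Bochner_Integration.integrable_bound[OF B2]) (auto simp: norm_mult norm_power)
    show "integrable M (\<lambda>\<omega>. g3 (\<lambda>i. X i \<omega>))"
      unfolding gB by (rule B3)
  qed
  have Xc: "integrable M (\<lambda>\<omega>. complex_of_real (X k \<omega>))" "(\<integral>\<omega>. complex_of_real (X k \<omega>) \<partial>M) = 0"
    "integrable M (\<lambda>\<omega>. complex_of_real ((X k \<omega>)\<^sup>2 - 1))" "(\<integral>\<omega>. complex_of_real ((X k \<omega>)\<^sup>2 - 1) \<partial>M) = 0"
    using int_simps[OF V(3)] mean[OF V(3)] var[OF V(3)] prob_space
    by (simp_all del: of_real_diff of_real_power add: complex_of_real_integrable_eq integral_of_real)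
  \<comment> \<open>Gathers the powers of \<open>X k\<close> in the remainder: the cube comes from
    the second-order expansion, the first power from replacing one exponential by another. Both
    powers are at most \<open>1 + x ^ 4\<close>, whence the factor
    \<open>2 * (1 + \<kappa>)\<close>.\<close>
  define \<rho> where "\<rho> x = \<bar>x\<bar> ^ 3 / 2 + \<bar>x\<bar>" for x :: real
  have \<rho>_le: "\<rho> x \<le> 2 * (1 + x ^ 4)" for x
    using abs_power_le[of 3 x] abs_power_le[of 1 x] by (simp add: \<rho>_def power_abs)
  have i\<rho>: "integrable M (\<lambda>\<omega>. \<rho> (X k \<omega>))"
    using int_simps[OF V(3)] by (simp add: \<rho>_def flip: power_abs)
  have E\<rho>: "expectation (\<lambda>\<omega>. \<rho> (X k \<omega>)) \<le> 2 * (1 + \<kappa>)"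
  proof -
    have "expectation (\<lambda>\<omega>. \<rho> (X k \<omega>)) \<le> expectation (\<lambda>\<omega>. 2 * (1 + X k \<omega> ^ 4))"
      using i\<rho> int_simps[OF V(3)] \<rho>_le by (intro integral_mono) auto
    also have "\<dots> = 2 * (1 + \<kappa>)" using int_simps[OF V(3)] fourth[OF V(3)] prob_space by simp
    finally show ?thesis .
  qed
  have [measurable]: "\<rho> \<in> borel_measurable borel" unfolding \<rho>_def by measurable
  note s1 = split[OF _ gm(1) gr(1) _ gi(1), of "\<lambda>x. complex_of_real x", simplified, OF Xc(1)]
  note s2 = split[OF _ gm(2) gr(2) _ gi(2), of "\<lambda>x. complex_of_real (x\<^sup>2 - 1)", OF _ Xc(3)]
  note s3 = split[OF _ gm(3) gr(3) i\<rho> gi(3)]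
  let ?Y = "\<lambda>\<omega>. A \<omega> + X k \<omega> * B \<omega>"
  let ?e = "\<lambda>\<omega>. iexp (t * ?Y \<omega>)"
  show I1: "integrable M (\<lambda>\<omega>. of_real (X k \<omega> * B \<omega>) * ?e \<omega>)"
    by (rule Bochner_Integration.integrable_bound[OF s1(1)]) (auto simp: norm_mult gB)
  show I2: "integrable M (\<lambda>\<omega>. of_real ((B \<omega>)\<^sup>2) * ?e \<omega>)"
    by (rule Bochner_Integration.integrable_bound[OF B2]) (auto simp: norm_mult norm_power)
  define R where "R \<omega> = of_real (X k \<omega> * B \<omega>) * ?e \<omega> - \<i> * t * (of_real ((B \<omega>)\<^sup>2) * ?e \<omega>)
     - of_real (X k \<omega>) * g1 (\<lambda>i. X i \<omega>) - \<i> * t * (of_real ((X k \<omega>)\<^sup>2 - 1) * g2 (\<lambda>i. X i \<omega>))" for \<omega>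
  have iR: "integrable M R"
    unfolding R_def using I1 I2 s1(1) s2(1) by (intro Bochner_Integration.integrable_diff integrable_mult_right) auto
  have ER: "(\<integral>\<omega>. of_real (X k \<omega> * B \<omega>) * ?e \<omega> \<partial>M) - \<i> * t * (\<integral>\<omega>. of_real ((B \<omega>)\<^sup>2) * ?e \<omega> \<partial>M) = (\<integral>\<omega>. R \<omega> \<partial>M)"
  proof -
    have "(\<integral>\<omega>. R \<omega> \<partial>M) = (\<integral>\<omega>. of_real (X k \<omega> * B \<omega>) * ?e \<omega> \<partial>M) - \<i> * t * (\<integral>\<omega>. of_real ((B \<omega>)\<^sup>2) * ?e \<omega> \<partial>M)
      - (\<integral>\<omega>. of_real (X k \<omega>) * g1 (\<lambda>i. X i \<omega>) \<partial>M) - \<i> * t * (\<integral>\<omega>. of_real ((X k \<omega>)\<^sup>2 - 1) * g2 (\<lambda>i. X i \<omega>) \<partial>M)"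
      unfolding R_def using I1 I2 s1(1) s2(1)
      by (subst Bochner_Integration.integral_diff Bochner_Integration.integral_mult_right; (intro Bochner_Integration.integrable_diff integrable_mult_right)?; simp)+
    then show ?thesis using s1(2) s2(2) Xc by simp
  qed
  have R_le: "cmod (R \<omega>) \<le> t\<^sup>2 * (\<rho> (X k \<omega>) * g3 (\<lambda>i. X i \<omega>))" for \<omega>
  proof -
    let ?x = "X k \<omega>" and ?b = "B \<omega>" and ?a = "A \<omega>"
    have ee: "iexp (t * (?a + ?x * ?b)) = iexp (t * ?a) * iexp (t * (?x * ?b))"
      by (simp only: distrib_left[of t] iexp_add)
    have r: "(x * b) * (p * q) - \<i> * s * ((b * b) * (p * q)) - x * (b * p) - \<i> * s * ((x * x - 1) * ((b * b) * p)) =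
      (x * b) * p * (q - 1 - \<i> * (s * (x * b))) - \<i> * s * (b * b) * (p * q - p)" for x b p q s :: complex
      by (simp add: algebra_simps)
    have "R \<omega> = of_real (?x * ?b) * iexp (t * ?a) * (iexp (t * (?x * ?b)) - 1 - \<i> * of_real (t * (?x * ?b)))
      - \<i> * t * of_real (?b\<^sup>2) * (iexp (t * (?a + ?x * ?b)) - iexp (t * ?a))"
      unfolding R_def gB ee
      unfolding power2_eq_square of_real_mult of_real_diff of_real_1 by (rule r)
    then have "cmod (R \<omega>) \<le> cmod (of_real (?x * ?b) * iexp (t * ?a) * (iexp (t * (?x * ?b)) - 1 - \<i> * of_real (t * (?x * ?b))))
      + cmod (\<i> * t * of_real (?b\<^sup>2) * (iexp (t * (?a + ?x * ?b)) - iexp (t * ?a)))"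
      by (metis norm_triangle_ineq4)
    also have "\<dots> = \<bar>?x * ?b\<bar> * cmod (iexp (t * (?x * ?b)) - 1 - \<i> * of_real (t * (?x * ?b)))
      + \<bar>t\<bar> * ?b\<^sup>2 * cmod (iexp (t * (?a + ?x * ?b)) - iexp (t * ?a))"
      by (simp add: norm_mult abs_mult norm_power)
    also have "\<dots> \<le> \<bar>?x * ?b\<bar> * ((t * (?x * ?b))\<^sup>2 / 2) + \<bar>t\<bar> * ?b\<^sup>2 * \<bar>t * (?a + ?x * ?b) - t * ?a\<bar>"
      by (intro add_mono mult_left_mono norm_iexp_minus_linear_le norm_iexp_diff_le) auto
    also have "\<dots> = t\<^sup>2 * (\<rho> ?x * \<bar>?b\<bar> ^ 3)"
    proof -
      have "t * (?a + ?x * ?b) - t * ?a = t * ?x * ?b" by (simp add: algebra_simps)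
      then show ?thesis by (simp only: \<rho>_def cubic_remainder_eq)
    qed
    finally show ?thesis by (simp add: gB)
  qed
  have "cmod (\<integral>\<omega>. R \<omega> \<partial>M) \<le> (\<integral>\<omega>. cmod (R \<omega>) \<partial>M)" by (rule integral_norm_bound)
  also have "\<dots> \<le> (\<integral>\<omega>. t\<^sup>2 * (\<rho> (X k \<omega>) * g3 (\<lambda>i. X i \<omega>)) \<partial>M)"
    using iR s3(1) R_le by (intro integral_mono) auto
  also have "\<dots> = t\<^sup>2 * (expectation (\<lambda>\<omega>. \<rho> (X k \<omega>)) * expectation (\<lambda>\<omega>. \<bar>B \<omega>\<bar> ^ 3))"
    using s3(2) by (simp add: gB)
  also have "\<dots> \<le> t\<^sup>2 * (2 * (1 + \<kappa>) * expectation (\<lambda>\<omega>. \<bar>B \<omega>\<bar> ^ 3))"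
    using E\<rho> by (intro mult_left_mono mult_right_mono) auto
  finally show "cmod ((\<integral>\<omega>. of_real (X k \<omega> * B \<omega>) * ?e \<omega> \<partial>M) - \<i> * t * (\<integral>\<omega>. of_real ((B \<omega>)\<^sup>2) * ?e \<omega> \<partial>M))
      \<le> t\<^sup>2 * (2 * (1 + \<kappa>)) * expectation (\<lambda>\<omega>. \<bar>B \<omega>\<bar> ^ 3)"
    unfolding ER by (simp add: mult.assoc)
qed

end

context indep_family4
begin

text \<open>
  The characteristic function \<open>\<phi>\<close> of \<open>W\<close> satisfies \<open>\<phi>'(u) \<approx> - u s \<phi>(u)\<close>, where \<open>s = Var W\<close>:
  by the Taylor expansion in each \<open>X\<^sub>k\<close> and Euler's identity \<open>\<Sum>\<^sub>k X\<^sub>k B\<^sub>k = d W\<close>,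
  \<open>E(W e\<^sup>i\<^sup>u\<^sup>W) \<approx> i u E(T e\<^sup>i\<^sup>u\<^sup>W)\<close> with \<open>T = (1/d) \<Sum>\<^sub>k B\<^sub>k\<^sup>2\<close>, which concentrates around \<open>s\<close>.
\<close>

lemma stein_bound:
  fixes t \<Lambda> \<eta> :: real
  assumes V: "finite V" "V \<subseteq> I" and c: "homogeneous d c" and d: "d \<ge> 2" and \<kappa>: "\<kappa> \<ge> 3"
    and \<Lambda>: "\<Lambda> \<ge> 1"
    and h3i: "\<And>V c. finite V \<Longrightarrow> V \<subseteq> I \<Longrightarrow> integrable M (\<lambda>\<omega>. \<bar>W V c \<omega>\<bar> powr 3)"
    and h3: "\<And>V c. finite V \<Longrightarrow> V \<subseteq> I \<Longrightarrow> expectation (\<lambda>\<omega>. \<bar>W V c \<omega>\<bar> powr 3) \<le>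
        (\<Sum>S\<in>Pow V. \<Lambda> ^ card S * (c S)\<^sup>2) powr (3 / 2)"
    and \<eta>: "\<eta> > 0" "mid_norm V d c \<le> \<eta> ^ 4"
  defines "s \<equiv> \<Sum>S\<in>Pow V. (c S)\<^sup>2"
  shows "cmod ((\<integral>\<omega>. of_real (W V c \<omega>) * iexp (t * W V c \<omega>) \<partial>M) - \<i> * t * s * (\<integral>\<omega>. iexp (t * W V c \<omega>) \<partial>M))
    \<le> \<bar>t\<bar> * ((1 + (16 * (\<kappa> - 1)) ^ d) * \<eta>\<^sup>2) + t\<^sup>2 * (2 * (1 + \<kappa>) * \<Lambda> ^ (2 * d) * s * \<eta>)"
proof -
  have fin: "finite S" if "S \<subseteq> V" for S using that V finite_subset by auto
  define B where "B k \<omega> = W (V - {k}) (\<lambda>S. c (insert k S)) \<omega>" for k \<omega>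
  define A where "A k \<omega> = W (V - {k}) c \<omega>" for k \<omega>
  let ?W = "W V c"
  have meas: "W J c' \<in> borel_measurable M" if "J \<subseteq> V" for J c'
    by (rule multilinear_measurable) (use that V in auto)
  have [measurable]: "?W \<in> borel_measurable M" "\<And>k. B k \<in> borel_measurable M"
    unfolding B_def[abs_def] by (auto intro!: meas)
  let ?e = "\<lambda>\<omega>. iexp (t * ?W \<omega>)"
  have W_split: "?W \<omega> = A k \<omega> + X k \<omega> * B k \<omega>" if "k \<in> V" for k \<omega>
    using multilinear_insert[of "V - {k}" k c] V that by (simp add: A_def B_def insert_absorb)
  have B3i: "integrable M (\<lambda>\<omega>. \<bar>B k \<omega>\<bar> ^ 3)" for k
    using h3i[of "V - {k}" "\<lambda>S. c (insert k S)"] V by (auto simp: B_def)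
  \<comment> \<open>The third moment is of order \<open>?J powr (3 / 2)\<close> in the influence
    \<open>?J\<close>. As \<open>?J \<le> \<eta>^2\<close>, half a power becomes
    \<open>\<eta>\<close>, and the remaining full power can be summed over \<open>k\<close>.\<close>
  have B3: "expectation (\<lambda>\<omega>. \<bar>B k \<omega>\<bar> ^ 3) \<le> \<Lambda> ^ (2 * d) * \<eta> * influence V c k" if k: "k \<in> V" for k
  proof -
    let ?J = "influence V c k"
    have J0: "?J \<ge> 0" by (rule influence_nonneg)
    have e4: "(\<eta>\<^sup>2)\<^sup>2 = \<eta> ^ 4" by (subst power_mult[symmetric]) simp
    have "?J\<^sup>2 \<le> (\<eta>\<^sup>2)\<^sup>2"
      unfolding e4 by (rule order_trans[OF influence_square_le[OF V(1) d k] \<eta>(2)])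
    then have J\<eta>: "?J \<le> \<eta>\<^sup>2" by (rule power2_le_imp_le) simp
    have "(\<Sum>S\<in>Pow (V - {k}). \<Lambda> ^ card S * (c (insert k S))\<^sup>2) \<le> (\<Sum>S\<in>Pow (V - {k}). \<Lambda> ^ d * (c (insert k S))\<^sup>2)"
    proof (intro sum_mono)
      fix S assume S: "S \<in> Pow (V - {k})"
      show "\<Lambda> ^ card S * (c (insert k S))\<^sup>2 \<le> \<Lambda> ^ d * (c (insert k S))\<^sup>2"
      proof (cases "c (insert k S) = 0")
        case False
        then have "card (insert k S) = d" using c by (auto simp: homogeneous_def)
        then have "card S \<le> d" using card_insert_le[of S k] by simp
        then show ?thesis using \<Lambda> by (intro mult_right_mono power_increasing) auto
      qed simp
    qed
    also have "\<dots> = \<Lambda> ^ d * ?J" by (simp add: influence_def sum_distrib_left)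
    finally have L: "(\<Sum>S\<in>Pow (V - {k}). \<Lambda> ^ card S * (c (insert k S))\<^sup>2) \<le> \<Lambda> ^ d * ?J" .
    have "expectation (\<lambda>\<omega>. \<bar>B k \<omega>\<bar> ^ 3) \<le> (\<Sum>S\<in>Pow (V - {k}). \<Lambda> ^ card S * (c (insert k S))\<^sup>2) powr (3 / 2)"
      using h3[of "V - {k}" "\<lambda>S. c (insert k S)"] V by (auto simp: B_def)
    also have "\<dots> \<le> (\<Lambda> ^ d * ?J) powr (3 / 2)"
      using L \<Lambda> by (intro powr_mono2 sum_nonneg) auto
    also have "\<dots> = (\<Lambda> ^ d) powr (3 / 2) * ?J powr (3 / 2)"
      using \<Lambda> J0 by (simp add: powr_mult)
    also have "\<dots> \<le> (\<Lambda> ^ d) powr 2 * (\<eta> * ?J)"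
    proof (intro mult_mono)
      show "(\<Lambda> ^ d) powr (3 / 2) \<le> (\<Lambda> ^ d) powr 2" using \<Lambda> by (intro powr_mono) auto
      show "?J powr (3 / 2) \<le> \<eta> * ?J"
      proof (cases "?J = 0")
        case False
        then have "?J powr (3 / 2) = ?J powr (1 / 2) * ?J"
          using J0 powr_add[of ?J "1/2" 1] by simp
        also have "?J powr (1 / 2) = sqrt ?J" using J0 by (simp add: powr_half_sqrt)
        also have "sqrt ?J \<le> \<eta>" using J\<eta> \<eta>(1) by (intro real_le_lsqrt) auto
        finally show ?thesis using J0 by (simp add: mult_right_mono)
      qed simp
    qed auto
    also have "\<dots> = \<Lambda> ^ (2 * d) * \<eta> * ?J"
      using \<Lambda> by (simp add: powr_numeral power_mult[symmetric] mult.commute)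
    finally show ?thesis .
  qed
  define T where "T \<omega> = (\<Sum>k\<in>V. (B k \<omega>)\<^sup>2) / real d" for \<omega>
  have [measurable]: "T \<in> borel_measurable M" unfolding T_def[abs_def] by measurable
  have Tv: "integrable M (\<lambda>\<omega>. (T \<omega> - s)\<^sup>2)" "expectation (\<lambda>\<omega>. (T \<omega> - s)\<^sup>2) \<le> (16 * (\<kappa> - 1)) ^ d * mid_norm V d c"
    using sum_partial_derivative_square_variance[OF V c, unfolded s_def[symmetric]] d \<kappa>
    by (auto simp: T_def B_def)
  have st: "integrable M (\<lambda>\<omega>. of_real (X k \<omega> * B k \<omega>) * ?e \<omega>)" "integrable M (\<lambda>\<omega>. of_real ((B k \<omega>)\<^sup>2) * ?e \<omega>)"
    "cmod ((\<integral>\<omega>. of_real (X k \<omega> * B k \<omega>) * ?e \<omega> \<partial>M) - \<i> * t * (\<integral>\<omega>. of_real ((B k \<omega>)\<^sup>2) * ?e \<omega> \<partial>M))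
      \<le> t\<^sup>2 * (2 * (1 + \<kappa>)) * expectation (\<lambda>\<omega>. \<bar>B k \<omega>\<bar> ^ 3)" if k: "k \<in> V" for k
    using stein_term_bound[of "V - {k}" k "\<lambda>S. c (insert k S)" t c] V k B3i[of k]
    unfolding W_split[OF k] A_def B_def by auto
  have EW: "of_real (real d) * (\<integral>\<omega>. of_real (?W \<omega>) * ?e \<omega> \<partial>M) = (\<Sum>k\<in>V. \<integral>\<omega>. of_real (X k \<omega> * B k \<omega>) * ?e \<omega> \<partial>M)"
  proof -
    have "(\<Sum>k\<in>V. \<integral>\<omega>. of_real (X k \<omega> * B k \<omega>) * ?e \<omega> \<partial>M) = (\<integral>\<omega>. (\<Sum>k\<in>V. of_real (X k \<omega> * B k \<omega>) * ?e \<omega>) \<partial>M)"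
      using st(1) by (intro Bochner_Integration.integral_sum[symmetric]) auto
    also have "\<dots> = (\<integral>\<omega>. of_real (real d) * (of_real (?W \<omega>) * ?e \<omega>) \<partial>M)"
    proof (intro Bochner_Integration.integral_cong refl)
      fix \<omega>
      have "(\<Sum>k\<in>V. of_real (X k \<omega> * B k \<omega>) * ?e \<omega>) = of_real (\<Sum>k\<in>V. X k \<omega> * B k \<omega>) * ?e \<omega>"
        by (simp only: of_real_sum sum_distrib_right)
      also have "(\<Sum>k\<in>V. X k \<omega> * B k \<omega>) = real d * ?W \<omega>"
        unfolding B_def by (rule sum_mult_partial_derivative[OF V(1) c])
      finally show "(\<Sum>k\<in>V. of_real (X k \<omega> * B k \<omega>) * ?e \<omega>) = of_real (real d) * (of_real (?W \<omega>) * ?e \<omega>)"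
        by (simp only: of_real_mult mult.assoc)
    qed
    finally show ?thesis by simp
  qed
  have iT: "integrable M (\<lambda>\<omega>. of_real (T \<omega>) * ?e \<omega>)" and
    ET: "of_real (real d) * (\<integral>\<omega>. of_real (T \<omega>) * ?e \<omega> \<partial>M) = (\<Sum>k\<in>V. \<integral>\<omega>. of_real ((B k \<omega>)\<^sup>2) * ?e \<omega> \<partial>M)"
  proof -
    have Te: "of_real (T \<omega>) * ?e \<omega> = (\<Sum>k\<in>V. of_real ((B k \<omega>)\<^sup>2) * ?e \<omega>) / of_real (real d)" for \<omega>
      by (simp only: T_def of_real_divide of_real_sum sum_distrib_right times_divide_eq_left)
    show "integrable M (\<lambda>\<omega>. of_real (T \<omega>) * ?e \<omega>)"
      unfolding Te using st(2) by (intro integrable_divide Bochner_Integration.integrable_sum) auto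
    have "(\<integral>\<omega>. of_real (T \<omega>) * ?e \<omega> \<partial>M) = (\<Sum>k\<in>V. \<integral>\<omega>. of_real ((B k \<omega>)\<^sup>2) * ?e \<omega> \<partial>M) / of_real (real d)"
      unfolding Te using st(2) by (subst integral_divide_zero, subst Bochner_Integration.integral_sum) auto
    then show "of_real (real d) * (\<integral>\<omega>. of_real (T \<omega>) * ?e \<omega> \<partial>M) = (\<Sum>k\<in>V. \<integral>\<omega>. of_real ((B k \<omega>)\<^sup>2) * ?e \<omega> \<partial>M)"
      using d by simp
  qed
  define D1 where "D1 = (\<integral>\<omega>. of_real (?W \<omega>) * ?e \<omega> \<partial>M) - \<i> * t * (\<integral>\<omega>. of_real (T \<omega>) * ?e \<omega> \<partial>M)"
  \<comment> \<open>The influences add up to \<open>d * s\<close>, which cancels the factor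
    \<open>d\<close> of Euler's identity, so the error does not grow with the number of
    variables.\<close>
  have D1: "cmod D1 \<le> t\<^sup>2 * (2 * (1 + \<kappa>) * \<Lambda> ^ (2 * d) * s * \<eta>)"
  proof -
    have "of_real (real d) * D1 = (\<Sum>k\<in>V. (\<integral>\<omega>. of_real (X k \<omega> * B k \<omega>) * ?e \<omega> \<partial>M) - \<i> * t * (\<integral>\<omega>. of_real ((B k \<omega>)\<^sup>2) * ?e \<omega> \<partial>M))"
      unfolding D1_def right_diff_distrib mult.left_commute[of "of_real (real d)"] EW ET
      by (simp only: sum_subtractf sum_distrib_left)
    then have "real d * cmod D1 = cmod (\<Sum>k\<in>V. (\<integral>\<omega>. of_real (X k \<omega> * B k \<omega>) * ?e \<omega> \<partial>M) - \<i> * t * (\<integral>\<omega>. of_real ((B k \<omega>)\<^sup>2) * ?e \<omega> \<partial>M))"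
      by (metis norm_mult norm_of_real abs_of_nat)
    also have "\<dots> \<le> (\<Sum>k\<in>V. t\<^sup>2 * (2 * (1 + \<kappa>)) * (\<Lambda> ^ (2 * d) * \<eta> * influence V c k))"
    proof (rule sum_norm_le)
      fix k assume k: "k \<in> V"
      show "cmod ((\<integral>\<omega>. of_real (X k \<omega> * B k \<omega>) * ?e \<omega> \<partial>M) - \<i> * t * (\<integral>\<omega>. of_real ((B k \<omega>)\<^sup>2) * ?e \<omega> \<partial>M)) \<le>
          t\<^sup>2 * (2 * (1 + \<kappa>)) * (\<Lambda> ^ (2 * d) * \<eta> * influence V c k)"
        by (rule order_trans[OF st(3)[OF k]], intro mult_left_mono B3 k) (use \<kappa> in auto)
    qed
    also have "\<dots> = t\<^sup>2 * (2 * (1 + \<kappa>)) * (\<Lambda> ^ (2 * d) * \<eta>) * (\<Sum>k\<in>V. influence V c k)"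
      by (simp only: sum_distrib_left mult.assoc)
    also have "\<dots> = real d * (t\<^sup>2 * (2 * (1 + \<kappa>) * \<Lambda> ^ (2 * d) * s * \<eta>))"
      unfolding sum_influence[OF V(1) c] s_def[symmetric] by (simp only: ac_simps)
    finally show ?thesis using d by (simp add: mult_le_cancel_left)
  qed
  define D2 where "D2 = (\<integral>\<omega>. of_real (T \<omega>) * ?e \<omega> \<partial>M) - s * (\<integral>\<omega>. ?e \<omega> \<partial>M)"
  have D2: "cmod D2 \<le> (1 + (16 * (\<kappa> - 1)) ^ d) * \<eta>\<^sup>2"
  proof -
    have ie: "integrable M ?e" by (rule integrable_const_bound[of _ 1]) auto
    have "D2 = (\<integral>\<omega>. of_real (T \<omega> - s) * ?e \<omega> \<partial>M)"
      unfolding D2_def using iT ie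
      by (subst integral_mult_right_zero[symmetric], subst Bochner_Integration.integral_diff[symmetric]) (auto simp: left_diff_distrib)
    then have "cmod D2 \<le> (\<integral>\<omega>. cmod (of_real (T \<omega> - s) * ?e \<omega>) \<partial>M)" by (simp only: integral_norm_bound)
    \<comment> \<open>Splitting at \<open>\<bar>T \<omega> - s\<bar> = \<eta>^2\<close> replaces
      Cauchy-Schwarz: a second moment of order \<open>\<eta> ^ 4\<close> yields a first moment of
      order \<open>\<eta>^2\<close>.\<close>
    also have "\<dots> \<le> (\<integral>\<omega>. \<eta>\<^sup>2 + (T \<omega> - s)\<^sup>2 / \<eta>\<^sup>2 \<partial>M)"
    proof (rule integral_mono)
      have "integrable M (\<lambda>\<omega>. of_real (T \<omega>) * ?e \<omega> - of_real s * ?e \<omega>)"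
        using iT ie by (intro Bochner_Integration.integrable_diff integrable_mult_right)
      then have "integrable M (\<lambda>\<omega>. of_real (T \<omega> - s) * ?e \<omega>)" by (simp only: of_real_diff left_diff_distrib)
      then show "integrable M (\<lambda>\<omega>. cmod (of_real (T \<omega> - s) * ?e \<omega>))" by (rule integrable_norm)
      show "integrable M (\<lambda>\<omega>. \<eta>\<^sup>2 + (T \<omega> - s)\<^sup>2 / \<eta>\<^sup>2)" using Tv(1) by simp
      fix \<omega>
      have "cmod (of_real (T \<omega> - s) * ?e \<omega>) = \<bar>T \<omega> - s\<bar>"
        by (simp only: norm_mult norm_exp_i_times norm_of_real mult_1_right)
      also have "\<dots> \<le> \<eta>\<^sup>2 + (T \<omega> - s)\<^sup>2 / \<eta>\<^sup>2"
      proof (cases "\<bar>T \<omega> - s\<bar> \<le> \<eta>\<^sup>2")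
        case False
        then have "\<eta>\<^sup>2 * \<bar>T \<omega> - s\<bar> \<le> \<bar>T \<omega> - s\<bar> * \<bar>T \<omega> - s\<bar>" by (intro mult_right_mono) auto
        then have "\<bar>T \<omega> - s\<bar> \<le> (T \<omega> - s)\<^sup>2 / \<eta>\<^sup>2"
          using \<eta>(1) by (simp add: le_divide_eq power2_eq_square[of "T \<omega> - s"] mult.commute)
        then show ?thesis by (simp add: add_increasing)
      qed (simp add: add_increasing2)
      finally show "cmod (of_real (T \<omega> - s) * ?e \<omega>) \<le> \<eta>\<^sup>2 + (T \<omega> - s)\<^sup>2 / \<eta>\<^sup>2" .
    qed
    also have "\<dots> = \<eta>\<^sup>2 + expectation (\<lambda>\<omega>. (T \<omega> - s)\<^sup>2) / \<eta>\<^sup>2"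
      using Tv(1) prob_space by simp
    also have "\<dots> \<le> \<eta>\<^sup>2 + (16 * (\<kappa> - 1)) ^ d * \<eta> ^ 4 / \<eta>\<^sup>2"
      using \<eta> \<kappa> by (intro add_left_mono divide_right_mono order_trans[OF Tv(2)] mult_left_mono) auto
    also have "\<dots> = (1 + (16 * (\<kappa> - 1)) ^ d) * \<eta>\<^sup>2"
    proof -
      have "\<eta> ^ 4 / \<eta>\<^sup>2 = \<eta>\<^sup>2" using \<eta>(1) by (simp add: power_diff[symmetric])
      then show ?thesis by (simp only: times_divide_eq_right[symmetric] distrib_right mult_1_left)
    qed
    finally show ?thesis .
  qed
  have r: "w - \<i> * a * b * z = \<i> * a * (v - b * z) + (w - \<i> * a * v)" for w v z a b :: complex
    by (simp add: algebra_simps)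
  have eq: "(\<integral>\<omega>. of_real (?W \<omega>) * ?e \<omega> \<partial>M) - \<i> * t * s * (\<integral>\<omega>. ?e \<omega> \<partial>M) = \<i> * t * D2 + D1"
    unfolding D1_def D2_def by (rule r)
  have "cmod (\<i> * t * D2 + D1) \<le> cmod (\<i> * t * D2) + cmod D1" by (rule norm_triangle_ineq)
  also have "cmod (\<i> * t * D2) = \<bar>t\<bar> * cmod D2" by (simp add: norm_mult)
  finally have "cmod ((\<integral>\<omega>. of_real (?W \<omega>) * ?e \<omega> \<partial>M) - \<i> * t * s * (\<integral>\<omega>. ?e \<omega> \<partial>M)) \<le> \<bar>t\<bar> * cmod D2 + cmod D1"
    by (simp only: eq)
  also have "\<dots> \<le> \<bar>t\<bar> * ((1 + (16 * (\<kappa> - 1)) ^ d) * \<eta>\<^sup>2) + t\<^sup>2 * (2 * (1 + \<kappa>) * \<Lambda> ^ (2 * d) * s * \<eta>)"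
    using D1 D2 by (intro add_mono mult_left_mono) auto
  finally show ?thesis .
qed

text \<open>The function \<open>exp (s * u^2 / 2)\<close> is the integrating factor of
  \<open>\<phi>' = - s u \<phi>\<close>; its product with \<open>\<phi>\<close> has a small
  derivative on \<open>{0..1}\<close> and starts at 1. Evaluation at 1 is enough, since a frequency
  can be absorbed into the coefficients.\<close>

lemma char_fun_bound:
  fixes \<Lambda> \<eta> :: real
  assumes V: "finite V" "V \<subseteq> I" and c: "homogeneous d c" and d: "d \<ge> 2" and \<kappa>: "\<kappa> \<ge> 3"
    and \<Lambda>: "\<Lambda> \<ge> 1"
    and h3i: "\<And>V c. finite V \<Longrightarrow> V \<subseteq> I \<Longrightarrow> integrable M (\<lambda>\<omega>. \<bar>W V c \<omega>\<bar> powr 3)"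
    and h3: "\<And>V c. finite V \<Longrightarrow> V \<subseteq> I \<Longrightarrow> expectation (\<lambda>\<omega>. \<bar>W V c \<omega>\<bar> powr 3) \<le>
        (\<Sum>S\<in>Pow V. \<Lambda> ^ card S * (c S)\<^sup>2) powr (3 / 2)"
    and \<eta>: "\<eta> > 0" "mid_norm V d c \<le> \<eta> ^ 4"
  defines "s \<equiv> \<Sum>S\<in>Pow V. (c S)\<^sup>2"
  shows "cmod ((\<integral>\<omega>. iexp (W V c \<omega>) \<partial>M) - exp (- s / 2))
    \<le> (1 + (16 * (\<kappa> - 1)) ^ d) * \<eta>\<^sup>2 + 2 * (1 + \<kappa>) * \<Lambda> ^ (2 * d) * s * \<eta>"
proof -
  let ?W = "W V c"
  define \<delta> where "\<delta> = (1 + (16 * (\<kappa> - 1)) ^ d) * \<eta>\<^sup>2 + 2 * (1 + \<kappa>) * \<Lambda> ^ (2 * d) * s * \<eta>"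
  have s0: "s \<ge> 0" by (simp add: s_def sum_nonneg)
  have nn: "(1 + (16 * (\<kappa> - 1)) ^ d) * \<eta>\<^sup>2 \<ge> 0" "2 * (1 + \<kappa>) * \<Lambda> ^ (2 * d) * s * \<eta> \<ge> 0"
    using \<kappa> \<eta> \<Lambda> s0 by auto
  have mW: "?W \<in> borel_measurable M"
    by (rule multilinear_measurable) (use V in auto)
  define \<phi> where "\<phi> u = (\<integral>\<omega>. iexp (u * ?W \<omega>) \<partial>M)" for u
  define \<phi>' where "\<phi>' u = \<i> * (\<integral>\<omega>. of_real (?W \<omega>) * iexp (u * ?W \<omega>) \<partial>M)" for u
  have d\<phi>: "(\<phi> has_vector_derivative \<phi>' u) (at u within A)" for u A
    unfolding \<phi>_def[abs_def] \<phi>'_def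
    by (rule has_vector_derivative_at_within, rule char_fun_has_vector_derivative[OF mW multilinear_second_moment(1)[OF V]])
  define g where "g u = exp (s * u\<^sup>2 / 2)" for u :: real
  have dg: "(g has_real_derivative (s * u * g u)) (at u within A)" for u A
  proof -
    have der: "((\<lambda>u. exp (s * u\<^sup>2 / 2)) has_real_derivative (s * u * exp (s * u\<^sup>2 / 2))) (at u within A)"
      by (auto intro!: derivative_eq_intros)
    have g: "g = (\<lambda>u. exp (s * u\<^sup>2 / 2))" by (rule ext) (rule g_def)
    show ?thesis unfolding g by (rule der)
  qed
  have bound: "norm (\<phi>' u + of_real (s * u) * \<phi> u) \<le> \<delta>" if u: "u \<in> {0..1}" for u
  proof -
    have "norm (\<phi>' u + of_real (s * u) * \<phi> u) = cmod (\<i> * ((\<integral>\<omega>. of_real (?W \<omega>) * iexp (u * ?W \<omega>) \<partial>M) - \<i> * u * s * \<phi> u))"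
      by (simp add: \<phi>'_def algebra_simps)
    also have "\<dots> = cmod ((\<integral>\<omega>. of_real (?W \<omega>) * iexp (u * ?W \<omega>) \<partial>M) - \<i> * u * s * \<phi> u)"
      by (simp add: norm_mult)
    also have "\<dots> \<le> \<bar>u\<bar> * ((1 + (16 * (\<kappa> - 1)) ^ d) * \<eta>\<^sup>2) + u\<^sup>2 * (2 * (1 + \<kappa>) * \<Lambda> ^ (2 * d) * s * \<eta>)"
      unfolding \<phi>_def s_def by (rule stein_bound[OF V c d \<kappa> \<Lambda> h3i h3 \<eta>])
    also have "\<dots> \<le> 1 * ((1 + (16 * (\<kappa> - 1)) ^ d) * \<eta>\<^sup>2) + 1 * (2 * (1 + \<kappa>) * \<Lambda> ^ (2 * d) * s * \<eta>)"
      using u nn by (intro add_mono mult_right_mono) (auto simp: power_le_one)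
    finally show ?thesis by (simp add: \<delta>_def)
  qed
  have "norm (of_real (g 1) * \<phi> 1 - of_real (g 0) * \<phi> 0) \<le> \<delta> * g 1 * 1 - \<delta> * g 1 * 0"
  proof (rule differentiable_bound_general[where f = "\<lambda>u. of_real (g u) * \<phi> u" and \<phi> = "\<lambda>u. \<delta> * g 1 * u"
        and f' = "\<lambda>u. of_real (g u) * (\<phi>' u + of_real (s * u) * \<phi> u)" and \<phi>' = "\<lambda>u. \<delta> * g 1"])
    have der: "((\<lambda>u. of_real (g u) * \<phi> u) has_vector_derivative of_real (g u) * (\<phi>' u + of_real (s * u) * \<phi> u)) (at u within A)" for u A
    proof -
      have "((\<lambda>u. complex_of_real (g u)) has_vector_derivative of_real (s * u * g u)) (at u within A)"
        by (intro has_vector_derivative_of_real dg)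
      from has_vector_derivative_mult[OF this d\<phi>[of u A]]
      show ?thesis by (simp add: algebra_simps)
    qed
    show "continuous_on {0..1} (\<lambda>u. of_real (g u) * \<phi> u)"
      using der by (intro continuous_on_vector_derivative) auto
    fix u :: real assume u: "0 < u" "u < 1"
    show "((\<lambda>u. of_real (g u) * \<phi> u) has_vector_derivative of_real (g u) * (\<phi>' u + of_real (s * u) * \<phi> u)) (at u)"
      by (rule der)
    have "g u \<le> g 1" using u s0 by (auto simp: g_def power_le_one mult_left_le)
    then have "g u * norm (\<phi>' u + of_real (s * u) * \<phi> u) \<le> g 1 * \<delta>"
      using bound[of u] u by (intro mult_mono) (auto simp: g_def)
    moreover have "norm (of_real (g u) * (\<phi>' u + of_real (s * u) * \<phi> u)) = g u * norm (\<phi>' u + of_real (s * u) * \<phi> u)"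
      by (simp only: norm_mult norm_of_real) (simp add: g_def)
    ultimately show "norm (of_real (g u) * (\<phi>' u + of_real (s * u) * \<phi> u)) \<le> \<delta> * g 1"
      by (simp only: mult.commute)
  qed (auto intro!: continuous_intros derivative_eq_intros)
  moreover have "\<phi> 0 = 1" "g 0 = 1" by (simp_all add: \<phi>_def g_def prob_space)
  ultimately have 1: "norm (of_real (g 1) * \<phi> 1 - 1) \<le> \<delta> * g 1" by simp
  have G: "g 1 > 0" "exp (- s / 2) = inverse (g 1)" by (simp_all add: g_def exp_minus)
  have "\<phi> 1 - exp (- s / 2) = of_real (inverse (g 1)) * (of_real (g 1) * \<phi> 1 - 1)"
    using G(1) unfolding G(2) by (simp add: right_diff_distrib)
  then have "cmod (\<phi> 1 - exp (- s / 2)) = inverse (g 1) * norm (of_real (g 1) * \<phi> 1 - 1)"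
    using G(1) by (simp only: norm_mult norm_of_real) simp
  also have "\<dots> \<le> inverse (g 1) * (\<delta> * g 1)"
    using 1 by (intro mult_left_mono) (auto simp: g_def)
  also have "\<dots> = \<delta>" by (simp add: g_def)
  finally show ?thesis by (simp add: \<phi>_def \<delta>_def)
qed

end

subsection \<open>Weak convergence from characteristic functions in several dimensions\<close>

inductive trig_poly :: "(real^'m \<Rightarrow> complex) \<Rightarrow> bool" where
  base: "trig_poly (\<lambda>x. c * iexp (t \<bullet> x))"
| add: "trig_poly f \<Longrightarrow> trig_poly g \<Longrightarrow> trig_poly (\<lambda>x. f x + g x)"

lemma trig_poly_const: "trig_poly (\<lambda>x. c)"
  using trig_poly.base[of c 0] by simp

lemma trig_poly_base_mult: "trig_poly f \<Longrightarrow> trig_poly (\<lambda>x. c * iexp (t \<bullet> x) * f x)"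
proof (induction f rule: trig_poly.induct)
  case (base b s)
  have "(\<lambda>x. c * iexp (t \<bullet> x) * (b * iexp (s \<bullet> x))) = (\<lambda>x. c * b * iexp ((t + s) \<bullet> x))"
    by (simp add: inner_add_left iexp_add fun_eq_iff del: of_real_add)
  then show ?case using trig_poly.base by simp
next
  case (add f g)
  then show ?case using trig_poly.add by (simp add: distrib_left)
qed

lemma trig_poly_mult: "trig_poly f \<Longrightarrow> trig_poly g \<Longrightarrow> trig_poly (\<lambda>x. f x * g x)"
proof (induction f rule: trig_poly.induct)
  case (base c t)
  then show ?case by (rule trig_poly_base_mult)
next
  case (add f h)
  then show ?case using trig_poly.add by (simp add: distrib_right)
qed

lemma trig_poly_sum: "finite A \<Longrightarrow> (\<And>j. j \<in> A \<Longrightarrow> trig_poly (f j)) \<Longrightarrow> trig_poly (\<lambda>x. \<Sum>j\<in>A. f j x)"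
  by (induction A rule: finite_induct) (auto intro: trig_poly_const trig_poly.add)

lemma trig_poly_sin: "trig_poly (\<lambda>x. of_real (sin (t \<bullet> x)))"
proof -
  have s: "complex_of_real (sin y) = (- \<i> / 2) * iexp y + (\<i> / 2) * iexp (- y)" for y
    unfolding sin_of_real[symmetric] sin_exp_eq by (simp add: divide_simps algebra_simps)
  have "trig_poly (\<lambda>x. (- \<i> / 2) * iexp (t \<bullet> x) + (\<i> / 2) * iexp ((- t) \<bullet> x))"
    by (intro trig_poly.add trig_poly.base)
  then show ?thesis unfolding s inner_minus_left .
qed

text \<open>Sines of linear forms are trigonometric polynomials, and these form an algebra. This
  links polynomial approximation on a cube to characteristic functions.\<close>

lemma trig_poly_real_polynomial_function:
  fixes p :: "real^'m \<Rightarrow> real"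
  assumes "real_polynomial_function p"
  shows "trig_poly (\<lambda>x. of_real (p (\<chi> j. sin (x $ j / L))))"
  using assms
proof (induction p rule: real_polynomial_function.induct)
  case (linear p)
  interpret bounded_linear p by fact
  have "p (\<chi> j. sin (x $ j / L)) = (\<Sum>j\<in>UNIV. sin ((axis j (1 / L)) \<bullet> x) * p (axis j 1))" for x
  proof -
    have "(\<chi> j. sin (x $ j / L)) = (\<Sum>j\<in>UNIV. sin (x $ j / L) *\<^sub>R axis j 1)"
      by (subst basis_expansion[symmetric]) (simp add: scalar_mult_eq_scaleR)
    then show ?thesis by (simp add: sum scale inner_axis')
  qed
  then have "(\<lambda>x. complex_of_real (p (\<chi> j. sin (x $ j / L)))) =
      (\<lambda>x. \<Sum>j\<in>UNIV. of_real (sin ((axis j (1 / L)) \<bullet> x)) * of_real (p (axis j 1)))"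
    by (simp only: of_real_sum of_real_mult)
  then show ?case
    by (simp only:) (intro trig_poly_sum trig_poly_mult trig_poly_sin trig_poly_const, simp)
next
  case (const c)
  then show ?case by (rule trig_poly_const)
next
  case (add p q)
  then show ?case using trig_poly.add by simp
next
  case (mult p q)
  then show ?case using trig_poly_mult by simp
qed

lemma integrable_iexp_inner:
  fixes \<mu> :: "(real^'m) measure"
  assumes "prob_space \<mu>" "sets \<mu> = sets borel"
  shows "integrable \<mu> (\<lambda>x. iexp (t \<bullet> x))"
proof -
  interpret prob_space \<mu> by fact
  have [measurable]: "(\<lambda>x. t \<bullet> x) \<in> borel_measurable \<mu>"
    using assms(2) by (simp add: measurable_cong_sets[OF assms(2) refl])
  show ?thesis by (rule integrable_const_bound[of _ 1]) auto
qed

lemma trig_poly_integral_tendsto: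
  fixes \<mu> :: "nat \<Rightarrow> (real^'m) measure"
  assumes \<mu>: "\<And>n. prob_space (\<mu> n)" "\<And>n. sets (\<mu> n) = sets borel" and \<nu>: "prob_space \<nu>" "sets \<nu> = sets borel"
    and conv: "\<And>t. (\<lambda>n. \<integral>x. iexp (t \<bullet> x) \<partial>\<mu> n) \<longlonglongrightarrow> (\<integral>x. iexp (t \<bullet> x) \<partial>\<nu>)"
    and f: "trig_poly f"
  shows "(\<forall>n. integrable (\<mu> n) f) \<and> integrable \<nu> f \<and> (\<lambda>n. \<integral>x. f x \<partial>\<mu> n) \<longlonglongrightarrow> (\<integral>x. f x \<partial>\<nu>)"
  using f
proof (induction f rule: trig_poly.induct)
  case (base c t)
  show ?case using integrable_iexp_inner[OF \<mu>, of _ t] integrable_iexp_inner[OF \<nu>, of t] tendsto_mult[OF tendsto_const conv[of t], of c]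
    by simp
next
  case (add f g)
  then show ?case by (auto intro: tendsto_add)
qed

lemma exceedance_borel: "{x::real^'m. \<exists>j. L < \<bar>x $ j\<bar>} \<in> sets borel"
proof -
  have "{x::real^'m. \<exists>j. L < \<bar>x $ j\<bar>} = (\<Union>j. {x. L < \<bar>x $ j\<bar>})" by auto
  moreover have "open {x::real^'m. L < \<bar>x $ j\<bar>}" for j
    by (intro open_Collect_less continuous_intros)
  then have "open (\<Union>j. {x::real^'m. L < \<bar>x $ j\<bar>})" by (intro open_UN) blast
  ultimately show ?thesis by (simp only: borel_open)
qed

text \<open>The substitution \<open>u j = sin (x j / L)\<close> carries the box
  \<open>\<bar>x j\<bar> \<le> L\<close> injectively into the cube \<open>[-1, 1]^m\<close>, where
  Stone-Weierstrass applies. A polynomial in \<open>u\<close> is a trigonometric polynomial in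
  \<open>x\<close>, so its integrals converge. As \<open>u\<close> never leaves the cube, the
  approximant stays bounded off the box as well, and tightness controls the error there.\<close>

theorem weak_conv_bc_if_char_conv:
  fixes \<mu> :: "nat \<Rightarrow> (real^'m) measure"
  assumes \<mu>: "\<And>n. prob_space (\<mu> n)" "\<And>n. sets (\<mu> n) = sets borel" and \<nu>: "prob_space \<nu>" "sets \<nu> = sets borel"
    and conv: "\<And>t. (\<lambda>n. \<integral>x. iexp (t \<bullet> x) \<partial>\<mu> n) \<longlonglongrightarrow> (\<integral>x. iexp (t \<bullet> x) \<partial>\<nu>)"
    and tight: "\<And>\<epsilon>. \<epsilon> > 0 \<Longrightarrow> \<exists>L. \<forall>\<^sub>F n in sequentially. measure (\<mu> n) {x. \<exists>j. L < \<bar>x $ j\<bar>} \<le> \<epsilon>"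
  shows "weak_conv_bc \<mu> \<nu>"
  unfolding weak_conv_bc_def
proof (intro allI impI)
  fix g :: "real^'m \<Rightarrow> real" assume g: "continuous_on UNIV g \<and> bounded (range g)"
  then obtain b where b: "b > 0" "\<And>x. \<bar>g x\<bar> \<le> b"
    by (auto simp: bounded_pos)
  have gm: "g \<in> borel_measurable borel" using g by (simp add: borel_measurable_continuous_onI)
  note open_out = exceedance_borel
  interpret \<nu>: prob_space \<nu> by fact
  have \<nu>_tight: "\<exists>L. measure \<nu> {x. \<exists>j. L < \<bar>x $ j\<bar>} < \<epsilon>" if "\<epsilon> > 0" for \<epsilon>
  proof -
    define F where "F n = {x::real^'m. \<exists>j. real n < \<bar>x $ j\<bar>}" for n :: nat
    have "decseq F"
      unfolding decseq_def F_def
    proof (intro allI impI subsetI, clarify)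
      fix m n :: nat and x :: "real^'m" and j
      assume "m \<le> n" "real n < \<bar>x $ j\<bar>"
      then have "real m < \<bar>x $ j\<bar>" by linarith
      then show "\<exists>j. real m < \<bar>x $ j\<bar>" by blast
    qed
    moreover have "range F \<subseteq> sets \<nu>" unfolding F_def \<nu>(2) using open_out by (intro image_subsetI)
    ultimately have "(\<lambda>n. measure \<nu> (F n)) \<longlonglongrightarrow> measure \<nu> (\<Inter>n. F n)"
      by (intro \<nu>.finite_Lim_measure_decseq)
    also have "(\<Inter>n. F n) = {}"
    proof -
      have "\<exists>n. x \<notin> F n" for x
      proof -
        obtain n :: nat where "norm x \<le> real n" using real_arch_simple by blast
        then have "\<bar>x $ j\<bar> \<le> real n" for j using component_le_norm_cart[of x j] by linarith
        then show ?thesis unfolding F_def by (auto simp: not_less intro!: exI[of _ n])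
      qed
      then show ?thesis by blast
    qed
    finally have "(\<lambda>n. measure \<nu> (F n)) \<longlonglongrightarrow> 0" by simp
    then have "eventually (\<lambda>n. measure \<nu> (F n) < \<epsilon>) sequentially"
      using that by (rule order_tendstoD)
    then obtain n where "measure \<nu> (F n) < \<epsilon>" by (auto simp: eventually_sequentially)
    then show ?thesis by (auto simp: F_def)
  qed
  show "(\<lambda>n. integral\<^sup>L (\<mu> n) g) \<longlonglongrightarrow> integral\<^sup>L \<nu> g"
  proof (rule LIMSEQ_I)
    fix r :: real assume r: "r > 0"
    \<comment> \<open>The approximation costs \<open>\<epsilon>\<close> everywhere and at most
      \<open>2 * b + 1\<close> more on a set of mass at most \<open>\<epsilon>\<close>, in total
      \<open>\<epsilon> * (2 * b + 2)\<close>. It is paid once for \<open>\<mu> n\<close> and once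
      for \<open>\<nu>\<close>; the last third of \<open>r\<close> goes to the convergence of the
      integrals of \<open>P\<close>.\<close>
    define \<epsilon> where "\<epsilon> = min 1 (r / (3 * (2 * b + 2)))"
    have "\<epsilon> \<le> r / (3 * (2 * b + 2))" by (simp add: \<epsilon>_def)
    then have "\<epsilon> * (3 * (2 * b + 2)) \<le> r" using b(1) by (simp add: pos_le_divide_eq)
    then have \<epsilon>: "\<epsilon> > 0" "\<epsilon> \<le> 1" "\<epsilon> * (2 * b + 2) \<le> r / 3"
      using r b(1) by (auto simp: \<epsilon>_def algebra_simps)
    obtain L1 where L1: "\<forall>\<^sub>F n in sequentially. measure (\<mu> n) {x. \<exists>j. L1 < \<bar>x $ j\<bar>} \<le> \<epsilon>"
      using tight[OF \<epsilon>(1)] by blast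
    obtain L2 where L2: "measure \<nu> {x. \<exists>j. L2 < \<bar>x $ j\<bar>} < \<epsilon>" using \<nu>_tight[OF \<epsilon>(1)] by blast
    define L where "L = max 1 (max L1 L2)"
    have L: "L > 0" "L1 \<le> L" "L2 \<le> L" by (auto simp: L_def)
    let ?K = "{x::real^'m. \<exists>j. L < \<bar>x $ j\<bar>}"
    define Q where "Q = {u::real^'m. \<forall>j. \<bar>u $ j\<bar> \<le> 1}"
    have Q_eq: "Q = cbox (\<chi> j. -1) (\<chi> j. 1)"
      by (auto simp: Q_def mem_box_cart abs_le_iff)
    have "compact Q" unfolding Q_eq by (rule compact_cbox)
    moreover have "continuous_on Q (\<lambda>u. g (\<chi> j. L * arcsin (u $ j)))"
    proof (rule continuous_on_compose2[of UNIV g])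
      show "continuous_on UNIV g" using g by blast
      show "continuous_on Q (\<lambda>u. \<chi> j. L * arcsin (u $ j))"
        by (intro continuous_intros) (auto simp: Q_def abs_le_iff minus_le_iff)
    qed auto
    ultimately obtain p where p: "real_polynomial_function p" "\<And>u. u \<in> Q \<Longrightarrow> \<bar>g (\<chi> j. L * arcsin (u $ j)) - p u\<bar> < \<epsilon>"
      using Stone_Weierstrass_real_polynomial_function[OF _ _ \<epsilon>(1)] by blast
    define P where "P x = p (\<chi> j. sin (x $ j / L))" for x
    have P: "trig_poly (\<lambda>x. complex_of_real (P x))"
      unfolding P_def by (rule trig_poly_real_polynomial_function[OF p(1)])
    note Pc = trig_poly_integral_tendsto[OF \<mu> \<nu> conv P]
    have Pi: "integrable (\<mu> n) P" "integrable \<nu> P" for n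
      using Pc by (auto simp: complex_of_real_integrable_eq)
    have PQ: "(\<chi> j. sin (x $ j / L)) \<in> Q" for x by (simp add: Q_def)
    have near: "\<bar>g x - P x\<bar> \<le> \<epsilon> + (2 * b + 1) * indicator ?K x" for x
    proof (cases "x \<in> ?K")
      case False
      \<comment> \<open>Inside the box \<open>x $ j / L\<close> lies in \<open>[-1, 1]\<close>,
        hence within the range where \<open>arcsin\<close> inverts \<open>sin\<close>.\<close>
      have "arcsin (sin (x $ j / L)) = x $ j / L" for j
      proof (rule arcsin_sin)
        have "\<bar>x $ j / L\<bar> \<le> 1" using False L(1) by (auto simp: not_less)
        then show "- (pi / 2) \<le> x $ j / L" "x $ j / L \<le> pi / 2" using pi_ge_two by linarith+
      qed
      then have "(\<chi> j. L * arcsin ((\<chi> j. sin (x $ j / L)) $ j)) = x"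
        using L(1) by (simp add: vec_eq_iff)
      then show ?thesis using p(2)[OF PQ[of x]] False by (simp add: P_def)
    next
      case True
      have "\<bar>P x\<bar> \<le> b + \<epsilon>" using p(2)[OF PQ[of x]] b(2)[of "\<chi> j. L * arcsin ((\<chi> j. sin (x $ j / L)) $ j)"] unfolding P_def by linarith
      then show ?thesis using True b(2)[of x] \<epsilon> by simp
    qed
    have est: "\<bar>integral\<^sup>L \<rho> g - integral\<^sup>L \<rho> P\<bar> \<le> r / 3"
      if \<rho>: "prob_space \<rho>" "sets \<rho> = sets borel" "integrable \<rho> P" "measure \<rho> ?K \<le> \<epsilon>" for \<rho>
    proof -
      interpret \<rho>: prob_space \<rho> by fact
      have [measurable]: "g \<in> borel_measurable \<rho>" using gm \<rho>(2) by (simp add: measurable_cong_sets[OF \<rho>(2) refl])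
      have gi: "integrable \<rho> g" by (rule \<rho>.integrable_const_bound[of _ b]) (use b in auto)
      have K: "?K \<in> sets \<rho>" using open_out \<rho>(2) by simp
      have Ki: "integrable \<rho> (\<lambda>x. indicator ?K x :: real)" using K by (simp add: integrable_indicator_iff \<rho>.emeasure_finite less_top[symmetric])
      have "\<bar>integral\<^sup>L \<rho> g - integral\<^sup>L \<rho> P\<bar> = \<bar>\<integral>x. g x - P x \<partial>\<rho>\<bar>" using gi \<rho>(3) by simp
      also have "\<dots> \<le> (\<integral>x. \<bar>g x - P x\<bar> \<partial>\<rho>)" by (rule integral_abs_bound)
      also have "\<dots> \<le> (\<integral>x. \<epsilon> + (2 * b + 1) * indicator ?K x \<partial>\<rho>)"
        using gi \<rho>(3) Ki near by (intro integral_mono) auto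
      also have "\<dots> = \<epsilon> + (2 * b + 1) * measure \<rho> ?K"
        using Ki K \<rho>.prob_space sets.sets_into_space[OF K] by (simp add: Int_absorb2)
      also have "\<dots> \<le> \<epsilon> + (2 * b + 1) * \<epsilon>" using \<rho>(4) b(1) by (intro add_left_mono mult_left_mono) auto
      also have "\<dots> = \<epsilon> * (2 * b + 2)" by (simp add: algebra_simps)
      also have "\<dots> \<le> r / 3" by (rule \<epsilon>(3))
      finally show ?thesis .
    qed
    have sub: "measure \<rho> ?K \<le> measure \<rho> {x. \<exists>j. l < \<bar>x $ j\<bar>}" if "prob_space \<rho>" "sets \<rho> = sets borel" "l \<le> L" for \<rho> l
    proof -
      interpret \<rho>: prob_space \<rho> by fact
      show ?thesis using open_out that by (intro \<rho>.finite_measure_mono) (auto intro: order.strict_trans1)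
    qed
    have "(\<lambda>n. integral\<^sup>L (\<mu> n) P) \<longlonglongrightarrow> integral\<^sup>L \<nu> P"
    proof -
      have "(\<lambda>n. complex_of_real (integral\<^sup>L (\<mu> n) P)) \<longlonglongrightarrow> of_real (integral\<^sup>L \<nu> P)"
        using Pc by (simp add: integral_complex_of_real)
      then show ?thesis by (simp only: tendsto_of_real_iff)
    qed
    then have "\<forall>\<^sub>F n in sequentially. dist (integral\<^sup>L (\<mu> n) P) (integral\<^sup>L \<nu> P) < r / 3"
      using r by (intro tendstoD) auto
    then have "\<forall>\<^sub>F n in sequentially. norm (integral\<^sup>L (\<mu> n) g - integral\<^sup>L \<nu> g) < r"
      using L1
    proof eventually_elim
      case (elim n)
      have "\<bar>integral\<^sup>L (\<mu> n) g - integral\<^sup>L (\<mu> n) P\<bar> \<le> r / 3"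
        using elim(2) sub[OF \<mu> L(2)] by (intro est \<mu> Pi) (auto intro: order_trans)
      moreover have "\<bar>integral\<^sup>L \<nu> g - integral\<^sup>L \<nu> P\<bar> \<le> r / 3"
        using L2 sub[OF \<nu> L(3)] by (intro est \<nu> Pi) (auto intro: order_trans)
      ultimately show ?case using elim(1) unfolding dist_real_def real_norm_def by linarith
    qed
    then show "\<exists>no. \<forall>n\<ge>no. norm (integral\<^sup>L (\<mu> n) g - integral\<^sup>L \<nu> g) < r"
      by (simp add: eventually_sequentially)
  qed
qed

subsection \<open>The characteristic function of a Gaussian density\<close>

lemma axis_one_in_Basis: "axis i (1::real) \<in> Basis"
  by (auto simp: Basis_vec_def)

text \<open>By Fubini the coordinate \<open>m\<close> can be integrated first; with the others
  fixed, the shear is a translation by \<open>x $ n\<close> in that coordinate.\<close>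

lemma nn_integral_lborel_shear:
  fixes g :: "real^'m \<Rightarrow> ennreal" and m n :: 'm
  assumes g [measurable]: "g \<in> borel_measurable borel" and mn: "m \<noteq> n"
  shows "(\<integral>\<^sup>+x. g (\<chi> i. if i = m then x $ m + x $ n else x $ i) \<partial>lborel) = (\<integral>\<^sup>+x. g x \<partial>lborel)"
proof -
  let ?h = "\<lambda>x::real^'m. \<chi> i. if i = m then x $ m + x $ n else x $ i"
  let ?b = "axis m 1 :: real^'m" and ?c = "axis n 1 :: real^'m"
  let ?R = "Basis - {?b}"
  interpret product_sigma_finite "\<lambda>_::real^'m. lborel :: real measure"
    by standard
  have bB: "Basis = insert ?b ?R" "?b \<notin> ?R" "finite ?R" by (auto simp: axis_one_in_Basis)
  have cR: "?c \<in> ?R" using mn by (auto simp: axis_eq_axis)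
  have h: "?h x = x + (x $ n) *\<^sub>R ?b" for x
    by (simp add: vec_eq_iff axis_def)
  have hm [measurable]: "?h \<in> borel_measurable borel"
    unfolding h by (intro borel_measurable_add borel_measurable_scaleR borel_measurable_const borel_measurable_nth measurable_ident_sets) auto
  let ?S = "\<lambda>f. \<Sum>b\<in>Basis. f b *\<^sub>R b :: real^'m"
  have meas: "(\<lambda>f. F (?S f)) \<in> borel_measurable (PiM Basis (\<lambda>_. lborel))" if "F \<in> borel_measurable borel" for F :: "real^'m \<Rightarrow> ennreal"
    using that by measurable
  have main: "(\<integral>\<^sup>+x. F x \<partial>lborel) = (\<integral>\<^sup>+ f. (\<integral>\<^sup>+ y. F (y *\<^sub>R ?b + (\<Sum>b\<in>?R. f b *\<^sub>R b)) \<partial>lborel) \<partial>PiM ?R (\<lambda>_. lborel))"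
    if F: "F \<in> borel_measurable borel" for F :: "real^'m \<Rightarrow> ennreal"
  proof -
    have "(\<integral>\<^sup>+x. F x \<partial>lborel) = (\<integral>\<^sup>+f. F (?S f) \<partial>PiM Basis (\<lambda>_. lborel))"
      using F by (subst lborel_eq) (simp add: nn_integral_distr)
    also have "\<dots> = (\<integral>\<^sup>+f. F (?S f) \<partial>PiM (insert ?b ?R) (\<lambda>_. lborel))"
      using bB(1) by simp
    also have "\<dots> = (\<integral>\<^sup>+ f. (\<integral>\<^sup>+ y. F (?S (f(?b := y))) \<partial>lborel) \<partial>PiM ?R (\<lambda>_. lborel))"
      using meas[OF F] bB by (intro product_nn_integral_insert) auto
    also have "\<dots> = (\<integral>\<^sup>+ f. (\<integral>\<^sup>+ y. F (y *\<^sub>R ?b + (\<Sum>b\<in>?R. f b *\<^sub>R b)) \<partial>lborel) \<partial>PiM ?R (\<lambda>_. lborel))"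
    proof -
      have "?S (f(?b := y)) = y *\<^sub>R ?b + (\<Sum>b\<in>?R. f b *\<^sub>R b)" for f y
        using sum.remove[of Basis ?b "\<lambda>b. (f(?b := y)) b *\<^sub>R b"] axis_one_in_Basis[of m] by (simp add: axis_one_in_Basis)
      then show ?thesis by simp
    qed
    finally show ?thesis .
  qed
  have inner: "(\<integral>\<^sup>+ y. g (?h (y *\<^sub>R ?b + z)) \<partial>lborel) = (\<integral>\<^sup>+ y. g (y *\<^sub>R ?b + z) \<partial>lborel)" for z
  proof -
    have "?h (y *\<^sub>R ?b + z) = (z $ n + 1 * y) *\<^sub>R ?b + z" for y
      unfolding h using mn by (simp add: axis_def scaleR_add_left algebra_simps)
    then show ?thesis
      using nn_integral_real_affine[of "\<lambda>y. g (y *\<^sub>R ?b + z)" 1 "z $ n"] by simp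
  qed
  have "(\<lambda>x. g (?h x)) \<in> borel_measurable borel" by measurable
  from main[OF this] main[OF g] show ?thesis by (simp add: inner)
qed

lemma distr_lborel_permute:
  fixes \<pi> :: "'m::finite \<Rightarrow> 'm"
  assumes "bij \<pi>"
  shows "distr lborel borel (\<lambda>x::real^'m. \<chi> i. x $ \<pi> i) = lborel"
proof (rule lborel_eqI[symmetric])
  let ?p = "\<lambda>x::real^'m. \<chi> i. x $ \<pi> i" and ?q = "\<lambda>x::real^'m. \<chi> i. x $ inv \<pi> i"
  have inv: "\<pi> (inv \<pi> i) = i" "inv \<pi> (\<pi> i) = i" for i
    using assms by (simp_all add: bij_is_surj surj_f_inv_f bij_is_inj)
  have m [measurable]: "?p \<in> borel_measurable borel"
    by (intro borel_measurable_continuous_onI continuous_intros)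
  have prod_Basis: "(\<Prod>b\<in>Basis. (u - l) \<bullet> b) = (\<Prod>i\<in>UNIV. u $ i - l $ i)" for u l :: "real^'m"
  proof -
    have B: "(Basis :: (real^'m) set) = (\<lambda>i. axis i 1) ` UNIV" by (auto simp: Basis_vec_def)
    show ?thesis unfolding B
      by (subst prod.reindex) (auto simp: inj_on_def axis_eq_axis inner_axis)
  qed
  fix l u :: "real^'m" assume le: "\<And>b. b \<in> Basis \<Longrightarrow> l \<bullet> b \<le> u \<bullet> b"
  have lei: "l $ i \<le> u $ i" for i using le[of "axis i 1"] by (simp add: axis_one_in_Basis inner_axis)
  have "?p -` box l u = box (?q l) (?q u)"
  proof (intro set_eqI iffI)
    fix x assume "x \<in> ?p -` box l u"
    then have "l $ i < x $ \<pi> i \<and> x $ \<pi> i < u $ i" for i by (simp add: mem_box_cart)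
    from this[of "inv \<pi> _"] show "x \<in> box (?q l) (?q u)" by (simp add: mem_box_cart inv)
  next
    fix x assume "x \<in> box (?q l) (?q u)"
    then have "l $ inv \<pi> i < x $ i \<and> x $ i < u $ inv \<pi> i" for i by (simp add: mem_box_cart)
    from this[of "\<pi> _"] show "x \<in> ?p -` box l u" by (simp add: mem_box_cart inv)
  qed
  then have "emeasure (distr lborel borel ?p) (box l u) = emeasure lborel (box (?q l) (?q u))"
    by (simp add: emeasure_distr)
  also have "\<dots> = (\<Prod>b\<in>Basis. (?q u - ?q l) \<bullet> b)"
  proof (rule emeasure_lborel_box)
    fix b :: "real^'m" assume "b \<in> Basis"
    then show "?q l \<bullet> b \<le> ?q u \<bullet> b" using lei by (auto simp: Basis_vec_def inner_axis)
  qed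
  also have "(\<Prod>b\<in>Basis. (?q u - ?q l) \<bullet> b) = (\<Prod>b\<in>Basis. (u - l) \<bullet> b)"
    unfolding prod_Basis
    by (simp, rule prod.reindex_bij_betw[OF bij_imp_bij_inv[OF assms], of "\<lambda>i. u $ i - l $ i"])
  finally show "emeasure (distr lborel borel ?p) (box l u) = (\<Prod>b\<in>Basis. (u - l) \<bullet> b)" .
qed simp

text \<open>The formula is stable under composition because determinants multiply, so elementary
  maps suffice. The determinant condition is carried inside the induction to make the case of a zero
  component vacuous, and \<open>g\<close> is quantified because composition applies the hypothesis
  to \<open>g\<close> after \<open>f1\<close>.\<close>

lemma nn_integral_lborel_linear:
  fixes f :: "real^'m \<Rightarrow> real^'m"
  assumes "linear f" "det (matrix f) \<noteq> 0" "g \<in> borel_measurable borel"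
  shows "(\<integral>\<^sup>+x. g x \<partial>lborel) = ennreal \<bar>det (matrix f)\<bar> * (\<integral>\<^sup>+x. g (f x) \<partial>lborel)"
proof -
  have "\<forall>g\<in>borel_measurable borel. det (matrix f) \<noteq> 0 \<longrightarrow>
      (\<integral>\<^sup>+x. g x \<partial>lborel) = ennreal \<bar>det (matrix f)\<bar> * (\<integral>\<^sup>+x. g (f x) \<partial>lborel)"
  proof (rule induct_linear_elementary[OF assms(1)])
    fix f1 f2 :: "real^'m \<Rightarrow> real^'m"
    assume lin: "linear f1" "linear f2"
      and 1: "\<forall>g\<in>borel_measurable borel. det (matrix f1) \<noteq> 0 \<longrightarrow> (\<integral>\<^sup>+x. g x \<partial>lborel) = ennreal \<bar>det (matrix f1)\<bar> * (\<integral>\<^sup>+x. g (f1 x) \<partial>lborel)"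
      and 2: "\<forall>g\<in>borel_measurable borel. det (matrix f2) \<noteq> 0 \<longrightarrow> (\<integral>\<^sup>+x. g x \<partial>lborel) = ennreal \<bar>det (matrix f2)\<bar> * (\<integral>\<^sup>+x. g (f2 x) \<partial>lborel)"
    have det: "det (matrix (f1 \<circ> f2)) = det (matrix f1) * det (matrix f2)"
      by (simp add: matrix_compose[OF lin(2,1)] det_mul)
    have m1: "f1 \<in> borel_measurable borel"
      using lin(1) by (intro borel_measurable_continuous_onI linear_continuous_on) (simp add: linear_linear)
    show "\<forall>g\<in>borel_measurable borel. det (matrix (f1 \<circ> f2)) \<noteq> 0 \<longrightarrow>
      (\<integral>\<^sup>+x. g x \<partial>lborel) = ennreal \<bar>det (matrix (f1 \<circ> f2))\<bar> * (\<integral>\<^sup>+x. g ((f1 \<circ> f2) x) \<partial>lborel)"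
    proof (intro ballI impI)
      fix g :: "real^'m \<Rightarrow> ennreal" assume g: "g \<in> borel_measurable borel" and nz: "det (matrix (f1 \<circ> f2)) \<noteq> 0"
      have "(\<lambda>x. g (f1 x)) \<in> borel_measurable borel" using measurable_compose[OF m1 g] by simp
      then have "(\<integral>\<^sup>+x. g (f1 x) \<partial>lborel) = ennreal \<bar>det (matrix f2)\<bar> * (\<integral>\<^sup>+x. g (f1 (f2 x)) \<partial>lborel)"
        using 2 nz det by auto
      moreover have "(\<integral>\<^sup>+x. g x \<partial>lborel) = ennreal \<bar>det (matrix f1)\<bar> * (\<integral>\<^sup>+x. g (f1 x) \<partial>lborel)"
        using 1 nz det g by auto
      ultimately show "(\<integral>\<^sup>+x. g x \<partial>lborel) = ennreal \<bar>det (matrix (f1 \<circ> f2))\<bar> * (\<integral>\<^sup>+x. g ((f1 \<circ> f2) x) \<partial>lborel)"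
        by (simp add: det abs_mult ennreal_mult mult.assoc)
    qed
  next
    fix f :: "real^'m \<Rightarrow> real^'m" and i
    assume "linear f" and 0: "\<And>x. f x $ i = 0"
    then have "\<not> inj f"
      by (metis (full_types) linear_injective_imp_surjective one_neq_zero surjE vec_component)
    then show "\<forall>g\<in>borel_measurable borel. det (matrix f) \<noteq> 0 \<longrightarrow>
      (\<integral>\<^sup>+x. g x \<partial>lborel) = ennreal \<bar>det (matrix f)\<bar> * (\<integral>\<^sup>+x. g (f x) \<partial>lborel)"
      using det_nz_iff_inj[OF \<open>linear f\<close>] by blast
  next
    fix c :: "'m \<Rightarrow> real"
    let ?f = "\<lambda>x::real^'m. \<chi> i. c i * x $ i"
    have det: "det (matrix ?f) = prod c UNIV"
      by (simp add: axis_def matrix_def det_diagonal)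
    have B: "(Basis :: (real^'m) set) = (\<lambda>i. axis i 1) ` UNIV" by (auto simp: Basis_vec_def)
    define c' where "c' b = c (SOME i. b = axis i 1)" for b :: "real^'m"
    have c': "c' (axis i 1) = c i" for i by (simp add: c'_def axis_eq_axis)
    show "\<forall>g\<in>borel_measurable borel. det (matrix ?f) \<noteq> 0 \<longrightarrow>
      (\<integral>\<^sup>+x. g x \<partial>lborel) = ennreal \<bar>det (matrix ?f)\<bar> * (\<integral>\<^sup>+x. g (?f x) \<partial>lborel)"
    proof (intro ballI impI)
      fix g :: "real^'m \<Rightarrow> ennreal" assume g [measurable]: "g \<in> borel_measurable borel" and nz: "det (matrix ?f) \<noteq> 0"
      have cnz: "c i \<noteq> 0" for i using nz unfolding det by (simp add: prod_zero_iff)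
      have f_eq: "?f x = 0 + (\<Sum>j\<in>Basis. (c' j * (x \<bullet> j)) *\<^sub>R j)" for x
      proof -
        have "(\<Sum>j\<in>Basis. (c' j * (x \<bullet> j)) *\<^sub>R j) = (\<Sum>i\<in>UNIV. (c i * x $ i) *\<^sub>R axis i 1)"
          unfolding B by (subst sum.reindex) (auto simp: inj_on_def axis_eq_axis c' inner_axis)
        then show ?thesis by (simp add: vec_eq_iff axis_def if_distrib cong: if_cong)
      qed
      have prod: "(\<Prod>j\<in>Basis. \<bar>c' j\<bar>) = \<bar>det (matrix ?f)\<bar>"
        unfolding B det by (subst prod.reindex) (auto simp: inj_on_def axis_eq_axis c' abs_prod)
      have "lborel = density (distr lborel borel ?f) (\<lambda>_. ennreal \<bar>det (matrix ?f)\<bar>)"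
      proof -
        have "c' j \<noteq> 0" if "j \<in> Basis" for j using that cnz c' by (auto simp: B)
        from lborel_affine_euclidean[of c' 0, OF this] show ?thesis
          unfolding f_eq[symmetric] prod .
      qed
      moreover have fm [measurable]: "?f \<in> borel_measurable borel"
        by (intro borel_measurable_continuous_onI continuous_intros)
      ultimately have "(\<integral>\<^sup>+x. g x \<partial>lborel) = (\<integral>\<^sup>+x. g x \<partial>density (distr lborel borel ?f) (\<lambda>_. ennreal \<bar>det (matrix ?f)\<bar>))"
        by simp
      also have "\<dots> = ennreal \<bar>det (matrix ?f)\<bar> * (\<integral>\<^sup>+x. g (?f x) \<partial>lborel)"
        by (simp add: nn_integral_density nn_integral_distr nn_integral_cmult)
      finally show "(\<integral>\<^sup>+x. g x \<partial>lborel) = ennreal \<bar>det (matrix ?f)\<bar> * (\<integral>\<^sup>+x. g (?f x) \<partial>lborel)" .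
    qed
  next
    fix m n :: 'm assume "m \<noteq> n"
    let ?f = "\<lambda>x::real^'m. \<chi> i. x $ Transposition.transpose m n i"
    have "(\<chi> i j. if Transposition.transpose m n i = j then 1 else 0) = (\<chi> i j. if j = Transposition.transpose m n i then 1 else (0::real))"
      by (auto intro!: Cart_lambda_cong)
    then have "matrix ?f = transpose (\<chi> i j. mat 1 $ i $ Transposition.transpose m n j)"
      by (auto simp: matrix_eq transpose_def axis_def mat_def matrix_def)
    then have det: "\<bar>det (matrix ?f)\<bar> = 1"
      by (simp add: det_permute_columns permutes_swap_id sign_swap_id abs_mult)
    have fm [measurable]: "?f \<in> borel_measurable borel"
      by (intro borel_measurable_continuous_onI continuous_intros)
    show "\<forall>g\<in>borel_measurable borel. det (matrix ?f) \<noteq> 0 \<longrightarrow>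
      (\<integral>\<^sup>+x. g x \<partial>lborel) = ennreal \<bar>det (matrix ?f)\<bar> * (\<integral>\<^sup>+x. g (?f x) \<partial>lborel)"
    proof (intro ballI impI)
      fix g :: "real^'m \<Rightarrow> ennreal" assume g [measurable]: "g \<in> borel_measurable borel"
      have "(\<integral>\<^sup>+x. g x \<partial>lborel) = (\<integral>\<^sup>+x. g x \<partial>distr lborel borel ?f)"
        by (subst distr_lborel_permute) (simp_all add: bij_swap_iff)
      also have "\<dots> = (\<integral>\<^sup>+x. g (?f x) \<partial>lborel)" by (simp add: nn_integral_distr)
      finally show "(\<integral>\<^sup>+x. g x \<partial>lborel) = ennreal \<bar>det (matrix ?f)\<bar> * (\<integral>\<^sup>+x. g (?f x) \<partial>lborel)"
        by (simp add: det)
    qed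
  next
    fix m n :: 'm assume mn: "m \<noteq> n"
    let ?f = "\<lambda>x::real^'m. \<chi> i. if i = m then x $ m + x $ n else x $ i"
    have "matrix ?f = (\<chi> k. if k = m then row m (mat 1) + 1 *s row n (mat 1) else row k (mat 1))"
      by (auto simp: matrix_def vec_eq_iff axis_def row_def mat_def)
    then have det: "det (matrix ?f) = 1"
      using det_row_operation[OF mn, of "mat 1 :: real^'m^'m" 1] by simp
    show "\<forall>g\<in>borel_measurable borel. det (matrix ?f) \<noteq> 0 \<longrightarrow>
      (\<integral>\<^sup>+x. g x \<partial>lborel) = ennreal \<bar>det (matrix ?f)\<bar> * (\<integral>\<^sup>+x. g (?f x) \<partial>lborel)"
      by (simp add: det nn_integral_lborel_shear[OF _ mn])
  qed
  then show ?thesis using assms by blast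
qed

lemma lborel_eq_density_distr_linear:
  fixes f :: "real^'m \<Rightarrow> real^'m"
  assumes "linear f" "det (matrix f) \<noteq> 0"
  shows "lborel = density (distr lborel borel f) (\<lambda>_. ennreal \<bar>det (matrix f)\<bar>)"
proof (rule measure_eqI)
  have fm [measurable]: "f \<in> borel_measurable borel"
    using assms(1) by (intro borel_measurable_continuous_onI linear_continuous_on) (simp add: linear_linear)
  fix A :: "(real^'m) set" assume "A \<in> sets lborel"
  then have A [measurable]: "A \<in> sets borel" by simp
  have "emeasure lborel A = (\<integral>\<^sup>+x. indicator A x \<partial>lborel)" by simp
  also have "\<dots> = ennreal \<bar>det (matrix f)\<bar> * (\<integral>\<^sup>+x. indicator A (f x) \<partial>lborel)"
    by (rule nn_integral_lborel_linear[OF assms]) simp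
  also have "\<dots> = emeasure (density (distr lborel borel f) (\<lambda>_. ennreal \<bar>det (matrix f)\<bar>)) A"
    using nn_integral_distr[of f lborel borel "indicator A"] by (simp add: emeasure_density nn_integral_cmult)
  finally show "emeasure lborel A = emeasure (density (distr lborel borel f) (\<lambda>_. ennreal \<bar>det (matrix f)\<bar>)) A" .
qed simp

lemma lborel_integral_prod_cart:
  fixes F :: "'m::finite \<Rightarrow> real \<Rightarrow> complex"
  assumes F: "\<And>i. integrable lborel (F i)"
  shows "(\<integral>x. (\<Prod>i\<in>UNIV. F i (x $ i)) \<partial>(lborel :: (real^'m) measure)) = (\<Prod>i\<in>UNIV. \<integral>y. F i y \<partial>lborel)"
proof -
  interpret product_sigma_finite "\<lambda>_::real^'m. lborel :: real measure"
    by standard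
  have B: "(Basis :: (real^'m) set) = (\<lambda>i. axis i 1) ` UNIV" by (auto simp: Basis_vec_def)
  define F' where "F' b = F (SOME i. b = axis i 1)" for b :: "real^'m"
  have F': "F' (axis i 1) = F i" for i by (simp add: F'_def axis_eq_axis)
  have [measurable]: "F i \<in> borel_measurable borel" for i using borel_measurable_integrable[OF F[of i]] by simp
  have re: "(\<Prod>i\<in>UNIV. h (axis i 1)) = (\<Prod>b\<in>Basis. h b)" for h :: "real^'m \<Rightarrow> complex"
    unfolding B by (subst prod.reindex) (auto simp: inj_on_def axis_eq_axis)
  have "(\<integral>x. (\<Prod>i\<in>UNIV. F i (x $ i)) \<partial>(lborel :: (real^'m) measure)) =
    (\<integral>f. (\<Prod>i\<in>UNIV. F i ((\<Sum>b\<in>Basis. f b *\<^sub>R b) $ i)) \<partial>PiM Basis (\<lambda>_::real^'m. lborel))"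
    by (subst lborel_eq) (simp add: integral_distr)
  also have "\<dots> = (\<integral>f. (\<Prod>b\<in>Basis. F' b (f b)) \<partial>PiM Basis (\<lambda>_::real^'m. lborel))"
  proof (intro Bochner_Integration.integral_cong refl)
    fix f :: "real^'m \<Rightarrow> real"
    have "(\<Sum>b\<in>Basis. f b *\<^sub>R b) $ i = f (axis i 1)" for i
    proof -
      have "(\<Sum>b\<in>Basis. f b *\<^sub>R b) $ i = (\<Sum>b\<in>Basis. f b *\<^sub>R b) \<bullet> axis i 1" by (simp add: inner_axis)
      also have "\<dots> = f (axis i 1)" by (simp add: axis_one_in_Basis)
      finally show ?thesis .
    qed
    then show "(\<Prod>i\<in>UNIV. F i ((\<Sum>b\<in>Basis. f b *\<^sub>R b) $ i)) = (\<Prod>b\<in>Basis. F' b (f b))"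
      by (simp add: re[symmetric] F')
  qed
  also have "\<dots> = (\<Prod>b\<in>Basis. \<integral>y. F' b y \<partial>lborel)"
    by (rule product_integral_prod) (auto simp: B F' F)
  also have "\<dots> = (\<Prod>i\<in>UNIV. \<integral>y. F i y \<partial>lborel)"
    by (simp add: re[symmetric] F')
  finally show ?thesis .
qed

section \<open>Standard normal integral and factorization of the covariance matrix\<close>

lemma integral_std_normal_iexp:
  "integrable lborel (\<lambda>y. complex_of_real (std_normal_density y) * iexp (t * y))"
  "(\<integral>y. complex_of_real (std_normal_density y) * iexp (t * y) \<partial>lborel) = exp (- (t\<^sup>2) / 2)"
proof -
  have i: "integrable lborel std_normal_density" by (rule integrable_normal_density) simp
  show "integrable lborel (\<lambda>y. complex_of_real (std_normal_density y) * iexp (t * y))"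
    by (rule Bochner_Integration.integrable_bound[OF i]) (auto simp: norm_mult)
  have "char std_normal_distribution t = (\<integral>y. std_normal_density y *\<^sub>R iexp (t * y) \<partial>lborel)"
    unfolding char_def by (subst integral_density) (auto simp: normal_density_nonneg)
  then show "(\<integral>y. complex_of_real (std_normal_density y) * iexp (t * y) \<partial>lborel) = exp (- (t\<^sup>2) / 2)"
    unfolding char_std_normal_distribution by (simp add: scaleR_conv_of_real)
qed

text \<open>Gram-Schmidt for the inner product \<open>x \<bullet> (C *v y)\<close>. A dimension
  count provides a vector outside the current span, and positive definiteness allows the division by
  its norm after projection.\<close>

lemma sym_pos_def_orthonormal_family:
  fixes C :: "real^'m^'m"
  assumes C: "sym_pos_def C" and "k \<le> CARD('m)"
  shows "\<exists>b :: nat \<Rightarrow> real^'m. \<forall>i<k. \<forall>j<k. b i \<bullet> (C *v b j) = (if i = j then 1 else 0)"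
  using assms(2)
proof (induction k)
  case (Suc k)
  then obtain b :: "nat \<Rightarrow> real^'m" where b: "\<And>i j. i < k \<Longrightarrow> j < k \<Longrightarrow> b i \<bullet> (C *v b j) = (if i = j then 1 else 0)"
    by auto
  have sym: "x \<bullet> (C *v y) = y \<bullet> (C *v x)" for x y
    using C by (metis dot_lmul_matrix inner_commute sym_pos_def_def transpose_matrix_vector)
  have "dim (span (b ` {..<k})) \<le> card (b ` {..<k})" by (simp add: dim_le_card')
  also have "\<dots> \<le> k" using card_image_le[of "{..<k}" b] by simp
  finally have "dim (span (b ` {..<k})) < DIM(real^'m)" using Suc.prems by simp
  then have "span (b ` {..<k}) \<noteq> UNIV" by (metis dim_UNIV less_irrefl)
  then obtain x where x: "x \<notin> span (b ` {..<k})" by auto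
  define y where "y = x - (\<Sum>i<k. (b i \<bullet> (C *v x)) *\<^sub>R b i)"
  have y: "y \<noteq> 0"
  proof
    assume "y = 0"
    then have "x = (\<Sum>i<k. (b i \<bullet> (C *v x)) *\<^sub>R b i)" by (simp add: y_def)
    also have "\<dots> \<in> span (b ` {..<k})" by (intro span_sum span_scale span_base) auto
    finally show False using x by simp
  qed
  have by0: "b j \<bullet> (C *v y) = 0" if j: "j < k" for j
  proof -
    have "b j \<bullet> (C *v y) = y \<bullet> (C *v b j)" by (rule sym)
    also have "\<dots> = x \<bullet> (C *v b j) - (\<Sum>i<k. (b i \<bullet> (C *v x)) * (b i \<bullet> (C *v b j)))"
      by (simp add: y_def inner_diff_left inner_sum_left)
    also have "(\<Sum>i<k. (b i \<bullet> (C *v x)) * (b i \<bullet> (C *v b j))) = (\<Sum>i<k. if i = j then b i \<bullet> (C *v x) else 0)"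
      using b j by (intro sum.cong) auto
    also have "\<dots> = b j \<bullet> (C *v x)" using j by simp
    finally show ?thesis using sym[of x "b j"] by simp
  qed
  have yy: "y \<bullet> (C *v y) > 0" using C y by (auto simp: sym_pos_def_def)
  define z where "z = (1 / sqrt (y \<bullet> (C *v y))) *\<^sub>R y"
  have zz: "z \<bullet> (C *v z) = 1"
    using yy by (simp add: z_def matrix_vector_mult_scaleR power2_eq_square[symmetric] field_simps)
  have bz: "b j \<bullet> (C *v z) = 0" if "j < k" for j
    using by0[OF that] by (simp add: z_def matrix_vector_mult_scaleR)
  have "\<forall>i<Suc k. \<forall>j<Suc k. (b(k := z)) i \<bullet> (C *v (b(k := z)) j) = (if i = j then 1 else 0)"
  proof (intro allI impI)
    fix i j assume "i < Suc k" "j < Suc k"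
    then consider "i < k" "j < k" | "i = k" "j < k" | "i < k" "j = k" | "i = k" "j = k" by linarith
    then show "(b(k := z)) i \<bullet> (C *v (b(k := z)) j) = (if i = j then 1 else 0)"
    proof cases
      case 2
      then show ?thesis using bz[of j] sym[of z "b j"] by simp
    qed (use b bz zz in auto)
  qed
  then show ?case by blast
qed auto

text \<open>Let the columns of \<open>B\<close> be orthonormal for \<open>C\<close>, that is,
  \<open>transpose B ** C ** B = mat 1\<close>. Then \<open>A = C ** B\<close> is inverse to
  \<open>transpose B\<close>, and both the factorization of \<open>C\<close> and that of its inverse
  follow algebraically.\<close>

lemma sym_pos_def_factorization:
  fixes C :: "real^'m^'m"
  assumes C: "sym_pos_def C"
  obtains A B :: "real^'m^'m" where "A ** transpose A = C" "transpose B ** A = mat 1" "matrix_inv C = B ** transpose B"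
proof -
  obtain b :: "nat \<Rightarrow> real^'m" where b: "\<And>i j. i < CARD('m) \<Longrightarrow> j < CARD('m) \<Longrightarrow> b i \<bullet> (C *v b j) = (if i = j then 1 else 0)"
    using sym_pos_def_orthonormal_family[OF C order_refl] by blast
  obtain h where h: "bij_betw h (UNIV :: 'm set) {0..<CARD('m)}"
    using ex_bij_betw_finite_nat[of "UNIV :: 'm set"] by auto
  have hl: "h i < CARD('m)" for i using h by (auto simp: bij_betw_def)
  have hi: "h i = h j \<longleftrightarrow> i = j" for i j using h by (auto simp: bij_betw_def inj_on_def)
  define B :: "real^'m^'m" where "B = (\<chi> i j. b (h j) $ i)"
  define A where "A = C ** B"
  have tC: "transpose C = C" using C by (simp add: sym_pos_def_def)
  have "(transpose B ** A) $ i $ j = (mat 1 :: real^'m^'m) $ i $ j" for i j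
  proof -
    have "(transpose B ** A) $ i $ j = (\<Sum>k\<in>UNIV. b (h i) $ k * (\<Sum>l\<in>UNIV. C $ k $ l * b (h j) $ l))"
      by (simp add: matrix_matrix_mult_def A_def B_def transpose_def)
    also have "\<dots> = b (h i) \<bullet> (C *v b (h j))"
      by (simp add: inner_vec_def matrix_vector_mult_def)
    also have "\<dots> = (if i = j then 1 else 0)" using b[OF hl hl] hi by simp
    finally show ?thesis by (simp add: mat_def)
  qed
  then have BA: "transpose B ** A = mat 1" by (simp add: vec_eq_iff)
  then have AB: "A ** transpose B = mat 1" by (simp add: matrix_left_right_inverse)
  have tA: "transpose A = transpose B ** C" by (simp add: A_def matrix_transpose_mul tC)
  have "A ** transpose A = (A ** transpose B) ** C" by (simp add: tA matrix_mul_assoc)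
  then have 1: "A ** transpose A = C" by (simp add: AB)
  have CB: "C ** (B ** transpose B) = mat 1" using AB by (simp add: A_def matrix_mul_assoc)
  then have BC: "(B ** transpose B) ** C = mat 1" by (simp add: matrix_left_right_inverse)
  have "invertible C" using CB BC unfolding invertible_def by blast
  then have inv: "C ** matrix_inv C = mat 1" "matrix_inv C ** C = mat 1"
    unfolding invertible_def matrix_inv_def by (metis (mono_tags, lifting) someI_ex)+
  have "matrix_inv C = matrix_inv C ** (C ** (B ** transpose B))" by (simp add: CB)
  also have "\<dots> = B ** transpose B" by (simp add: matrix_mul_assoc inv)
  finally have 3: "matrix_inv C = B ** transpose B" .
  from that[OF 1 BA 3] show thesis .
qed

text \<open>Substituting \<open>x = A *v y\<close> turns the quadratic form into
  \<open>y \<bullet> y\<close> and cancels the determinant, leaving a product of standard normal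
  densities. The frequency becomes \<open>transpose A *v t\<close>, whose squared length is
  \<open>t \<bullet> (C *v t)\<close>.\<close>

lemma centered_gaussian_char:
  fixes C :: "real^'m^'m"
  assumes C: "sym_pos_def C"
  shows "prob_space (centered_gaussian C)" "sets (centered_gaussian C) = sets borel"
    "(\<integral>x. iexp (t \<bullet> x) \<partial>centered_gaussian C) = exp (- (t \<bullet> (C *v t)) / 2)"
proof -
  obtain A B :: "real^'m^'m" where AA: "A ** transpose A = C" and BA: "transpose B ** A = mat 1" and iC: "matrix_inv C = B ** transpose B"
    using sym_pos_def_factorization[OF C] by blast
  define D where "D x = exp (- (x \<bullet> (matrix_inv C *v x)) / 2) / sqrt ((2 * pi) ^ CARD('m) * det C)" for x :: "real^'m"
  have detA: "det A \<noteq> 0"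
  proof
    assume "det A = 0"
    then have "det (transpose B ** A) = 0" by (simp add: det_mul)
    then show False using BA by simp
  qed
  have detC: "det C = (det A)\<^sup>2" by (simp add: AA[symmetric] det_mul power2_eq_square)
  have tAB: "transpose A ** B = mat 1"
    using arg_cong[OF BA, of transpose] by (simp add: matrix_transpose_mul)
  have D_A: "D (A *v y) = (\<Prod>i\<in>UNIV. std_normal_density (y $ i)) / \<bar>det A\<bar>" for y
  proof -
    have "(A *v y) \<bullet> (matrix_inv C *v (A *v y)) = (A *v y) \<bullet> (B *v ((transpose B ** A) *v y))"
      by (simp add: iC matrix_vector_mul_assoc matrix_mul_assoc)
    also have "\<dots> = y \<bullet> ((transpose A ** B) *v y)"
      by (simp add: BA dot_lmul_matrix[symmetric] matrix_vector_mul_assoc[symmetric] flip: transpose_matrix_vector)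
    also have "\<dots> = (\<Sum>i\<in>UNIV. (y $ i)\<^sup>2)" by (simp add: tAB inner_vec_def power2_eq_square)
    finally have e: "(A *v y) \<bullet> (matrix_inv C *v (A *v y)) = (\<Sum>i\<in>UNIV. (y $ i)\<^sup>2)" .
    have "(\<Prod>i\<in>UNIV. std_normal_density (y $ i)) = (\<Prod>i\<in>(UNIV::'m set). 1 / sqrt (2 * pi)) * (\<Prod>i\<in>UNIV. exp (- (y $ i)\<^sup>2 / 2))"
      by (simp only: std_normal_density_def prod.distrib)
    also have "(\<Prod>i\<in>UNIV. exp (- (y $ i)\<^sup>2 / 2)) = exp (\<Sum>i\<in>UNIV. - (y $ i)\<^sup>2 / 2)"
      by (simp add: exp_sum)
    also have "(\<Sum>i\<in>UNIV. - (y $ i)\<^sup>2 / 2) = - (\<Sum>i\<in>UNIV. (y $ i)\<^sup>2) / 2"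
      by (simp add: sum_divide_distrib sum_negf)
    also have "(\<Prod>i\<in>(UNIV::'m set). 1 / sqrt (2 * pi)) = 1 / sqrt ((2 * pi) ^ CARD('m))"
      by (simp only: prod_constant power_one_over real_sqrt_power)
    finally have p: "(\<Prod>i\<in>UNIV. std_normal_density (y $ i)) = 1 / sqrt ((2 * pi) ^ CARD('m)) * exp (- (\<Sum>i\<in>UNIV. (y $ i)\<^sup>2) / 2)" .
    show ?thesis unfolding p D_def e detC by (simp add: real_sqrt_mult)
  qed
  have Dm [measurable]: "D \<in> borel_measurable borel"
    unfolding D_def by (intro borel_measurable_continuous_onI continuous_intros linear_continuous_on matrix_vector_mul_bounded_linear) (use detC detA in auto)
  have D0: "D x \<ge> 0" for x using detC by (simp add: D_def)
  have cg: "centered_gaussian C = density lborel (\<lambda>x. ennreal (D x))"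
    unfolding centered_gaussian_def D_def by simp
  have lin: "linear ((*v) A)" by simp
  have Am [measurable]: "(*v) A \<in> borel_measurable borel"
    by (intro borel_measurable_continuous_onI linear_continuous_on matrix_vector_mul_bounded_linear)
  have main: "(\<integral>x. D x *\<^sub>R iexp (t \<bullet> x) \<partial>lborel) = exp (- (t \<bullet> (C *v t)) / 2)" for t
  proof -
    define u where "u = transpose A *v t"
    have tA: "t \<bullet> (A *v y) = (\<Sum>i\<in>UNIV. u $ i * y $ i)" for y
    proof -
      have "t \<bullet> (A *v y) = u \<bullet> y" unfolding u_def by (simp add: dot_lmul_matrix transpose_matrix_vector)
      then show ?thesis by (simp add: inner_vec_def)
    qed
    have "(\<integral>x. D x *\<^sub>R iexp (t \<bullet> x) \<partial>lborel) = (\<integral>x. D x *\<^sub>R iexp (t \<bullet> x) \<partial>density (distr lborel borel ((*v) A)) (\<lambda>_. ennreal \<bar>det A\<bar>))"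
      using lborel_eq_density_distr_linear[OF lin] detA by (simp add: matrix_of_matrix_vector_mul)
    also have "\<dots> = (\<integral>y. \<bar>det A\<bar> *\<^sub>R (D (A *v y) *\<^sub>R iexp (t \<bullet> (A *v y))) \<partial>lborel)"
      by (subst integral_density) (simp_all add: integral_distr)
    also have "\<dots> = (\<integral>y. (\<Prod>i\<in>UNIV. complex_of_real (std_normal_density (y $ i)) * iexp (u $ i * y $ i)) \<partial>lborel)"
    proof (intro Bochner_Integration.integral_cong refl)
      fix y :: "real^'m"
      have "iexp (t \<bullet> (A *v y)) = (\<Prod>i\<in>UNIV. iexp (u $ i * y $ i))"
        unfolding tA of_real_sum sum_distrib_left by (rule exp_sum) simp
      then show "\<bar>det A\<bar> *\<^sub>R (D (A *v y) *\<^sub>R iexp (t \<bullet> (A *v y))) = (\<Prod>i\<in>UNIV. complex_of_real (std_normal_density (y $ i)) * iexp (u $ i * y $ i))"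
        using detA by (simp only: prod.distrib D_A) (simp add: scaleR_conv_of_real flip: of_real_prod)
    qed
    also have "\<dots> = (\<Prod>i\<in>UNIV. \<integral>y. complex_of_real (std_normal_density y) * iexp (u $ i * y) \<partial>lborel)"
      by (intro lborel_integral_prod_cart integral_std_normal_iexp)
    also have "\<dots> = (\<Prod>i\<in>UNIV. of_real (exp (- ((u $ i)\<^sup>2) / 2)))"
      by (simp only: integral_std_normal_iexp(2))
    also have "\<dots> = of_real (exp (\<Sum>i\<in>UNIV. - ((u $ i)\<^sup>2) / 2))"
      by (simp only: of_real_prod[symmetric] exp_sum finite)
    also have "(\<Sum>i\<in>UNIV. - ((u $ i)\<^sup>2) / 2) = - (u \<bullet> u) / 2"
      by (simp add: inner_vec_def power2_eq_square sum_divide_distrib sum_negf)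
    also have "u \<bullet> u = t \<bullet> (C *v t)"
      unfolding u_def AA[symmetric] by (simp add: matrix_vector_mul_assoc[symmetric] dot_lmul_matrix transpose_matrix_vector)
    finally show ?thesis .
  qed
  show "sets (centered_gaussian C) = sets borel" by (simp add: centered_gaussian_def)
  show "(\<integral>x. iexp (t \<bullet> x) \<partial>centered_gaussian C) = exp (- (t \<bullet> (C *v t)) / 2)"
    unfolding cg by (subst integral_density) (use D0 main[of t] in auto)
  have c1: "(\<integral>x. complex_of_real (D x) \<partial>lborel) = 1"
    using main[of 0] by (simp add: scaleR_conv_of_real)
  \<comment> \<open>The Bochner integral of a non-integrable function is 0 by convention, so the
    value 1 at frequency 0 yields integrability together with total mass 1.\<close>
  then have "integrable lborel (\<lambda>x. complex_of_real (D x))" using not_integrable_integral_eq by fastforce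
  then have i: "integrable lborel D" by (simp add: complex_of_real_integrable_eq)
  have "(\<integral>x. D x \<partial>lborel) = 1" using c1 by (simp add: integral_complex_of_real)
  then have "(\<integral>\<^sup>+x. ennreal (D x) \<partial>lborel) = 1" using nn_integral_eq_integral[OF i] D0 by simp
  then show "prob_space (centered_gaussian C)"
    unfolding cg by (intro prob_spaceI) (simp add: emeasure_density)
qed

subsection \<open>Homogeneous sums\<close>

text \<open>Collects all orderings of \<open>S\<close>. For a symmetric kernel and a d-element
  \<open>S\<close> within \<open>{1..n}\<close> it is \<open>d!\<close> times the common value of
  \<open>f\<close> on them.\<close>

definition subset_coeff :: "nat \<Rightarrow> nat \<Rightarrow> ((nat \<Rightarrow> nat) \<Rightarrow> real) \<Rightarrow> nat set \<Rightarrow> real" where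
  "subset_coeff d n f S = (\<Sum>i\<in>{i \<in> {1..d} \<rightarrow>\<^sub>E {1..n}. inj_on i {1..d} \<and> i ` {1..d} = S}. f i)"

lemma homogeneous_subset_coeff: "homogeneous d (subset_coeff d n f)"
  unfolding homogeneous_def
proof (intro allI impI)
  fix S assume "subset_coeff d n f S \<noteq> 0"
  then obtain i where "inj_on i {1..d}" "i ` {1..d} = S"
    unfolding subset_coeff_def by (metis (mono_tags, lifting) mem_Collect_eq sum.not_neutral_contains_not_neutral)
  then show "card S = d" using card_image[of i "{1..d}"] by simp
qed

text \<open>Vanishing on diagonals leaves the injective multi-indices; grouping them by image turns
  each monomial into a product over a set.\<close>

lemma hom_sum_eq_multilinear:
  assumes diag: "\<And>i. i \<in> {1..d} \<rightarrow>\<^sub>E {1..n} \<Longrightarrow> \<exists>j\<in>{1..d}. \<exists>k\<in>{1..d}. j \<noteq> k \<and> i j = i k \<Longrightarrow> f i = 0"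
  shows "hom_sum d n X f \<omega> = multilinear {1..n} (subset_coeff d n f) (\<lambda>k. X k \<omega>)"
proof -
  let ?E = "{1..d} \<rightarrow>\<^sub>E {1..n}"
  let ?J = "{i \<in> ?E. inj_on i {1..d}}"
  have fin: "finite ?E" by (intro finite_PiE) auto
  have "hom_sum d n X f \<omega> = (\<Sum>i\<in>?J. f i * (\<Prod>k=1..d. X (i k) \<omega>))"
    unfolding hom_sum_def
  proof (rule sum.mono_neutral_right[OF fin])
    show "\<forall>i\<in>?E - ?J. f i * (\<Prod>k=1..d. X (i k) \<omega>) = 0"
    proof
      fix i assume "i \<in> ?E - ?J"
      then have "f i = 0" by (intro diag) (auto simp: inj_on_def)
      then show "f i * (\<Prod>k=1..d. X (i k) \<omega>) = 0" by simp
    qed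
  qed auto
  also have "\<dots> = (\<Sum>S\<in>Pow {1..n}. \<Sum>i\<in>{i\<in>?J. i ` {1..d} = S}. f i * (\<Prod>k=1..d. X (i k) \<omega>))"
    using fin by (intro sum.group[symmetric]) auto
  also have "\<dots> = (\<Sum>S\<in>Pow {1..n}. subset_coeff d n f S * (\<Prod>k\<in>S. X k \<omega>))"
  proof (intro sum.cong refl)
    fix S assume "S \<in> Pow {1..n}"
    have "(\<Sum>i\<in>{i\<in>?J. i ` {1..d} = S}. f i * (\<Prod>k=1..d. X (i k) \<omega>)) = (\<Sum>i\<in>{i\<in>?J. i ` {1..d} = S}. f i * (\<Prod>k\<in>S. X k \<omega>))"
    proof (intro sum.cong refl)
      fix i assume "i \<in> {i\<in>?J. i ` {1..d} = S}"
      then have "inj_on i {1..d}" "S = i ` {1..d}" by auto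
      then show "f i * (\<Prod>k=1..d. X (i k) \<omega>) = f i * (\<Prod>k\<in>S. X k \<omega>)"
        by (simp add: prod.reindex)
    qed
    also have "\<dots> = subset_coeff d n f S * (\<Prod>k\<in>S. X k \<omega>)"
      by (simp add: subset_coeff_def sum_distrib_right conj_assoc)
    finally show "(\<Sum>i\<in>{i\<in>?J. i ` {1..d} = S}. f i * (\<Prod>k=1..d. X (i k) \<omega>)) = subset_coeff d n f S * (\<Prod>k\<in>S. X k \<omega>)" .
  qed
  finally show ?thesis by (simp add: multilinear_def)
qed

lemma multilinear_linear_combination:
  "multilinear V (\<lambda>S. \<Sum>j\<in>J. t j * c j S) x = (\<Sum>j\<in>J. t j * multilinear V (c j) x)"
proof -
  have "multilinear V (\<lambda>S. \<Sum>j\<in>J. t j * c j S) x = (\<Sum>S\<in>Pow V. \<Sum>j\<in>J. t j * (c j S * (\<Prod>k\<in>S. x k)))"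
    by (simp only: multilinear_def sum_distrib_right mult.assoc)
  also have "\<dots> = (\<Sum>j\<in>J. \<Sum>S\<in>Pow V. t j * (c j S * (\<Prod>k\<in>S. x k)))" by (rule sum.swap)
  finally show ?thesis by (simp only: multilinear_def sum_distrib_left)
qed

lemma homogeneous_linear_combination:
  assumes "\<And>j. j \<in> J \<Longrightarrow> homogeneous d (c j)"
  shows "homogeneous d (\<lambda>S. \<Sum>j\<in>J. t j * c j S)"
  unfolding homogeneous_def
proof (intro allI impI)
  fix S assume "(\<Sum>j\<in>J. t j * c j S) \<noteq> 0"
  then obtain j where "j \<in> J" "t j * c j S \<noteq> 0"
    by (rule sum.not_neutral_contains_not_neutral)
  then show "card S = d" using assms by (auto simp: homogeneous_def)
qed

lemma char_normal_density:
  assumes "\<sigma> > 0"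
  shows "char (density lborel (normal_density 0 \<sigma>)) t = exp (- (\<sigma> * t)\<^sup>2 / 2)"
proof -
  have "char (density lborel (normal_density 0 \<sigma>)) t = (\<integral>y. normal_density 0 \<sigma> y *\<^sub>R iexp (t * y) \<partial>lborel)"
    unfolding char_def by (subst integral_density) (auto simp: normal_density_nonneg)
  also have "\<dots> = \<bar>\<sigma>\<bar> *\<^sub>R (\<integral>z. normal_density 0 \<sigma> (0 + \<sigma> * z) *\<^sub>R iexp (t * (0 + \<sigma> * z)) \<partial>lborel)"
    by (rule lborel_integral_real_affine) (use assms in simp)
  also have "\<dots> = (\<integral>z. complex_of_real (std_normal_density z) * iexp ((\<sigma> * t) * z) \<partial>lborel)"
  proof -
    have n: "\<bar>\<sigma>\<bar> * normal_density 0 \<sigma> (0 + \<sigma> * z) = std_normal_density z" for z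
      using assms by (simp add: normal_density_def power_mult_distrib real_sqrt_mult)
    have e: "t * (0 + \<sigma> * z) = (\<sigma> * t) * z" for z by simp
    have "\<bar>\<sigma>\<bar> *\<^sub>R (normal_density 0 \<sigma> (0 + \<sigma> * z) *\<^sub>R iexp (t * (0 + \<sigma> * z))) = complex_of_real (std_normal_density z) * iexp ((\<sigma> * t) * z)" for z
      unfolding e scaleR_scaleR n by (rule scaleR_conv_of_real)
    then show ?thesis by (simp only: integral_scaleR_right[symmetric])
  qed
  also have "\<dots> = exp (- (\<sigma> * t)\<^sup>2 / 2)" by (rule integral_std_normal_iexp(2))
  finally show ?thesis .
qed

text \<open>Truncation at \<open>L ^ 4\<close> gives a bounded continuous function, whose integrals
  converge to a limit at most the normal fourth moment. Beyond \<open>L\<close> the fourth power is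
  at most the q-th power divided by \<open>L powr (q - 4)\<close>, and the q-th moments are
  bounded.\<close>

lemma weak_conv_m_normal_fourth_moment:
  fixes Y :: "nat \<Rightarrow> 'a \<Rightarrow> real"
  assumes "prob_space M" and Y [measurable]: "\<And>n. Y n \<in> borel_measurable M"
    and \<sigma>: "\<sigma> > 0" and wc: "weak_conv_m (\<lambda>n. distr M borel (Y n)) (density lborel (normal_density 0 \<sigma>))"
    and q: "q > 4"
    and bound: "\<forall>\<^sub>F n in sequentially. integrable M (\<lambda>\<omega>. \<bar>Y n \<omega>\<bar> powr q) \<and> integrable M (\<lambda>\<omega>. Y n \<omega> ^ 4) \<and> (\<integral>\<omega>. \<bar>Y n \<omega>\<bar> powr q \<partial>M) \<le> B"
    and \<epsilon>: "\<epsilon> > 0"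
  shows "\<forall>\<^sub>F n in sequentially. (\<integral>\<omega>. Y n \<omega> ^ 4 \<partial>M) < 3 * \<sigma> ^ 4 + \<epsilon>"
proof -
  interpret prob_space M by fact
  define B' where "B' = max B 1"
  \<comment> \<open>Chosen so that \<open>L powr (q - 4) = 2 * B' / \<epsilon>\<close>, which makes
    the tail at most \<open>\<epsilon> / 2\<close>.\<close>
  define L where "L = (2 * B' / \<epsilon>) powr (1 / (q - 4))"
  have B': "B' > 0" "B \<le> B'" by (auto simp: B'_def)
  have L: "L > 0" "L powr (q - 4) = 2 * B' / \<epsilon>"
    using B' \<epsilon> q by (simp_all add: L_def powr_powr)
  define h where "h y = min (y ^ 4) (L ^ 4)" for y :: real
  have h: "isCont h y" "norm (h y) \<le> L ^ 4" for y
  proof -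
    show "isCont h y" unfolding h_def[abs_def] by (intro continuous_intros)
    show "norm (h y) \<le> L ^ 4" using L by (simp add: h_def min_def)
  qed
  have hm [measurable]: "h \<in> borel_measurable borel" unfolding h_def by measurable
  have N: "real_distribution (density lborel (normal_density 0 \<sigma>))"
    using prob_space_normal_density[OF \<sigma>] by (auto simp: real_distribution_def real_distribution_axioms_def)
  interpret N: real_distribution "density lborel (normal_density 0 \<sigma>)" by fact
  have RD: "real_distribution (distr M borel (Y n))" for n by (rule real_distribution_distr) simp
  have "(\<lambda>n. integral\<^sup>L (distr M borel (Y n)) h) \<longlonglongrightarrow> integral\<^sup>L (density lborel (normal_density 0 \<sigma>)) h"
    by (rule weak_conv_imp_integral_bdd_continuous_conv[OF RD N wc h])
  then have lim: "(\<lambda>n. \<integral>\<omega>. h (Y n \<omega>) \<partial>M) \<longlonglongrightarrow> integral\<^sup>L (density lborel (normal_density 0 \<sigma>)) h"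
    by (simp add: integral_distr)
  have "integral\<^sup>L (density lborel (normal_density 0 \<sigma>)) h \<le> 3 * \<sigma> ^ 4"
  proof -
    have m: "has_bochner_integral lborel (\<lambda>x. normal_density 0 \<sigma> x * x ^ 4) (3 * \<sigma> ^ 4)"
      using normal_moment_even[OF \<sigma>, of 0 2] \<sigma> by (simp add: fact_numeral power_divide power_mult[symmetric] field_simps)
    have "integral\<^sup>L (density lborel (normal_density 0 \<sigma>)) h = (\<integral>x. normal_density 0 \<sigma> x * h x \<partial>lborel)"
      by (subst integral_density) (auto simp: normal_density_nonneg)
    also have "\<dots> \<le> (\<integral>x. normal_density 0 \<sigma> x * x ^ 4 \<partial>lborel)"
    proof (rule integral_mono)
      show i: "integrable lborel (\<lambda>x. normal_density 0 \<sigma> x * x ^ 4)" using m by (rule integrable.intros)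
      show "integrable lborel (\<lambda>x. normal_density 0 \<sigma> x * h x)"
        by (rule Bochner_Integration.integrable_bound[OF i])
           (use L in \<open>auto simp: h_def normal_density_nonneg abs_mult intro!: mult_left_mono\<close>)
    qed (auto simp: h_def normal_density_nonneg intro!: mult_left_mono)
    also have "\<dots> = 3 * \<sigma> ^ 4" using m by (rule has_bochner_integral_integral_eq)
    finally show ?thesis .
  qed
  then have "\<forall>\<^sub>F n in sequentially. (\<integral>\<omega>. h (Y n \<omega>) \<partial>M) < 3 * \<sigma> ^ 4 + \<epsilon> / 2"
    using \<epsilon> by (intro order_tendstoD[OF lim]) linarith
  then show ?thesis using bound
  proof eventually_elim
    case (elim n)
    have le: "y ^ 4 \<le> h y + \<bar>y\<bar> powr q / (2 * B' / \<epsilon>)" for y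
    proof (cases "\<bar>y\<bar> \<le> L")
      case True
      then have "\<bar>y\<bar> ^ 4 \<le> L ^ 4" by (intro power_mono) auto
      then have "h y = y ^ 4" by (simp add: h_def)
      then show ?thesis using B' \<epsilon> by simp
    next
      case False
      then have y: "\<bar>y\<bar> > 0" "L \<le> \<bar>y\<bar>" using L by auto
      have "y ^ 4 * (2 * B' / \<epsilon>) = \<bar>y\<bar> powr 4 * L powr (q - 4)"
        using y L(2) by (simp add: powr_numeral)
      also have "\<dots> \<le> \<bar>y\<bar> powr 4 * \<bar>y\<bar> powr (q - 4)"
        using y L q by (intro mult_left_mono powr_mono2) auto
      also have "\<dots> = \<bar>y\<bar> powr q" by (subst powr_add[symmetric]) simp
      finally have "y ^ 4 \<le> \<bar>y\<bar> powr q / (2 * B' / \<epsilon>)"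
        using B' \<epsilon> by (subst pos_le_divide_eq) auto
      moreover have "h y \<ge> 0" using L by (simp add: h_def)
      ultimately show ?thesis by linarith
    qed
    have hi: "integrable M (\<lambda>\<omega>. h (Y n \<omega>))" by (rule integrable_const_bound[of _ "L ^ 4"]) (use h in auto)
    have "(\<integral>\<omega>. Y n \<omega> ^ 4 \<partial>M) \<le> (\<integral>\<omega>. h (Y n \<omega>) + \<bar>Y n \<omega>\<bar> powr q / (2 * B' / \<epsilon>) \<partial>M)"
      using elim hi le by (intro integral_mono) auto
    also have "\<dots> = (\<integral>\<omega>. h (Y n \<omega>) \<partial>M) + (\<integral>\<omega>. \<bar>Y n \<omega>\<bar> powr q \<partial>M) / (2 * B' / \<epsilon>)"
      using elim hi by simp
    also have "(\<integral>\<omega>. \<bar>Y n \<omega>\<bar> powr q \<partial>M) / (2 * B' / \<epsilon>) \<le> B' / (2 * B' / \<epsilon>)"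
      using elim B' \<epsilon> by (intro divide_right_mono) auto
    also have "\<dots> = \<epsilon> / 2" using B' by simp
    finally show ?case using elim(1) by linarith
  qed
qed

section \<open>Asymptotics along a sequence of homogeneous sums\<close>

context indep_family4
begin

text \<open>The Cramer-Wold device: for fixed \<open>t\<close> the combination is one homogeneous
  sum with coefficients \<open>g n\<close>. Its variance is the quadratic form of the covariances,
  and its \<open>mid_norm\<close> tends to 0 with those of the components, so the bound for a single
  sum applies.\<close>

lemma char_fun_tendsto:
  fixes c :: "nat \<Rightarrow> 'm::finite \<Rightarrow> 'i set \<Rightarrow> real" and V :: "nat \<Rightarrow> 'i set" and C :: "real^'m^'m" and t :: "real^'m"
  assumes V: "\<And>n. finite (V n)" "\<And>n. V n \<subseteq> I" and c: "\<And>n j. homogeneous d (c n j)" and d: "d \<ge> 2" and \<kappa>: "\<kappa> \<ge> 3"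
    and int3: "\<And>k. k \<in> I \<Longrightarrow> integrable M (\<lambda>\<omega>. \<bar>X k \<omega>\<bar> powr 3)"
    and K: "\<And>k. k \<in> I \<Longrightarrow> expectation (\<lambda>\<omega>. \<bar>X k \<omega>\<bar> powr 3) \<le> K"
    and C: "\<And>i j. (\<lambda>n. expectation (\<lambda>\<omega>. W (V n) (c n j) \<omega> * W (V n) (c n i) \<omega>)) \<longlonglongrightarrow> C $ i $ j"
    and mid: "\<And>j. (\<lambda>n. mid_norm (V n) d (c n j)) \<longlonglongrightarrow> 0"
  shows "(\<lambda>n. \<integral>\<omega>. iexp (\<Sum>j\<in>UNIV. t $ j * W (V n) (c n j) \<omega>) \<partial>M) \<longlonglongrightarrow> exp (- (t \<bullet> (C *v t)) / 2)"
proof -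
  obtain \<Lambda> where \<Lambda>: "\<Lambda> \<ge> 1"
    and h3i: "\<And>V c. finite V \<Longrightarrow> V \<subseteq> I \<Longrightarrow> integrable M (\<lambda>\<omega>. \<bar>W V c \<omega>\<bar> powr 3)"
    and h3: "\<And>V c. finite V \<Longrightarrow> V \<subseteq> I \<Longrightarrow> expectation (\<lambda>\<omega>. \<bar>W V c \<omega>\<bar> powr 3) \<le>
      (\<Sum>S\<in>Pow V. \<Lambda> ^ card S * (c S)\<^sup>2) powr (3 / 2)"
    using hypercontractivity[of 3 K, OF _ int3 K int_simps(1) mean int_simps(2) var] by auto
  define g where "g n S = (\<Sum>j\<in>UNIV. t $ j * c n j S)" for n S
  have gh: "homogeneous d (g n)" for n
    unfolding g_def by (rule homogeneous_linear_combination) (rule c)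
  have gW: "W (V n) (g n) \<omega> = (\<Sum>j\<in>UNIV. t $ j * W (V n) (c n j) \<omega>)" for n \<omega>
    unfolding g_def by (rule multilinear_linear_combination)
  define s where "s n = (\<Sum>S\<in>Pow (V n). (g n S)\<^sup>2)" for n
  define m where "m n = mid_norm (V n) d (g n)" for n
  have m_lim: "m \<longlonglongrightarrow> 0"
  proof (rule tendsto_sandwich)
    let ?u = "\<lambda>n. real (card ((UNIV :: 'm set) \<times> (UNIV :: 'm set))) * (\<Sum>j\<in>UNIV. \<Sum>i\<in>UNIV. (t $ j * t $ i)\<^sup>2 *
       ((mid_norm (V n) d (c n j) + mid_norm (V n) d (c n i)) / 2))"
    show "\<forall>\<^sub>F n in sequentially. 0 \<le> m n" by (simp add: m_def mid_norm_nonneg)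
    show "\<forall>\<^sub>F n in sequentially. m n \<le> ?u n"
      unfolding m_def g_def by (intro always_eventually allI mid_norm_linear_combination_le V)
    have "?u \<longlonglongrightarrow> real (card ((UNIV :: 'm set) \<times> (UNIV :: 'm set))) * (\<Sum>j\<in>UNIV. \<Sum>i\<in>UNIV. (t $ j * t $ i)\<^sup>2 * ((0 + 0) / 2))"
      by (intro tendsto_intros mid) simp
    then show "?u \<longlonglongrightarrow> 0" by simp
  qed simp
  have ii: "integrable M (\<lambda>\<omega>. W (V n) (c n j) \<omega> * W (V n) (c n i) \<omega>)" for n i j
  proof (rule Bochner_Integration.integrable_bound)
    show "integrable M (\<lambda>\<omega>. (W (V n) (c n j) \<omega>)\<^sup>2 + (W (V n) (c n i) \<omega>)\<^sup>2)"
      using multilinear_second_moment(1)[OF V] by simp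
    have mm: "W (V n) c' \<in> borel_measurable M" for c'
      by (rule multilinear_measurable) (use V in auto)
    show "(\<lambda>\<omega>. W (V n) (c n j) \<omega> * W (V n) (c n i) \<omega>) \<in> borel_measurable M"
      using mm by (intro borel_measurable_times)
    have "\<bar>x * y\<bar> \<le> x\<^sup>2 + y\<^sup>2" for x y :: real
    proof -
      have "0 \<le> \<bar>x\<bar> * \<bar>y\<bar>" by simp
      then show ?thesis
        using sum_squares_bound[of "\<bar>x\<bar>" "\<bar>y\<bar>"] unfolding abs_mult power2_abs by linarith
    qed
    then show "AE \<omega> in M. norm (W (V n) (c n j) \<omega> * W (V n) (c n i) \<omega>) \<le> norm ((W (V n) (c n j) \<omega>)\<^sup>2 + (W (V n) (c n i) \<omega>)\<^sup>2)"
      by (simp add: abs_of_nonneg)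
  qed
  have s_eq: "s n = (\<Sum>i\<in>UNIV. \<Sum>j\<in>UNIV. t $ i * t $ j * expectation (\<lambda>\<omega>. W (V n) (c n j) \<omega> * W (V n) (c n i) \<omega>))" for n
  proof -
    have "s n = expectation (\<lambda>\<omega>. (W (V n) (g n) \<omega>)\<^sup>2)"
      unfolding s_def by (rule multilinear_second_moment(2)[OF V, symmetric])
    also have "\<dots> = expectation (\<lambda>\<omega>. \<Sum>i\<in>UNIV. \<Sum>j\<in>UNIV. t $ i * t $ j * (W (V n) (c n j) \<omega> * W (V n) (c n i) \<omega>))"
      unfolding gW power2_eq_square sum_product by (simp add: ac_simps)
    also have "\<dots> = (\<Sum>i\<in>UNIV. \<Sum>j\<in>UNIV. t $ i * t $ j * expectation (\<lambda>\<omega>. W (V n) (c n j) \<omega> * W (V n) (c n i) \<omega>))"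
      using ii by (subst Bochner_Integration.integral_sum, simp)+ simp
    finally show ?thesis .
  qed
  have s_lim: "s \<longlonglongrightarrow> t \<bullet> (C *v t)"
  proof -
    have "s \<longlonglongrightarrow> (\<Sum>i\<in>UNIV. \<Sum>j\<in>UNIV. t $ i * t $ j * C $ i $ j)"
      unfolding s_eq[abs_def] by (intro tendsto_intros C)
    also have "(\<Sum>i\<in>UNIV. \<Sum>j\<in>UNIV. t $ i * t $ j * C $ i $ j) = t \<bullet> (C *v t)"
      by (simp add: inner_vec_def matrix_vector_mult_def sum_distrib_left ac_simps)
    finally show ?thesis .
  qed
  \<comment> \<open>The summand \<open>1 / (real n + 1)\<close> keeps \<open>\<eta> n\<close>
    positive even when \<open>m n\<close> is 0, as the Stein bound divides by
    \<open>\<eta>^2\<close>.\<close>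
  define \<eta> where "\<eta> n = root 4 (m n + 1 / (real n + 1))" for n
  have \<eta>0: "\<eta> n > 0" for n
    using mid_norm_nonneg[of "V n" d "g n"] by (auto simp: \<eta>_def m_def intro!: add_nonneg_pos)
  have \<eta>4: "mid_norm (V n) d (g n) \<le> \<eta> n ^ 4" for n
  proof -
    have "\<eta> n ^ 4 = m n + 1 / (real n + 1)"
      unfolding \<eta>_def using mid_norm_nonneg[of "V n" d "g n"] by (intro real_root_pow_pos2) (auto simp: m_def)
    then show ?thesis by (simp add: m_def)
  qed
  have "(\<lambda>n. 1 / (real n + 1)) \<longlonglongrightarrow> 0" by real_asymp
  then have "\<eta> \<longlonglongrightarrow> root 4 (0 + 0)"
    unfolding \<eta>_def[abs_def] by (intro tendsto_real_root tendsto_add m_lim)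
  then have \<eta>_lim: "\<eta> \<longlonglongrightarrow> 0" by simp
  let ?\<delta> = "\<lambda>n. (1 + (16 * (\<kappa> - 1)) ^ d) * (\<eta> n)\<^sup>2 + 2 * (1 + \<kappa>) * \<Lambda> ^ (2 * d) * s n * \<eta> n"
  have "?\<delta> \<longlonglongrightarrow> (1 + (16 * (\<kappa> - 1)) ^ d) * 0\<^sup>2 + 2 * (1 + \<kappa>) * \<Lambda> ^ (2 * d) * (t \<bullet> (C *v t)) * 0"
    by (intro tendsto_intros \<eta>_lim s_lim)
  then have \<delta>_lim: "?\<delta> \<longlonglongrightarrow> 0" by simp
  have "(\<lambda>n. (\<integral>\<omega>. iexp (W (V n) (g n) \<omega>) \<partial>M) - complex_of_real (exp (- s n / 2))) \<longlonglongrightarrow> 0"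
  proof (rule Lim_null_comparison[OF _ \<delta>_lim])
    show "\<forall>\<^sub>F n in sequentially. norm ((\<integral>\<omega>. iexp (W (V n) (g n) \<omega>) \<partial>M) - complex_of_real (exp (- s n / 2))) \<le> ?\<delta> n"
      unfolding s_def by (intro always_eventually allI char_fun_bound[OF V gh d \<kappa> \<Lambda> h3i h3 \<eta>0 \<eta>4])
  qed
  moreover have "(\<lambda>n. complex_of_real (exp (- s n / 2))) \<longlonglongrightarrow> of_real (exp (- (t \<bullet> (C *v t)) / 2))"
    by (intro tendsto_intros s_lim) simp
  ultimately have "(\<lambda>n. ((\<integral>\<omega>. iexp (W (V n) (g n) \<omega>) \<partial>M) - complex_of_real (exp (- s n / 2))) + complex_of_real (exp (- s n / 2))) \<longlonglongrightarrow> 0 + of_real (exp (- (t \<bullet> (C *v t)) / 2))"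
    by (rule tendsto_add)
  then show ?thesis by (simp add: gW)
qed

text \<open>The fourth moment is at least \<open>3 * (s n)^2 + mid_norm\<close> and, by weak
  convergence with bounded q-th moments, eventually below \<open>3 * \<sigma> ^ 4\<close> plus any
  margin. As \<open>s n\<close> tends to \<open>\<sigma>^2\<close>, nothing is left for
  \<open>mid_norm\<close>. For degree d the hypercontractive bound is
  \<open>(\<Lambda> ^ d * s n) powr (q / 2)\<close>, hence uniform in n.\<close>

lemma mid_norm_tendsto_0:
  fixes c :: "nat \<Rightarrow> 'i set \<Rightarrow> real" and V :: "nat \<Rightarrow> 'i set"
  assumes V: "\<And>n. finite (V n)" "\<And>n. V n \<subseteq> I" and c: "\<And>n. homogeneous d (c n)" and d: "d \<ge> 1" and \<kappa>: "\<kappa> \<ge> 3"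
    and q: "q > 4" and intq: "\<And>k. k \<in> I \<Longrightarrow> integrable M (\<lambda>\<omega>. \<bar>X k \<omega>\<bar> powr q)"
    and Kq: "\<And>k. k \<in> I \<Longrightarrow> expectation (\<lambda>\<omega>. \<bar>X k \<omega>\<bar> powr q) \<le> Kq"
    and \<sigma>: "\<sigma> > 0" and var_lim: "(\<lambda>n. expectation (\<lambda>\<omega>. (W (V n) (c n) \<omega>)\<^sup>2)) \<longlonglongrightarrow> \<sigma>\<^sup>2"
    and wc: "weak_conv_m (\<lambda>n. distr M borel (W (V n) (c n))) (density lborel (normal_density 0 \<sigma>))"
  shows "(\<lambda>n. mid_norm (V n) d (c n)) \<longlonglongrightarrow> 0"
proof -
  obtain \<Lambda> where \<Lambda>: "\<Lambda> \<ge> 1"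
    and hi: "\<And>V c. finite V \<Longrightarrow> V \<subseteq> I \<Longrightarrow> integrable M (\<lambda>\<omega>. \<bar>W V c \<omega>\<bar> powr q)"
    and h: "\<And>V c. finite V \<Longrightarrow> V \<subseteq> I \<Longrightarrow> expectation (\<lambda>\<omega>. \<bar>W V c \<omega>\<bar> powr q) \<le>
      (\<Sum>S\<in>Pow V. \<Lambda> ^ card S * (c S)\<^sup>2) powr (q / 2)"
    using hypercontractivity[of q Kq, OF _ intq Kq int_simps(1) mean int_simps(2) var] q by auto
  have mm: "W (V n) c' \<in> borel_measurable M" for n c'
    by (rule multilinear_measurable) (use V in auto)
  define s where "s n = (\<Sum>S\<in>Pow (V n). (c n S)\<^sup>2)" for n
  have s_lim: "s \<longlonglongrightarrow> \<sigma>\<^sup>2"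
    using var_lim by (simp add: multilinear_second_moment(2)[OF V] s_def[abs_def])
  have s0: "s n \<ge> 0" for n by (simp add: s_def sum_nonneg)
  have bound: "\<forall>\<^sub>F n in sequentially. integrable M (\<lambda>\<omega>. \<bar>W (V n) (c n) \<omega>\<bar> powr q) \<and> integrable M (\<lambda>\<omega>. W (V n) (c n) \<omega> ^ 4)
    \<and> expectation (\<lambda>\<omega>. \<bar>W (V n) (c n) \<omega>\<bar> powr q) \<le> (\<Lambda> ^ d * (\<sigma>\<^sup>2 + 1)) powr (q / 2)"
  proof -
    have "\<forall>\<^sub>F n in sequentially. s n < \<sigma>\<^sup>2 + 1" by (rule order_tendstoD[OF s_lim]) simp
    then show ?thesis
    proof eventually_elim
      case (elim n)
      have "(\<Sum>S\<in>Pow (V n). \<Lambda> ^ card S * (c n S)\<^sup>2) = \<Lambda> ^ d * s n"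
        unfolding s_def sum_distrib_left using c[of n] by (intro sum.cong) (auto simp: homogeneous_def)
      also have "\<dots> \<le> \<Lambda> ^ d * (\<sigma>\<^sup>2 + 1)" using elim \<Lambda> by (intro mult_left_mono) auto
      finally have le: "(\<Sum>S\<in>Pow (V n). \<Lambda> ^ card S * (c n S)\<^sup>2) \<le> \<Lambda> ^ d * (\<sigma>\<^sup>2 + 1)" .
      have "expectation (\<lambda>\<omega>. \<bar>W (V n) (c n) \<omega>\<bar> powr q) \<le> (\<Sum>S\<in>Pow (V n). \<Lambda> ^ card S * (c n S)\<^sup>2) powr (q / 2)"
        by (rule h[OF V])
      also have "\<dots> \<le> (\<Lambda> ^ d * (\<sigma>\<^sup>2 + 1)) powr (q / 2)"
        using le q \<Lambda> by (intro powr_mono2 sum_nonneg) auto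
      finally show ?case using hi[OF V] multilinear_fourth_moment(1)[OF V c d \<kappa>] by blast
    qed
  qed
  show ?thesis
  proof (rule tendstoI)
    fix e :: real assume e: "e > 0"
    have "\<forall>\<^sub>F n in sequentially. expectation (\<lambda>\<omega>. W (V n) (c n) \<omega> ^ 4) < 3 * \<sigma> ^ 4 + e / 2"
      by (rule weak_conv_m_normal_fourth_moment[OF prob_space_axioms mm \<sigma> wc q bound]) (use e in simp)
    moreover have "\<forall>\<^sub>F n in sequentially. 3 * \<sigma> ^ 4 - e / 2 < 3 * (s n)\<^sup>2"
    proof (rule order_tendstoD)
      have "(\<lambda>n. 3 * (s n)\<^sup>2) \<longlonglongrightarrow> 3 * (\<sigma>\<^sup>2)\<^sup>2" by (intro tendsto_intros s_lim)
      then show "(\<lambda>n. 3 * (s n)\<^sup>2) \<longlonglongrightarrow> 3 * \<sigma> ^ 4" by (simp flip: power_mult)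
    qed (use e in simp)
    ultimately show "\<forall>\<^sub>F n in sequentially. dist (mid_norm (V n) d (c n)) 0 < e"
    proof eventually_elim
      case (elim n)
      have "3 * (s n)\<^sup>2 + mid_norm (V n) d (c n) \<le> expectation (\<lambda>\<omega>. W (V n) (c n) \<omega> ^ 4)"
        unfolding s_def by (rule multilinear_fourth_moment(2)[OF V c d \<kappa>])
      then have "mid_norm (V n) d (c n) < e" using elim by linarith
      then show ?case using mid_norm_nonneg[of "V n" d "c n"] by simp
    qed
  qed
qed

end

section \<open>Tightness and characteristic functions of vector-valued laws\<close>

lemma borel_measurable_vec_lambda:
  fixes F :: "'m::finite \<Rightarrow> 'a \<Rightarrow> real"
  assumes "\<And>j. F j \<in> borel_measurable M"
  shows "(\<lambda>\<omega>. \<chi> j. F j \<omega>) \<in> borel_measurable M"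
  by (subst borel_measurable_euclidean_space) (use assms in \<open>auto simp: Basis_vec_def inner_axis\<close>)

lemma tight_if_second_moment_bounded:
  fixes F :: "nat \<Rightarrow> 'm::finite \<Rightarrow> 'a \<Rightarrow> real"
  assumes "prob_space M" and F [measurable]: "\<And>n j. F n j \<in> borel_measurable M"
    and bound: "\<And>j. \<forall>\<^sub>F n in sequentially. integrable M (\<lambda>\<omega>. (F n j \<omega>)\<^sup>2) \<and> (\<integral>\<omega>. (F n j \<omega>)\<^sup>2 \<partial>M) \<le> B j"
    and \<epsilon>: "\<epsilon> > 0"
  shows "\<exists>L. \<forall>\<^sub>F n in sequentially. measure (distr M borel (\<lambda>\<omega>. \<chi> j. F n j \<omega>)) {x. \<exists>j. L < \<bar>x $ j\<bar>} \<le> \<epsilon>"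
proof -
  interpret prob_space M by fact
  define b where "b = (\<Sum>j\<in>UNIV. \<bar>B j\<bar>)"
  \<comment> \<open>Chebyshev in each coordinate bounds the exceedance probability by
    \<open>b / L^2\<close>, which is at most \<open>\<epsilon>\<close>; the added 1 keeps
    \<open>L\<close> positive when \<open>b = 0\<close>.\<close>
  define L where "L = sqrt ((b + 1) / \<epsilon>)"
  have b: "b \<ge> 0" by (simp add: b_def sum_nonneg)
  have L: "L > 0" "L\<^sup>2 = (b + 1) / \<epsilon>" using b \<epsilon> by (simp_all add: L_def)
  have "\<forall>\<^sub>F n in sequentially. \<forall>j. integrable M (\<lambda>\<omega>. (F n j \<omega>)\<^sup>2) \<and> (\<integral>\<omega>. (F n j \<omega>)\<^sup>2 \<partial>M) \<le> B j"
    using bound by (rule eventually_all_finite)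
  then have "\<forall>\<^sub>F n in sequentially. measure (distr M borel (\<lambda>\<omega>. \<chi> j. F n j \<omega>)) {x. \<exists>j. L < \<bar>x $ j\<bar>} \<le> \<epsilon>"
  proof eventually_elim
    case (elim n)
    let ?A = "\<lambda>j. {\<omega> \<in> space M. L \<le> \<bar>F n j \<omega>\<bar>}"
    have "measure (distr M borel (\<lambda>\<omega>. \<chi> j. F n j \<omega>)) {x. \<exists>j. L < \<bar>x $ j\<bar>} =
      measure M ((\<lambda>\<omega>. \<chi> j. F n j \<omega>) -` {x. \<exists>j. L < \<bar>x $ j\<bar>} \<inter> space M)"
      by (intro measure_distr borel_measurable_vec_lambda F exceedance_borel)
    also have "\<dots> \<le> measure M (\<Union>j. ?A j)"
      by (intro finite_measure_mono) (auto intro: less_imp_le)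
    also have "\<dots> \<le> (\<Sum>j\<in>UNIV. measure M (?A j))"
      by (intro finite_measure_subadditive_finite) auto
    also have "\<dots> \<le> (\<Sum>j\<in>UNIV. \<bar>B j\<bar> / L\<^sup>2)"
    proof (intro sum_mono)
      fix j
      have "measure M (?A j) \<le> (\<integral>\<omega>. (F n j \<omega>)\<^sup>2 \<partial>M) / L\<^sup>2"
        using elim L(1) by (intro second_moment_method) auto
      also have "\<dots> \<le> \<bar>B j\<bar> / L\<^sup>2"
        using elim[rule_format, of j] by (intro divide_right_mono) auto
      finally show "measure M (?A j) \<le> \<bar>B j\<bar> / L\<^sup>2" .
    qed
    also have "\<dots> = b * \<epsilon> / (b + 1)" using b by (simp add: b_def L sum_divide_distrib[symmetric] sum_distrib_right[symmetric])
    also have "\<dots> \<le> \<epsilon>" using b \<epsilon> by (simp add: divide_le_eq algebra_simps)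
    finally show ?case .
  qed
  then show ?thesis by blast
qed

lemma weak_conv_bc_char:
  fixes \<mu> :: "nat \<Rightarrow> (real^'m) measure"
  assumes wc: "weak_conv_bc \<mu> \<nu>" and \<mu>: "\<And>n. prob_space (\<mu> n)" "\<And>n. sets (\<mu> n) = sets borel"
    and \<nu>: "prob_space \<nu>" "sets \<nu> = sets borel"
  shows "(\<lambda>n. \<integral>x. iexp (t \<bullet> x) \<partial>\<mu> n) \<longlonglongrightarrow> (\<integral>x. iexp (t \<bullet> x) \<partial>\<nu>)"
proof -
  have c: "(\<lambda>n. \<integral>x. cos (t \<bullet> x) \<partial>\<mu> n) \<longlonglongrightarrow> (\<integral>x. cos (t \<bullet> x) \<partial>\<nu>)"
    and s: "(\<lambda>n. \<integral>x. sin (t \<bullet> x) \<partial>\<mu> n) \<longlonglongrightarrow> (\<integral>x. sin (t \<bullet> x) \<partial>\<nu>)"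
  proof -
    have "continuous_on UNIV (\<lambda>x. cos (t \<bullet> x)) \<and> bounded (range (\<lambda>x. cos (t \<bullet> x)))"
      "continuous_on UNIV (\<lambda>x. sin (t \<bullet> x)) \<and> bounded (range (\<lambda>x. sin (t \<bullet> x)))"
      by (auto intro!: continuous_intros boundedI[of _ 1])
    then show "(\<lambda>n. \<integral>x. cos (t \<bullet> x) \<partial>\<mu> n) \<longlonglongrightarrow> (\<integral>x. cos (t \<bullet> x) \<partial>\<nu>)"
      "(\<lambda>n. \<integral>x. sin (t \<bullet> x) \<partial>\<mu> n) \<longlonglongrightarrow> (\<integral>x. sin (t \<bullet> x) \<partial>\<nu>)"
      using wc unfolding weak_conv_bc_def by blast+
  qed
  have re: "Re (iexp y) = cos y" "Im (iexp y) = sin y" for y by (simp_all add: Re_exp Im_exp)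
  have eq: "(\<integral>x. iexp (t \<bullet> x) \<partial>\<rho>) = Complex (\<integral>x. cos (t \<bullet> x) \<partial>\<rho>) (\<integral>x. sin (t \<bullet> x) \<partial>\<rho>)"
    if "prob_space \<rho>" "sets \<rho> = sets borel" for \<rho>
    using integral_Re[OF integrable_iexp_inner[OF that, of t]] integral_Im[OF integrable_iexp_inner[OF that, of t]]
    by (simp only: complex_eq_iff complex.sel re)
  show ?thesis unfolding eq[OF \<mu>] eq[OF \<nu>] by (intro tendsto_Complex c s)
qed

theorem theorem3p3:
  fixes d :: nat
    and N :: "'b measure" and Z :: "'b \<Rightarrow> real"
    and M :: "'a measure" and X :: "nat \<Rightarrow> 'a \<Rightarrow> real"
    and f :: "nat \<Rightarrow> 'm::finite \<Rightarrow> (nat \<Rightarrow> nat) \<Rightarrow> real"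
    and C :: "real^'m^'m"
  assumes "d \<ge> 2"
    and "prob_space N" and "Z \<in> borel_measurable N"
    and "integral\<^sup>L N Z = 0"
    and "integral\<^sup>L N (\<lambda>\<omega>. (Z \<omega>)^2) = 1"
    and "integral\<^sup>L N (\<lambda>\<omega>. (Z \<omega>)^3) = 0"
    and "\<exists>\<epsilon>>0. integrable N (\<lambda>\<omega>. \<bar>Z \<omega>\<bar> powr (4 + \<epsilon>))"
    and "integral\<^sup>L N (\<lambda>\<omega>. (Z \<omega>)^4) \<ge> 3"
    and "prob_space M"
    and "prob_space.indep_vars M (\<lambda>_. borel) X {1..}"
    and "\<forall>i\<ge>1. distr M borel (X i) = distr N borel Z"
    and "\<forall>j. \<forall>n\<ge>d. admissible_kernel d n (f n j)"
    and "sym_pos_def C"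
    and "\<forall>i j. (\<lambda>n. integral\<^sup>L M (\<lambda>\<omega>. hom_sum d n X (f n j) \<omega> * hom_sum d n X (f n i) \<omega>))
                 \<longlonglongrightarrow> C $ i $ j"
  shows "(\<forall>j. weak_conv_m (\<lambda>n. distr M borel (hom_sum d n X (f n j)))
                 (density lborel (normal_density 0 (sqrt (C $ j $ j)))))
     \<longleftrightarrow> weak_conv_bc (\<lambda>n. distr M borel (\<lambda>\<omega>. \<chi> j. hom_sum d n X (f n j) \<omega>))
           (centered_gaussian C)"
proof -
  interpret M: prob_space M by fact
  interpret N: prob_space N by fact
  note Z [measurable] = \<open>Z \<in> borel_measurable N\<close>
  obtain \<epsilon> where \<epsilon>: "\<epsilon> > 0" and Zq: "integrable N (\<lambda>\<omega>. \<bar>Z \<omega>\<bar> powr (4 + \<epsilon>))"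
    using assms(7) by blast
  define q where "q = 4 + \<epsilon>"
  define \<kappa> where "\<kappa> = integral\<^sup>L N (\<lambda>\<omega>. (Z \<omega>)^4)"
  have \<kappa>: "\<kappa> \<ge> 3" using assms(8) by (simp add: \<kappa>_def)
  have Xm: "X k \<in> borel_measurable M" if "k \<in> {1..}" for k
    using assms(10) that by (auto simp: M.indep_vars_def)
  have tr: "integrable M (\<lambda>\<omega>. h (X k \<omega>)) \<longleftrightarrow> integrable N (\<lambda>\<omega>. h (Z \<omega>))"
    "(\<integral>\<omega>. h (X k \<omega>) \<partial>M) = (\<integral>\<omega>. h (Z \<omega>) \<partial>N)"
    if "k \<in> {1..}" "h \<in> borel_measurable borel" for h :: "real \<Rightarrow> real" and k
  proof -
    have D: "distr M borel (X k) = distr N borel Z" using assms(11) that by simp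
    show "integrable M (\<lambda>\<omega>. h (X k \<omega>)) \<longleftrightarrow> integrable N (\<lambda>\<omega>. h (Z \<omega>))"
      using integrable_distr_eq[OF Xm[OF that(1)] that(2)] integrable_distr_eq[OF Z that(2)] D by simp
    show "(\<integral>\<omega>. h (X k \<omega>) \<partial>M) = (\<integral>\<omega>. h (Z \<omega>) \<partial>N)"
      using integral_distr[OF Xm[OF that(1)] that(2)] integral_distr[OF Z that(2)] D by simp
  qed
  have Zp: "integrable N (\<lambda>\<omega>. \<bar>Z \<omega>\<bar> powr r)" if "0 \<le> r" "r \<le> q" for r
  proof (rule Bochner_Integration.integrable_bound)
    show "integrable N (\<lambda>\<omega>. 1 + \<bar>Z \<omega>\<bar> powr q)" using Zq by (simp add: q_def)
    have "\<bar>y\<bar> powr r \<le> 1 + \<bar>y\<bar> powr q" for y :: real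
    proof (cases "\<bar>y\<bar> \<le> 1")
      case True
      then have "\<bar>y\<bar> powr r \<le> 1 powr r" using that by (intro powr_mono2) auto
      then show ?thesis by (simp add: add_increasing2)
    next
      case False
      then have "\<bar>y\<bar> powr r \<le> \<bar>y\<bar> powr q" using that by (intro powr_mono) auto
      then show ?thesis by simp
    qed
    then show "AE \<omega> in N. norm (\<bar>Z \<omega>\<bar> powr r) \<le> norm (1 + \<bar>Z \<omega>\<bar> powr q)" by simp
  qed simp
  have Z4: "integrable N (\<lambda>\<omega>. (Z \<omega>) ^ 4)"
    by (rule Bochner_Integration.integrable_bound[OF Zp[of 4]]) (use \<epsilon> in \<open>auto simp: q_def\<close>)
  interpret indep_family4 M X "{1..}" \<kappa>
  proof
    show "M.indep_vars (\<lambda>_. borel) X {1..}" by fact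
    fix k :: nat assume k: "k \<in> {1..}"
    show "integrable M (\<lambda>\<omega>. X k \<omega> ^ 4)" using tr(1)[OF k, of "\<lambda>x. x ^ 4"] Z4 by simp
    show "M.expectation (X k) = 0" using tr(2)[OF k, of "\<lambda>x. x"] assms(4) by simp
    show "M.expectation (\<lambda>\<omega>. (X k \<omega>)\<^sup>2) = 1" using tr(2)[OF k, of "\<lambda>x. x\<^sup>2"] assms(5) by simp
    show "M.expectation (\<lambda>\<omega>. X k \<omega> ^ 3) = 0" using tr(2)[OF k, of "\<lambda>x. x ^ 3"] assms(6) by simp
    show "M.expectation (\<lambda>\<omega>. X k \<omega> ^ 4) = \<kappa>" using tr(2)[OF k, of "\<lambda>x. x ^ 4"] by (simp add: \<kappa>_def)
  qed
  have Xp: "integrable M (\<lambda>\<omega>. \<bar>X k \<omega>\<bar> powr r)" "M.expectation (\<lambda>\<omega>. \<bar>X k \<omega>\<bar> powr r) \<le> (\<integral>\<omega>. \<bar>Z \<omega>\<bar> powr r \<partial>N)"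
    if "k \<in> {1..}" "0 \<le> r" "r \<le> q" for k r
    using tr[OF that(1), of "\<lambda>x. \<bar>x\<bar> powr r"] Zp[OF that(2,3)] by simp_all
  define V where "V n = {1..n}" for n :: nat
  have V: "finite (V n)" "V n \<subseteq> {1..}" for n by (auto simp: V_def)
  define c where "c n j = subset_coeff d n (f n j)" for n j
  have ch: "homogeneous d (c n j)" for n j unfolding c_def by (rule homogeneous_subset_coeff)
  define Q where "Q n j = hom_sum d n X (f n j)" for n j
  \<comment> \<open>For \<open>n < d\<close> the kernels are arbitrary and may charge diagonals. The
    multilinear form is therefore available only from \<open>d\<close> on, and every limit is
    transferred along eventual equality.\<close>
  have QW: "Q n j \<omega> = W (V n) (c n j) \<omega>" if "d \<le> n" for n j \<omega>
    unfolding Q_def V_def c_def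
    by (rule hom_sum_eq_multilinear) (use assms(12) that in \<open>auto simp: admissible_kernel_def\<close>)
  have QW_ev: "\<forall>\<^sub>F n in sequentially. \<forall>j \<omega>. Q n j \<omega> = W (V n) (c n j) \<omega>"
    using eventually_ge_at_top[of d] by eventually_elim (simp add: QW)
  have Qm [measurable]: "Q n j \<in> borel_measurable M" for n j
  proof -
    have "(\<lambda>\<omega>. f n j i * (\<Prod>k=1..d. X (i k) \<omega>)) \<in> borel_measurable M" if "i \<in> {1..d} \<rightarrow>\<^sub>E {1..n}" for i
      using that by (intro borel_measurable_times borel_measurable_prod borel_measurable_const X_measurable) (auto simp: PiE_iff)
    then show ?thesis unfolding Q_def hom_sum_def[abs_def] by (rule borel_measurable_sum)
  qed
  have cov: "(\<lambda>n. M.expectation (\<lambda>\<omega>. W (V n) (c n j) \<omega> * W (V n) (c n i) \<omega>)) \<longlonglongrightarrow> C $ i $ j" for i j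
  proof (rule Lim_transform_eventually)
    show "(\<lambda>n. M.expectation (\<lambda>\<omega>. Q n j \<omega> * Q n i \<omega>)) \<longlonglongrightarrow> C $ i $ j"
      unfolding Q_def using assms(14) by blast
    show "\<forall>\<^sub>F n in sequentially. M.expectation (\<lambda>\<omega>. Q n j \<omega> * Q n i \<omega>) = M.expectation (\<lambda>\<omega>. W (V n) (c n j) \<omega> * W (V n) (c n i) \<omega>)"
      using QW_ev by eventually_elim simp
  qed
  have var_lim: "(\<lambda>n. M.expectation (\<lambda>\<omega>. (W (V n) (c n j) \<omega>)\<^sup>2)) \<longlonglongrightarrow> C $ j $ j" for j
    using cov[of j j] by (simp add: power2_eq_square)
  have quad: "axis j u \<bullet> (C *v axis j u) = u\<^sup>2 * C $ j $ j" for j u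
  proof -
    have "axis j u = u *\<^sub>R axis j (1::real)" by (simp add: vec_eq_iff axis_def)
    then show ?thesis
      by (simp add: matrix_vector_mult_scaleR matrix_vector_mult_basis inner_axis' column_def power2_eq_square)
  qed
  have Cpos: "C $ j $ j > 0" for j
  proof -
    have "axis j (1::real) \<noteq> 0" by simp
    then have "0 < axis j 1 \<bullet> (C *v axis j 1)" using assms(13) unfolding sym_pos_def_def by blast
    then show ?thesis by (simp add: quad)
  qed
  define \<sigma> where "\<sigma> j = sqrt (C $ j $ j)" for j
  have \<sigma>: "\<sigma> j > 0" "(\<sigma> j)\<^sup>2 = C $ j $ j" for j using Cpos[of j] by (simp_all add: \<sigma>_def)
  let ?\<mu> = "\<lambda>n. distr M borel (\<lambda>\<omega>. \<chi> j. Q n j \<omega>)"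
  note gauss = centered_gaussian_char[OF assms(13)]
  have Qvm [measurable]: "(\<lambda>\<omega>. \<chi> j. Q n j \<omega>) \<in> borel_measurable M" for n
    by (rule borel_measurable_vec_lambda) (rule Qm)
  have \<mu>: "prob_space (?\<mu> n)" "sets (?\<mu> n) = sets borel" for n
    by (rule M.prob_space_distr, rule Qvm) simp
  have char_\<mu>: "(\<integral>x. iexp (t \<bullet> x) \<partial>?\<mu> n) = (\<integral>\<omega>. iexp (\<Sum>j\<in>UNIV. t $ j * Q n j \<omega>) \<partial>M)" for n t
  proof -
    have "(\<integral>x. iexp (t \<bullet> x) \<partial>?\<mu> n) = (\<integral>\<omega>. iexp (t \<bullet> (\<chi> j. Q n j \<omega>)) \<partial>M)"
      by (rule integral_distr) (rule Qvm, measurable)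
    then show ?thesis by (simp add: inner_vec_def)
  qed
  \<comment> \<open>The characteristic function of a marginal is the joint one along a coordinate
    axis, which ties statement (i) to statement (ii).\<close>
  have char_Q: "char (distr M borel (Q n j)) u = (\<integral>x. iexp (axis j u \<bullet> x) \<partial>?\<mu> n)" for n j u
  proof -
    have "(\<Sum>i\<in>UNIV. axis j u $ i * Q n i \<omega>) = u * Q n j \<omega>" for \<omega>
      by (simp add: axis_def if_distrib[of "\<lambda>z. z * _"] cong: if_cong)
    then show ?thesis unfolding char_\<mu> char_def by (subst integral_distr) auto
  qed
  have RD: "real_distribution (distr M borel (Q n j))" for n j
    by (rule M.real_distribution_distr) (rule Qm)
  have ND: "real_distribution (density lborel (normal_density 0 (\<sigma> j)))" for j
    using prob_space_normal_density[OF \<sigma>(1)] by (auto simp: real_distribution_def real_distribution_axioms_def)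
  have "(\<forall>j. weak_conv_m (\<lambda>n. distr M borel (Q n j)) (density lborel (normal_density 0 (\<sigma> j))))
     \<longleftrightarrow> weak_conv_bc ?\<mu> (centered_gaussian C)"
  proof
    assume wc: "\<forall>j. weak_conv_m (\<lambda>n. distr M borel (Q n j)) (density lborel (normal_density 0 (\<sigma> j)))"
    have wcW: "weak_conv_m (\<lambda>n. distr M borel (W (V n) (c n j))) (density lborel (normal_density 0 (\<sigma> j)))" for j
      unfolding weak_conv_m_def weak_conv_def
    proof (intro allI impI)
      fix x assume "isCont (cdf (density lborel (normal_density 0 (\<sigma> j)))) x"
      then have lim: "(\<lambda>n. cdf (distr M borel (Q n j)) x) \<longlonglongrightarrow> cdf (density lborel (normal_density 0 (\<sigma> j))) x"
        using wc unfolding weak_conv_m_def weak_conv_def by blast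
      have "\<forall>\<^sub>F n in sequentially. cdf (distr M borel (Q n j)) x = cdf (distr M borel (W (V n) (c n j))) x"
        using QW_ev
      proof eventually_elim
        case (elim n)
        then have "Q n j = W (V n) (c n j)" by blast
        then show ?case by simp
      qed
      then show "(\<lambda>n. cdf (distr M borel (W (V n) (c n j))) x) \<longlonglongrightarrow> cdf (density lborel (normal_density 0 (\<sigma> j))) x"
        by (rule Lim_transform_eventually[OF lim])
    qed
    \<comment> \<open>The only use of marginal convergence: from here on the argument concerns the
      coefficients and the covariances alone.\<close>
    have mid: "(\<lambda>n. mid_norm (V n) d (c n j)) \<longlonglongrightarrow> 0" for j
    proof (rule mid_norm_tendsto_0[where q = q and \<sigma> = "\<sigma> j" and Kq = "\<integral>\<omega>. \<bar>Z \<omega>\<bar> powr q \<partial>N"])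
      show "(\<lambda>n. M.expectation (\<lambda>\<omega>. (W (V n) (c n j) \<omega>)\<^sup>2)) \<longlonglongrightarrow> (\<sigma> j)\<^sup>2" using var_lim \<sigma> by simp
    qed (use V ch assms(1) \<kappa> \<epsilon> Xp \<sigma> wcW in \<open>auto simp: q_def\<close>)
    have lim: "(\<lambda>n. \<integral>\<omega>. iexp (\<Sum>j\<in>UNIV. t $ j * W (V n) (c n j) \<omega>) \<partial>M) \<longlonglongrightarrow> exp (- (t \<bullet> (C *v t)) / 2)" for t
      by (rule char_fun_tendsto[where K = "\<integral>\<omega>. \<bar>Z \<omega>\<bar> powr 3 \<partial>N", OF V ch assms(1) \<kappa> _ _ cov mid])
         (use Xp[of _ 3] \<epsilon> in \<open>auto simp: q_def\<close>)
    show "weak_conv_bc ?\<mu> (centered_gaussian C)"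
    proof (rule weak_conv_bc_if_char_conv[OF \<mu> gauss(1,2)])
      fix t :: "real^'m"
      show "(\<lambda>n. \<integral>x. iexp (t \<bullet> x) \<partial>?\<mu> n) \<longlonglongrightarrow> (\<integral>x. iexp (t \<bullet> x) \<partial>centered_gaussian C)"
        unfolding char_\<mu> gauss(3)
      proof (rule Lim_transform_eventually[OF lim])
        show "\<forall>\<^sub>F n in sequentially. (\<integral>\<omega>. iexp (\<Sum>j\<in>UNIV. t $ j * W (V n) (c n j) \<omega>) \<partial>M) = (\<integral>\<omega>. iexp (\<Sum>j\<in>UNIV. t $ j * Q n j \<omega>) \<partial>M)"
          using QW_ev by eventually_elim (simp only:)
      qed
    next
      fix e :: real assume "e > 0"
      have "\<forall>\<^sub>F n in sequentially. integrable M (\<lambda>\<omega>. (Q n j \<omega>)\<^sup>2) \<and> (\<integral>\<omega>. (Q n j \<omega>)\<^sup>2 \<partial>M) \<le> C $ j $ j + 1" for j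
      proof -
        have "\<forall>\<^sub>F n in sequentially. M.expectation (\<lambda>\<omega>. (W (V n) (c n j) \<omega>)\<^sup>2) < C $ j $ j + 1"
          by (rule order_tendstoD[OF var_lim]) simp
        then show ?thesis using QW_ev
        proof eventually_elim
          case (elim n)
          then have "Q n j = W (V n) (c n j)" by blast
          then show ?case using elim(1) multilinear_second_moment(1)[OF V, of n "c n j"] by simp
        qed
      qed
      then show "\<exists>L. \<forall>\<^sub>F n in sequentially. measure (?\<mu> n) {x. \<exists>j. L < \<bar>x $ j\<bar>} \<le> e"
        by (rule tight_if_second_moment_bounded[OF assms(9) Qm _ \<open>e > 0\<close>])
    qed
  next
    assume wc: "weak_conv_bc ?\<mu> (centered_gaussian C)"
    show "\<forall>j. weak_conv_m (\<lambda>n. distr M borel (Q n j)) (density lborel (normal_density 0 (\<sigma> j)))"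
    proof
      fix j
      show "weak_conv_m (\<lambda>n. distr M borel (Q n j)) (density lborel (normal_density 0 (\<sigma> j)))"
      proof (rule levy_continuity[OF RD ND])
        fix u
        have "char (density lborel (normal_density 0 (\<sigma> j))) u = (\<integral>x. iexp (axis j u \<bullet> x) \<partial>centered_gaussian C)"
          unfolding gauss(3) char_normal_density[OF \<sigma>(1)] quad power_mult_distrib \<sigma>(2) by (simp add: mult.commute)
        then show "(\<lambda>n. char (distr M borel (Q n j)) u) \<longlonglongrightarrow> char (density lborel (normal_density 0 (\<sigma> j))) u"
          unfolding char_Q using weak_conv_bc_char[OF wc \<mu> gauss(1,2), of "axis j u"] by (simp only:)
      qed
    qed
  qed
  then show ?thesis unfolding Q_def \<sigma>_def .
qed

end
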